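(* Let $X$ be a finite dimensional Banach space with Haar measure $\lambda$, let $Y$ be a separable Banach space, let $f:X\to\mathcal{Q}_Q(Y)$ be Lipschitz continuous, and assume that $Y$ has the Radon-Nikodým property. Let the space $\mathrm{Hom}(X,Y)$ of linear operators $X\to Y$ be equipped with some norm $|||\cdot|||$, which is the norm used in the definition of $|Df(a)|$ below. Then: (A) For $\lambda$-almost every $a\in X$, $f$ is unambiguously approximately differentiable at $a$, and $Af(a)(a)=f(a)$. (B) The map $X\to\mathcal{Q}_Q(\mathrm{Hom}(X,Y)):x\mapsto Df(x)$ (defined at the points where $f$ is approximately differentiable, hence $\lambda$-almost everywhere) is Borel measurable. (C) If $f$ is approximately differentiable at $a\in X$ then it is differentiable at $a$ in the sense that $$\lim_{x\to a}\frac{\mathcal{G}(f(x),Af(a)(x))}{\|x-a\|}=0,$$ and $|Df(a)|\le\sqrt{Q}\,\mathrm{Lip} f$. (D) For every injective Lipschitz curve $\gamma:[0,1]\to X$ such that $\|\gamma'(t)\|=1$ and $f$ is approximately differentiable at $\gamma(t)$ for $\mathcal{L}^1$-almost every $0\le t\le1$, one has $$\mathcal{G}(f(\gamma(1)),f(\gamma(0)))\le\int_{\mathrm{im}\,\gamma}|Df(x)|\,d\mathcal{H}^1(x).$$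
   Context: $Q\ge1$ is an integer. For a metric space $(Z,d)$, $\mathcal{Q}_Q(Z)$ is the quotient of $Z^Q$ by the permutation action of the symmetric group $S_Q$; the class of $(z_1,\dots,z_Q)$ is $[\![z_1,\dots,z_Q]\!]$. It carries the metric $\mathcal{G}([\![z_1,\dots,z_Q]\!],[\![z_1',\dots,z_Q']\!])=\min_{\sigma\in S_Q}\big(\sum_{i=1}^Q d(z_i,z'_{\sigma(i)})^2\big)^{1/2}$, and $\mathrm{Lip} f$ is the Lipschitz constant of $f$ with respect to this metric. $\mathcal{L}^1$ is Lebesgue measure on $\mathbb{R}$ and $\mathcal{H}^1$ is one-dimensional Hausdorff measure. A map $g:X\to\mathcal{Q}_Q(Y)$ is affine if $g(x)=[\![A_1(x),\dots,A_Q(x)]\!]$ for affine maps $A_i:X\to Y$; the unordered tuple of the $A_i$ is uniquely determined by $g$. A Borel map $f:X\to\mathcal{Q}_Q(Y)$ is approximately differentiable at $a$ if there is an affine $g:X\to\mathcal{Q}_Q(Y)$ such that for every $\varepsilon>0$ the set $E_\varepsilon=\{x:\mathcal{G}(f(x),g(x))>\varepsilon\|x-a\|\}$ has density zero at $a$, i.e. $\lambda(E_\varepsilon\cap B(a,r))/\lambda(B(a,r))\to0$ as $r\to0$, where $B(a,r)$ is the ball of center $a$ and radius $r$; such $g$ is unique and denoted $Af(a)$. Writing $Af(a)=[\![A_1,\dots,A_Q]\!]$ and $L_i=A_i-A_i(0)$ (the linear parts), put $Df(a)=[\![L_1,\dots,L_Q]\!]\in\mathcal{Q}_Q(\mathrm{Hom}(X,Y))$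 and $|Df(a)|=\big(\sum_{i=1}^Q|||L_i|||^2\big)^{1/2}$. $f$ is unambiguously approximately differentiable at $a$ if it is approximately differentiable at $a$ and, for all $i,j=1,\dots,Q$, $A_i(a)=A_j(a)$ implies $L_i=L_j$.
   Formalization: For an arbitrary norm on Hom(X,Y) the bound in (C) and inequality (D) fail (Q=1, f linear, twice or half the operator norm). Here |||·||| is assumed continuous for the operator norm, at most the operator norm for the bound in (C), and at least the operator norm for (D). *)

theory Defs
  imports "HOL-Analysis.Analysis" "HOL-Library.Multiset" "HOL-Combinatorics.Permutations"
begin

section \<open>Unordered \<open>Q\<close>-tuples and their metric\<close>

text \<open>
  The class of \<open>(z\<^sub>1, \<dots>, z\<^sub>Q)\<close> modulo permutations of the indices is the multiset
  \<open>mset [z\<^sub>1, \<dots>, z\<^sub>Q]\<close>; the quotient of the \<open>Q\<close>-fold product by the symmetric group is the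
  set of multisets of size \<open>Q\<close>.
\<close>

definition qtuples :: "nat \<Rightarrow> 'z multiset set" where
  "qtuples Q = {M. size M = Q}"

text \<open>
  The minimum is formally taken over all enumerations of the two multisets as well as over all
  permutations; by \<open>qdist_mset\<close> below the enumerations do not matter. The value for
  multisets of different sizes is irrelevant and is set to 0, because
  \<^locale>\<open>Metric_space\<close> asks for symmetry outside the carrier too.
\<close>

definition qcost :: "('z \<Rightarrow> 'z \<Rightarrow> real) \<Rightarrow> 'z list \<Rightarrow> 'z list \<Rightarrow> (nat \<Rightarrow> nat) \<Rightarrow> real" where
  "qcost d xs ys \<sigma> = sqrt (\<Sum>i<length xs. (d (xs ! i) (ys ! \<sigma> i))\<^sup>2)"

definition qdist :: "('z \<Rightarrow> 'z \<Rightarrow> real) \<Rightarrow> 'z multiset \<Rightarrow> 'z multiset \<Rightarrow> real" where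
  "qdist d M N =
     (if size M = size N
      then Min {qcost d xs ys \<sigma> | xs ys \<sigma>.
                  mset xs = M \<and> mset ys = N \<and> \<sigma> permutes {..<size M}}
      else 0)"

lemma qcost_change_enumeration:
  assumes "mset xs' = mset xs" "mset ys' = mset ys" "length xs = length ys"
    and \<sigma>: "\<sigma> permutes {..<length xs}"
  shows "\<exists>\<tau>. \<tau> permutes {..<length xs} \<and> qcost d xs' ys' \<sigma> = qcost d xs ys \<tau>"
proof -
  obtain p where p: "p permutes {..<length xs}" "permute_list p xs = xs'"
    using mset_eq_permutation[OF assms(1)] by blast
  obtain q where q: "q permutes {..<length ys}" "permute_list q ys = ys'"
    using mset_eq_permutation[OF assms(2)] by blast
  let ?\<tau> = "q \<circ> \<sigma> \<circ> inv p"
  have \<tau>: "?\<tau> permutes {..<length xs}"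
    using p(1) q(1) \<sigma> assms(3) by (simp add: permutes_compose permutes_inv)
  have len: "length xs' = length xs"
    using assms(1) by (metis size_mset)
  have "(\<Sum>i<length xs. (d (xs ! i) (ys ! ?\<tau> i))\<^sup>2)
      = (\<Sum>i<length xs. (d (xs ! p i) (ys ! ?\<tau> (p i)))\<^sup>2)"
    using sum.permute[OF p(1), of "\<lambda>i. (d (xs ! i) (ys ! ?\<tau> i))\<^sup>2"] by (simp add: o_def)
  also have "\<dots> = (\<Sum>i<length xs'. (d (xs' ! i) (ys' ! \<sigma> i))\<^sup>2)"
    unfolding len
  proof (rule sum.cong)
    fix i assume "i \<in> {..<length xs}"
    then have i: "i < length xs" "\<sigma> i < length ys"
      using permutes_in_image[OF \<sigma>, of i] assms(3) by auto
    have "xs' ! i = xs ! p i"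
      using p i by (metis permute_list_nth)
    moreover have "ys' ! \<sigma> i = ys ! q (\<sigma> i)"
      using q i by (metis permute_list_nth)
    moreover have "?\<tau> (p i) = q (\<sigma> i)"
      using permutes_inverses[OF p(1)] by simp
    ultimately show "(d (xs ! p i) (ys ! ?\<tau> (p i)))\<^sup>2 = (d (xs' ! i) (ys' ! \<sigma> i))\<^sup>2"
      by simp
  qed simp
  finally show ?thesis
    using \<tau> unfolding qcost_def by auto
qed

lemma qdist_mset:
  assumes "length xs = length ys"
  shows "qdist d (mset xs) (mset ys) = Min (qcost d xs ys ` {\<sigma>. \<sigma> permutes {..<length xs}})"
proof -
  have "{qcost d xs' ys' \<sigma> | xs' ys' \<sigma>.
           mset xs' = mset xs \<and> mset ys' = mset ys \<and> \<sigma> permutes {..<length xs}}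
      = qcost d xs ys ` {\<sigma>. \<sigma> permutes {..<length xs}}"
    using qcost_change_enumeration[OF _ _ assms] by blast
  then show ?thesis
    using assms by (simp add: qdist_def)
qed

lemma qdist_le:
  assumes "length xs = length ys" "\<sigma> permutes {..<length xs}"
  shows "qdist d (mset xs) (mset ys) \<le> qcost d xs ys \<sigma>"
  unfolding qdist_mset[OF assms(1)] using assms(2) by (intro Min_le) (auto simp: finite_permutations)

lemma qdist_attained:
  assumes "length xs = length ys"
  obtains \<sigma> where "\<sigma> permutes {..<length xs}" "qdist d (mset xs) (mset ys) = qcost d xs ys \<sigma>"
proof -
  have "Min (qcost d xs ys ` {\<sigma>. \<sigma> permutes {..<length xs}})
      \<in> qcost d xs ys ` {\<sigma>. \<sigma> permutes {..<length xs}}"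
    by (intro Min_in) (auto simp: finite_permutations intro: exI[of _ id] permutes_id)
  with that show thesis
    unfolding qdist_mset[OF assms] by auto
qed

lemma qdist_attained_aligned:
  assumes "size M = size N" "mset xs = M"
  obtains ys where "mset ys = N" "length ys = length xs"
    "qdist d M N = L2_set (\<lambda>i. d (xs ! i) (ys ! i)) {..<length xs}"
proof -
  obtain zs where zs: "mset zs = N" using ex_mset by blast
  have len: "length xs = length zs" using assms zs by (metis size_mset)
  obtain \<sigma> where \<sigma>: "\<sigma> permutes {..<length xs}" "qdist d M N = qcost d xs zs \<sigma>"
    using qdist_attained[OF len, of d] assms(2) zs by metis
  have "mset (permute_list \<sigma> zs) = N"
    using \<sigma>(1) len zs by simp
  moreover have "qcost d xs zs \<sigma> = L2_set (\<lambda>i. d (xs ! i) (permute_list \<sigma> zs ! i)) {..<length xs}"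
    unfolding qcost_def L2_set_def using \<sigma>(1) len by (simp add: permute_list_nth)
  ultimately show thesis
    using that[of "permute_list \<sigma> zs"] \<sigma>(2) len by simp
qed

lemma qdist_le_aligned:
  assumes "length xs = length ys"
  shows "qdist d (mset xs) (mset ys) \<le> L2_set (\<lambda>i. d (xs ! i) (ys ! i)) {..<length xs}"
  using qdist_le[OF assms permutes_id] by (simp add: qcost_def L2_set_def)

lemma Metric_space_qdist:
  assumes "Metric_space UNIV d"
  shows "Metric_space (qtuples Q) (qdist d)"
proof -
  interpret d: Metric_space UNIV d by fact
  have nn: "0 \<le> qdist d M N" for M N
  proof (cases "size M = size N")
    case True
    obtain xs where "mset xs = M" using ex_mset by blast
    with True show ?thesis
      by (metis qdist_attained_aligned L2_set_nonneg)
  qed (simp add: qdist_def)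
  have le: "qdist d M N \<le> qdist d N M" for M N
  proof (cases "size M = size N")
    case True
    obtain ys where ys: "mset ys = N" using ex_mset by blast
    obtain xs where xs: "mset xs = M" "length xs = length ys"
      "qdist d N M = L2_set (\<lambda>i. d (ys ! i) (xs ! i)) {..<length ys}"
      using qdist_attained_aligned[OF True[symmetric] ys] by metis
    then show ?thesis
      using qdist_le_aligned[OF xs(2), of d] ys by (simp add: d.commute)
  qed (simp add: qdist_def)
  show ?thesis
  proof
    show "0 \<le> qdist d M N" for M N by (rule nn)
    show "qdist d M N = qdist d N M" for M N using le by (simp add: order.antisym)
  next
    fix M N :: "'a multiset"
    assume MN: "M \<in> qtuples Q" "N \<in> qtuples Q"
    then have sz: "size M = size N" by (simp add: qtuples_def)
    obtain xs where xs: "mset xs = M" using ex_mset by blast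
    obtain ys where ys: "mset ys = N" "length ys = length xs"
      "qdist d M N = L2_set (\<lambda>i. d (xs ! i) (ys ! i)) {..<length xs}"
      using qdist_attained_aligned[OF sz xs] by metis
    show "qdist d M N = 0 \<longleftrightarrow> M = N"
    proof
      assume "qdist d M N = 0"
      then have "\<forall>i<length xs. d (xs ! i) (ys ! i) = 0"
        using ys(3) by (simp add: L2_set_eq_0_iff)
      then have "xs = ys" using ys(2) by (simp add: list_eq_iff_nth_eq)
      then show "M = N" using xs ys by simp
    next
      assume "M = N"
      then have "qdist d M N \<le> 0"
        using qdist_le_aligned[of xs xs d] xs by (simp add: L2_set_def)
      then show "qdist d M N = 0" using nn[of M N] by simp
    qed
  next
    fix M N K :: "'a multiset"
    assume MNK: "M \<in> qtuples Q" "N \<in> qtuples Q" "K \<in> qtuples Q"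
    then have sz: "size M = size N" "size N = size K" by (simp_all add: qtuples_def)
    obtain xs where xs: "mset xs = M" using ex_mset by blast
    obtain ys where ys: "mset ys = N" "length ys = length xs"
      "qdist d M N = L2_set (\<lambda>i. d (xs ! i) (ys ! i)) {..<length xs}"
      using qdist_attained_aligned[OF sz(1) xs] by metis
    obtain zs where zs: "mset zs = K" "length zs = length ys"
      "qdist d N K = L2_set (\<lambda>i. d (ys ! i) (zs ! i)) {..<length ys}"
      using qdist_attained_aligned[OF sz(2) ys(1)] by metis
    have "qdist d M K \<le> L2_set (\<lambda>i. d (xs ! i) (zs ! i)) {..<length xs}"
      using qdist_le_aligned[of xs zs d] xs ys zs by simp
    also have "\<dots> \<le> L2_set (\<lambda>i. d (xs ! i) (ys ! i) + d (ys ! i) (zs ! i)) {..<length xs}"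
      by (intro L2_set_mono) (auto intro: d.triangle)
    also have "\<dots> \<le> qdist d M N + qdist d N K"
      using L2_set_triangle_ineq[of "\<lambda>i. d (xs ! i) (ys ! i)" "\<lambda>i. d (ys ! i) (zs ! i)" "{..<length xs}"]
        ys zs by simp
    finally show "qdist d M K \<le> qdist d M N + qdist d N K" .
  qed
qed

definition qborel :: "nat \<Rightarrow> ('z \<Rightarrow> 'z \<Rightarrow> real) \<Rightarrow> 'z multiset measure" where
  "qborel Q d = sigma (qtuples Q)
     {U. openin (Metric_space.mtopology (qtuples Q) (qdist d)) U}"

definition qlipschitz :: "('x::metric_space \<Rightarrow> 'y::metric_space multiset) \<Rightarrow> bool" where
  "qlipschitz f \<longleftrightarrow> (\<exists>C\<ge>0. \<forall>x x'. qdist dist (f x) (f x') \<le> C * dist x x')"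

definition qLip :: "('x::metric_space \<Rightarrow> 'y::metric_space multiset) \<Rightarrow> real" where
  "qLip f = Inf {C. 0 \<le> C \<and> (\<forall>x x'. qdist dist (f x) (f x') \<le> C * dist x x')}"


section \<open>Haar measure, norms, and the Radon-Nikodym property\<close>

definition finite_dimensional :: "'x::real_vector itself \<Rightarrow> bool" where
  "finite_dimensional _ \<longleftrightarrow> (\<exists>B::'x set. finite B \<and> span B = UNIV)"

definition haar_measure :: "'x::real_normed_vector measure \<Rightarrow> bool" where
  "haar_measure \<mu> \<longleftrightarrow>
     sets \<mu> = sets borel \<and>
     (\<forall>a. distr \<mu> borel (\<lambda>x. a + x) = \<mu>) \<and>
     (\<forall>K. compact K \<longrightarrow> emeasure \<mu> K < \<infinity>) \<and>
     emeasure \<mu> UNIV \<noteq> 0"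

definition is_norm :: "('v::real_vector \<Rightarrow> real) \<Rightarrow> bool" where
  "is_norm \<nu> \<longleftrightarrow>
     (\<forall>v. 0 \<le> \<nu> v) \<and> (\<forall>v. \<nu> v = 0 \<longleftrightarrow> v = 0) \<and>
     (\<forall>c v. \<nu> (c *\<^sub>R v) = \<bar>c\<bar> * \<nu> v) \<and>
     (\<forall>v w. \<nu> (v + w) \<le> \<nu> v + \<nu> w)"

definition vector_measure :: "'w measure \<Rightarrow> ('w set \<Rightarrow> 'y::real_normed_vector) \<Rightarrow> bool" where
  "vector_measure M \<nu> \<longleftrightarrow>
     (\<forall>A::nat \<Rightarrow> 'w set. range A \<subseteq> sets M \<longrightarrow> disjoint_family A \<longrightarrow>
        (\<lambda>n. \<nu> (A n)) sums \<nu> (\<Union>n. A n))"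

definition bounded_variation :: "'w measure \<Rightarrow> ('w set \<Rightarrow> 'y::real_normed_vector) \<Rightarrow> bool" where
  "bounded_variation M \<nu> \<longleftrightarrow>
     (\<exists>C. \<forall>P. finite P \<longrightarrow> P \<subseteq> sets M \<longrightarrow> disjoint P \<longrightarrow> (\<Sum>A\<in>P. norm (\<nu> A)) \<le> C)"

text \<open>
  Every vector measure of bounded variation that is absolutely continuous with respect to a
  finite measure has a Bochner integrable density. A definition cannot quantify over the type of
  the underlying space, so the finite measures range over all sigma-algebras of subsets of the
  reals; this loses nothing, since Lebesgue measure on the unit interval alone already suffices.
\<close>

definition radon_nikodym_property :: "'y::{banach, second_countable_topology} itself \<Rightarrow> bool" where
  "radon_nikodym_property _ \<longleftrightarrow>
     (\<forall>(M::real measure) (\<nu>::real set \<Rightarrow> 'y).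
        finite_measure M \<longrightarrow> vector_measure M \<nu> \<longrightarrow> bounded_variation M \<nu> \<longrightarrow>
        (\<forall>A\<in>null_sets M. \<nu> A = 0) \<longrightarrow>
        (\<exists>h. integrable M h \<and> (\<forall>A\<in>sets M. \<nu> A = (LINT w:A|M. h w))))"


section \<open>Approximate differentiability\<close>

text \<open>
  These notions are used for finite-dimensional domains only, where all linear maps are bounded;
  so affine maps have a bounded linear part, and the space of linear operators is
  the library's type of bounded linear functions.
\<close>

definition affine_map :: "('x::real_normed_vector \<Rightarrow> 'y::real_normed_vector) \<Rightarrow> bool" where
  "affine_map A \<longleftrightarrow> bounded_linear (\<lambda>x. A x - A 0)"

definition linear_part ::
    "('x::real_normed_vector \<Rightarrow> 'y::real_normed_vector) \<Rightarrow> 'x \<Rightarrow>\<^sub>L 'y" where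
  "linear_part A = Blinfun (\<lambda>x. A x - A 0)"

text \<open>An affine \<open>Q\<close>-valued map is given by the multiset of its affine branches.\<close>

definition qeval :: "('x \<Rightarrow> 'y) multiset \<Rightarrow> 'x \<Rightarrow> 'y multiset" where
  "qeval As x = image_mset (\<lambda>A. A x) As"

definition density_zero :: "'x::metric_space measure \<Rightarrow> 'x set \<Rightarrow> 'x \<Rightarrow> bool" where
  "density_zero \<mu> E a \<longleftrightarrow>
     ((\<lambda>r. measure \<mu> (E \<inter> cball a r) / measure \<mu> (cball a r)) \<longlongrightarrow> 0) (at_right 0)"

text \<open>
  Meant for Borel \<open>f\<close> (in particular Lipschitz \<open>f\<close>), so that the exceptional sets are
  Borel.
\<close>

definition is_approx_affine ::
    "nat \<Rightarrow> 'x::real_normed_vector measure \<Rightarrow> ('x \<Rightarrow> 'y::real_normed_vector multiset) \<Rightarrow> 'x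
      \<Rightarrow> ('x \<Rightarrow> 'y) multiset \<Rightarrow> bool" where
  "is_approx_affine Q \<mu> f a As \<longleftrightarrow>
     size As = Q \<and> (\<forall>A\<in>#As. affine_map A) \<and>
     (\<forall>\<epsilon>>0. density_zero \<mu> {x. qdist dist (f x) (qeval As x) > \<epsilon> * norm (x - a)} a)"

definition approx_differentiable ::
    "nat \<Rightarrow> 'x::real_normed_vector measure \<Rightarrow> ('x \<Rightarrow> 'y::real_normed_vector multiset) \<Rightarrow> 'x \<Rightarrow> bool"
  where
  "approx_differentiable Q \<mu> f a \<longleftrightarrow> (\<exists>As. is_approx_affine Q \<mu> f a As)"

definition approx_affine ::
    "nat \<Rightarrow> 'x::real_normed_vector measure \<Rightarrow> ('x \<Rightarrow> 'y::real_normed_vector multiset) \<Rightarrow> 'x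
      \<Rightarrow> ('x \<Rightarrow> 'y) multiset" where
  "approx_affine Q \<mu> f a = (THE As. is_approx_affine Q \<mu> f a As)"

definition approx_deriv ::
    "nat \<Rightarrow> 'x::real_normed_vector measure \<Rightarrow> ('x \<Rightarrow> 'y::real_normed_vector multiset) \<Rightarrow> 'x
      \<Rightarrow> ('x \<Rightarrow>\<^sub>L 'y) multiset" where
  "approx_deriv Q \<mu> f a = image_mset linear_part (approx_affine Q \<mu> f a)"

definition approx_deriv_norm ::
    "(('x \<Rightarrow>\<^sub>L 'y) \<Rightarrow> real) \<Rightarrow> nat \<Rightarrow> 'x::real_normed_vector measure
      \<Rightarrow> ('x \<Rightarrow> 'y::real_normed_vector multiset) \<Rightarrow> 'x \<Rightarrow> real" where
  "approx_deriv_norm \<nu> Q \<mu> f a = sqrt (\<Sum>L\<in>#approx_deriv Q \<mu> f a. (\<nu> L)\<^sup>2)"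

definition unambiguously_approx_differentiable ::
    "nat \<Rightarrow> 'x::real_normed_vector measure \<Rightarrow> ('x \<Rightarrow> 'y::real_normed_vector multiset) \<Rightarrow> 'x \<Rightarrow> bool"
  where
  "unambiguously_approx_differentiable Q \<mu> f a \<longleftrightarrow>
     approx_differentiable Q \<mu> f a \<and>
     (\<forall>A\<in>#approx_affine Q \<mu> f a. \<forall>B\<in>#approx_affine Q \<mu> f a.
        A a = B a \<longrightarrow> linear_part A = linear_part B)"


section \<open>One-dimensional Hausdorff measure\<close>

text \<open>
  The diameter is extended-valued: \<^const>\<open>diameter\<close> is real-valued and has no
  meaningful value on unbounded sets.
\<close>

definition ediam :: "'x::metric_space set \<Rightarrow> ennreal" where
  "ediam S = (SUP x\<in>S. SUP y\<in>S. ennreal (dist x y))"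

definition hausdorff1_size :: "real \<Rightarrow> 'x::metric_space set \<Rightarrow> ennreal" where
  "hausdorff1_size \<delta> S =
     (INF C\<in>{C::nat \<Rightarrow> 'x set. S \<subseteq> (\<Union>i. C i) \<and> (\<forall>i. ediam (C i) \<le> ennreal \<delta>)}. \<Sum>i. ediam (C i))"

definition hausdorff1 :: "'x::metric_space measure" where
  "hausdorff1 = measure_of UNIV (sets borel) (\<lambda>S. SUP \<delta>\<in>{0<..}. hausdorff1_size \<delta> S)"

end

theory Submission
  imports Defs
begin

text \<open>
  Everything rests on Rademacher's theorem for Lipschitz maps \<open>F : X \<rightarrow> Y\<close>. On the line, the
  difference quotients of a Lipschitz curve define vector measures whose limit has a density by
  the Radon-Nikodym property, and the curve is differentiable at the density points of this density. By Fubini,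
  directional derivatives of \<open>F\<close> exist almost everywhere. Their additivity follows from countably many
  closed sets on which the difference quotients are nearly constant: on each line only countably
  many points of such a set are isolated.

  A \<open>Q\<close>-valued map \<open>f\<close> is reduced to ordinary maps by the sums over \<open>f(x)\<close> of cut-off functions
  \<open>y \<mapsto> \<chi>(y) (y - q)\<close>. On the set where \<open>f\<close> has exactly \<open>m\<close> distinct values these sums determine the
  values locally. The distance to this set is Lipschitz, hence vanishes to first order at almost
  every point of it, so differentiability on the set gives differentiability.

  Approximate and classical differentiability agree because balls are doubling for Haar
  measure. Since finitely many permutations match two tuples of linear maps in all directions, a
  pigeonhole argument yields one permutation for all directions, which gives uniqueness
  and, in its quantitative form, measurability of the derivative. The last inequality compares Lebesgue
  measure on the parameter interval with Hausdorff measure on the image.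
\<close>

section \<open>Finite-dimensional normed spaces\<close>

text \<open>The domain has no preferred coordinates and no product structure, so Fubini is applied
  to translates of a set along one direction and never to a decomposition of the space; density
  theorems are then needed on the line only. Real-valued Lipschitz functions are handled by
  multiplying them with a fixed nonzero vector of \<open>'y\<close>: the vector-valued theorems then
  also serve for distance functions on the domain and for the distance between two values of
  \<open>f\<close> along a curve. This is why a trivial \<open>'y\<close> is treated apart. The
  recurring obstacle is that a tuple has no canonical enumeration: every estimate holds up to a
  permutation that may depend on the scale and on the point. No branches are ever selected
  measurably. Instead, two near-affine descriptions of \<open>f\<close> at one point have slopes
  that agree, after one permutation, up to a factor depending on \<open>Q\<close> and the basis
  only. With this uniform constant the derivative is captured by countably many closed sets.\<close>

text \<open>Induction on \<open>I\<close>: a further index turns the box into the continuous image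
  of an interval times the smaller box. The compactness of closed balls rests on this.\<close>

lemma compact_coordinate_box:
  fixes b :: "'i \<Rightarrow> 'a::real_normed_vector"
  assumes "finite I"
  shows "compact {x. \<exists>c. x = (\<Sum>i\<in>I. c i *\<^sub>R b i) \<and> (\<forall>i\<in>I. \<bar>c i\<bar> \<le> R)}"
  using assms
proof (induction I)
  case empty
  have "{x::'a. \<exists>c. x = (\<Sum>i\<in>{}. c i *\<^sub>R b i) \<and> (\<forall>i\<in>{}. \<bar>c i\<bar> \<le> R)} = {0}" by auto
  then show ?case by (metis compact_insert compact_empty)
next
  case (insert k I)
  let ?S = "{x. \<exists>c. x = (\<Sum>i\<in>I. c i *\<^sub>R b i) \<and> (\<forall>i\<in>I. \<bar>c i\<bar> \<le> R)}"
  have "{x. \<exists>c. x = (\<Sum>i\<in>insert k I. c i *\<^sub>R b i) \<and> (\<forall>i\<in>insert k I. \<bar>c i\<bar> \<le> R)}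
     = (\<lambda>(t, s). t *\<^sub>R b k + s) ` ({-R..R} \<times> ?S)" (is "?L = ?R")
  proof
    show "?L \<subseteq> ?R"
    proof
      fix x assume "x \<in> ?L"
      then obtain c where c: "x = (\<Sum>i\<in>insert k I. c i *\<^sub>R b i)" "\<forall>i\<in>insert k I. \<bar>c i\<bar> \<le> R" by blast
      have "x = (\<lambda>(t, s). t *\<^sub>R b k + s) (c k, \<Sum>i\<in>I. c i *\<^sub>R b i)"
        using c(1) insert.hyps by simp
      moreover have "(c k, \<Sum>i\<in>I. c i *\<^sub>R b i) \<in> {-R..R} \<times> ?S"
        using c(2) by (auto simp: abs_le_iff)
      ultimately show "x \<in> ?R" by blast
    qed
  next
    show "?R \<subseteq> ?L"
    proof
      fix x assume "x \<in> ?R"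
      then obtain t c where c: "x = t *\<^sub>R b k + (\<Sum>i\<in>I. c i *\<^sub>R b i)" "\<forall>i\<in>I. \<bar>c i\<bar> \<le> R" "t \<in> {-R..R}"
        by auto
      have "(\<Sum>i\<in>I. (c(k := t)) i *\<^sub>R b i) = (\<Sum>i\<in>I. c i *\<^sub>R b i)"
        using insert.hyps by (intro sum.cong) auto
      then have "x = (\<Sum>i\<in>insert k I. (c(k := t)) i *\<^sub>R b i)"
        using c(1) insert.hyps by simp
      moreover have "\<forall>i\<in>insert k I. \<bar>(c(k := t)) i\<bar> \<le> R" using c(2,3) by (auto simp: abs_le_iff)
      ultimately show "x \<in> ?L" by blast
    qed
  qed
  moreover have "compact ?R"
    by (intro compact_continuous_image compact_Times compact_Icc insert.IH)
      (auto simp: case_prod_unfold intro!: continuous_intros)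
  ultimately show ?case by simp
qed

text \<open>In the induction step the new vector \<open>b\<close> keeps a positive distance
  \<open>d'\<close> from all combinations of \<open>B\<close>: those with coefficients up to
  \<open>R\<close> form a closed set missing \<open>b\<close>, and larger coefficients force, by the
  induction hypothesis, a norm too large to be near \<open>b\<close>.\<close>

lemma coordinates_bounded:
  fixes B :: "'a::real_normed_vector set"
  assumes "finite B" "independent B"
  shows "\<exists>K>0. \<forall>c. \<forall>b\<in>B. \<bar>c b\<bar> \<le> K * norm (\<Sum>b\<in>B. c b *\<^sub>R b)"
  using assms
proof (induction B)
  case empty
  show ?case by (intro exI[of _ 1]) auto
next
  case (insert b B)
  have ind: "independent B" "b \<notin> span B"
    using insert.prems insert.hyps by (auto simp: independent_insert)
  obtain K where K: "K > 0" "\<And>c a. a \<in> B \<Longrightarrow> \<bar>c a\<bar> \<le> K * norm (\<Sum>b\<in>B. c b *\<^sub>R b)"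
    using insert.IH[OF ind(1)] by blast
  \<comment> \<open>A coefficient above \<open>R\<close> gives a combination of norm above
    \<open>2 * norm b + 1\<close>, hence at distance at least 1 from \<open>b\<close>; this is why
    \<open>d'\<close> is capped at 1.\<close>
  define R where "R = K * (2 * norm b + 1)"
  let ?S = "{x. \<exists>c. x = (\<Sum>b\<in>B. c b *\<^sub>R b) \<and> (\<forall>b\<in>B. \<bar>c b\<bar> \<le> R)}"
  have "?S \<subseteq> span B"
  proof safe
    show "(\<Sum>b\<in>B. c b *\<^sub>R b) \<in> span B" for c
      by (intro span_sum span_scale span_base)
  qed
  then have "b \<notin> ?S" using ind(2) by blast
  moreover have "closed ?S" using compact_coordinate_box[OF insert.hyps(1), of "\<lambda>b. b" R] by (rule compact_imp_closed)
  ultimately obtain d where d: "d > 0" "\<And>y. y \<in> ?S \<Longrightarrow> d \<le> dist b y"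
  proof -
    have "open (- ?S)" "b \<in> - ?S" using \<open>closed ?S\<close> \<open>b \<notin> ?S\<close> by auto
    then obtain d where d: "d > 0" "ball b d \<subseteq> - ?S" by (meson open_contains_ball)
    have "d \<le> dist b y" if "y \<in> ?S" for y using d(2) that by (force simp: not_less[symmetric])
    then show thesis using that d(1) by blast
  qed
  define d' where "d' = min d 1"
  have d': "d' > 0" using d by (simp add: d'_def)
  have far: "d' \<le> norm (b - (\<Sum>b\<in>B. c b *\<^sub>R b))" for c
  proof (cases "(\<Sum>b\<in>B. c b *\<^sub>R b) \<in> ?S")
    case True
    show ?thesis using d(2)[OF True] by (simp add: d'_def dist_norm)
  next
    case False
    then obtain a where a: "a \<in> B" "\<bar>c a\<bar> > R" by fastforce
    have "K * (2 * norm b + 1) < K * norm (\<Sum>b\<in>B. c b *\<^sub>R b)"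
      using K(2)[OF a(1), of c] a(2) by (simp add: R_def)
    then have "2 * norm b + 1 < norm (\<Sum>b\<in>B. c b *\<^sub>R b)" using K(1) by simp
    moreover have "norm (\<Sum>b\<in>B. c b *\<^sub>R b) - norm b \<le> norm (b - (\<Sum>b\<in>B. c b *\<^sub>R b))"
      by (metis norm_minus_commute norm_triangle_ineq2)
    ultimately have "1 \<le> norm (b - (\<Sum>b\<in>B. c b *\<^sub>R b))" using norm_ge_zero[of b] by linarith
    then show ?thesis unfolding d'_def by linarith
  qed
  \<comment> \<open>\<open>1 / d'\<close> bounds the coefficient of \<open>b\<close>. Subtracting
    that term leaves a combination of \<open>B\<close> of norm at most
    \<open>(1 + norm b / d') * norm ?x\<close>, to which \<open>K\<close> applies.\<close>
  define K' where "K' = 1 / d' + K * (1 + norm b / d')"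
  have "K' > 0" using d' K(1) by (auto simp: K'_def intro!: add_pos_nonneg)
  moreover have "\<bar>c a\<bar> \<le> K' * norm (\<Sum>a\<in>insert b B. c a *\<^sub>R a)" if a: "a \<in> insert b B" for c a
  proof -
    let ?y = "\<Sum>b\<in>B. c b *\<^sub>R b"
    let ?x = "\<Sum>a\<in>insert b B. c a *\<^sub>R a"
    have x: "?x = c b *\<^sub>R b + ?y" using insert.hyps by simp
    have b1: "\<bar>c b\<bar> * d' \<le> norm ?x"
    proof (cases "c b = 0")
      case False
      have "(\<Sum>a\<in>B. (- c a / c b) *\<^sub>R a) = - (1 / c b) *\<^sub>R ?y"
        by (simp add: scaleR_sum_right divide_inverse mult.commute sum_negf)
      then have "?x = c b *\<^sub>R (b - (\<Sum>a\<in>B. (- c a / c b) *\<^sub>R a))"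
        using False x by (simp add: scaleR_right_distrib)
      then have "norm ?x = \<bar>c b\<bar> * norm (b - (\<Sum>a\<in>B. (- c a / c b) *\<^sub>R a))" by (metis norm_scaleR)
      then show ?thesis using far[of "\<lambda>a. - c a / c b"] by (simp add: mult_left_mono)
    qed simp
    then have b2: "\<bar>c b\<bar> \<le> 1 / d' * norm ?x" using d' by (simp add: field_simps)
    have k0: "0 \<le> K * (1 + norm b / d') * norm ?x" "0 \<le> 1 / d' * norm ?x" using K(1) d' by auto
    show ?thesis
    proof (cases "a = b")
      case True
      have "\<bar>c a\<bar> \<le> 1 / d' * norm ?x" unfolding True by (rule b2)
      then show ?thesis using k0 unfolding K'_def distrib_right by linarith
    next
      case False
      then have "a \<in> B" using a by simp
      have "norm ?y = norm (?x - c b *\<^sub>R b)" using x by simp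
      also have "\<dots> \<le> norm ?x + \<bar>c b\<bar> * norm b" by (metis norm_triangle_ineq4 norm_scaleR)
      also have "\<dots> \<le> norm ?x + (1 / d' * norm ?x) * norm b" using b2 by (intro add_left_mono mult_right_mono) auto
      also have "\<dots> = (1 + norm b / d') * norm ?x" by (simp add: algebra_simps)
      finally have "K * norm ?y \<le> K * (1 + norm b / d') * norm ?x"
        using K(1) by (metis mult.assoc mult_le_cancel_left_pos)
      then show ?thesis using K(2)[OF \<open>a \<in> B\<close>, of c] k0 unfolding K'_def distrib_right by linarith
    qed
  qed
  ultimately show ?case by blast
qed

section \<open>Coordinates with respect to a basis\<close>

text \<open>The bound \<open>coord_le\<close> carries linear independence: a combination equal to 0
  has only zero coefficients. Its quantitative form turns values on the basis into operator
  norms.\<close>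

locale fd_basis =
  fixes b :: "nat \<Rightarrow> 'x::real_normed_vector" and n :: nat and K :: real
  assumes K_pos: "K > 0"
    and spanning: "\<exists>c. x = (\<Sum>i<n. c i *\<^sub>R b i)"
    and coord_le: "i < n \<Longrightarrow> \<bar>c i\<bar> \<le> K * norm (\<Sum>i<n. c i *\<^sub>R b i)"

lemma finite_dimensional_fd_basis:
  assumes "finite_dimensional TYPE('x::real_normed_vector)"
  obtains b :: "nat \<Rightarrow> 'x::real_normed_vector" and n K where "fd_basis b n K"
proof -
  obtain B0 :: "'x::real_normed_vector set" where B0: "finite B0" "span B0 = UNIV"
    using assms by (auto simp: finite_dimensional_def)
  obtain B where B: "B \<subseteq> B0" "independent B" "B0 \<subseteq> span B"
    using maximal_independent_subset[of B0] by metis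
  have fB: "finite B" using B(1) B0(1) by (rule finite_subset)
  have spB: "span B = UNIV" using B(3) B0(2) by (metis span_minimal subspace_span top.extremum_uniqueI)
  obtain K where K: "K > 0" "\<And>c a. a \<in> B \<Longrightarrow> \<bar>c a\<bar> \<le> K * norm (\<Sum>b\<in>B. c b *\<^sub>R b)"
    using coordinates_bounded[OF fB B(2)] by blast
  obtain h where "bij_betw h {0..<card B} B" using ex_bij_betw_nat_finite[OF fB] by blast
  then have h: "bij_betw h {..<card B} B" by (simp add: lessThan_atLeast0)
  have re: "(\<Sum>i<card B. g (h i)) = (\<Sum>b\<in>B. g b)" for g :: "'x \<Rightarrow> 'x"
    by (rule sum.reindex_bij_betw[OF h])
  have "fd_basis h (card B) K"
  proof
    show "K > 0" by (rule K)
  next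
    fix x :: 'x
    have "x \<in> span B" using spB by simp
    then obtain c where "x = (\<Sum>b\<in>B. c b *\<^sub>R b)" using fB by (auto simp: span_finite)
    then have "x = (\<Sum>i<card B. (c \<circ> h) i *\<^sub>R h i)" using re[of "\<lambda>a. c a *\<^sub>R a"] by simp
    then show "\<exists>c. x = (\<Sum>i<card B. c i *\<^sub>R h i)" by blast
  next
    fix i and c :: "nat \<Rightarrow> real" assume i: "i < card B"
    let ?g = "inv_into {..<card B} h"
    have inv: "?g (h j) = j" if "j < card B" for j
      using h that by (simp add: bij_betw_def)
    have "(\<Sum>b\<in>B. c (?g b) *\<^sub>R b) = (\<Sum>i<card B. c (?g (h i)) *\<^sub>R h i)"
      using re[of "\<lambda>a. c (?g a) *\<^sub>R a"] by simp
    also have "\<dots> = (\<Sum>i<card B. c i *\<^sub>R h i)" using inv by (intro sum.cong) auto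
    finally show "\<bar>c i\<bar> \<le> K * norm (\<Sum>i<card B. c i *\<^sub>R h i)"
      using K(2)[of "h i" "\<lambda>a. c (?g a)"] inv[OF i] h i by (simp add: bij_betw_apply)
  qed
  then show thesis by (rule that)
qed

context fd_basis
begin

definition coord :: "'x \<Rightarrow> nat \<Rightarrow> real" where
  "coord x = (SOME c. x = (\<Sum>i<n. c i *\<^sub>R b i))"

lemma sum_coord: "(\<Sum>i<n. coord x i *\<^sub>R b i) = x"
  unfolding coord_def using someI_ex[OF spanning[of x]] by simp

lemma coord_unique:
  assumes "(\<Sum>i<n. c i *\<^sub>R b i) = (\<Sum>i<n. d i *\<^sub>R b i)" "i < n"
  shows "c i = d i"
proof -
  have "(\<Sum>i<n. (c i - d i) *\<^sub>R b i) = 0"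
    using assms(1) by (simp add: scaleR_left_diff_distrib sum_subtractf)
  then show ?thesis using coord_le[OF assms(2), of "\<lambda>i. c i - d i"] by simp
qed

lemma coord_sum: "i < n \<Longrightarrow> coord (\<Sum>i<n. c i *\<^sub>R b i) i = c i"
  by (rule coord_unique) (simp_all add: sum_coord)

lemma coord_add: "i < n \<Longrightarrow> coord (x + y) i = coord x i + coord y i"
  by (rule coord_unique[of "coord (x + y)" "\<lambda>i. coord x i + coord y i"])
    (simp_all add: sum_coord scaleR_left_distrib sum.distrib)

lemma coord_scaleR: "i < n \<Longrightarrow> coord (r *\<^sub>R x) i = r * coord x i"
proof (rule coord_unique[of "coord (r *\<^sub>R x)" "\<lambda>i. r * coord x i"])
  have "(\<Sum>i<n. (r * coord x i) *\<^sub>R b i) = r *\<^sub>R (\<Sum>i<n. coord x i *\<^sub>R b i)"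
    by (simp add: scaleR_sum_right)
  then show "(\<Sum>i<n. coord (r *\<^sub>R x) i *\<^sub>R b i) = (\<Sum>i<n. (r * coord x i) *\<^sub>R b i)"
    by (simp add: sum_coord)
qed

lemma coord_bound: "i < n \<Longrightarrow> \<bar>coord x i\<bar> \<le> K * norm x"
  using coord_le[of i "coord x"] by (simp add: sum_coord)

lemma coord_basis: "i < n \<Longrightarrow> j < n \<Longrightarrow> coord (b j) i = (if i = j then 1 else 0)"
proof -
  assume ij: "i < n" "j < n"
  have "(\<Sum>i<n. (if i = j then 1 else 0) *\<^sub>R b i) = (\<Sum>i<n. if i = j then b i else 0)"
    by (intro sum.cong) auto
  also have "\<dots> = b j" using ij by simp
  finally show ?thesis using coord_sum[OF ij(1), of "\<lambda>i. if i = j then 1 else 0"] by simp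
qed

definition lin_of :: "(nat \<Rightarrow> 'y::real_normed_vector) \<Rightarrow> 'x \<Rightarrow>\<^sub>L 'y" where
  "lin_of w = Blinfun (\<lambda>x. \<Sum>i<n. coord x i *\<^sub>R w i)"

lemma lin_of_bound: "norm (\<Sum>i<n. coord x i *\<^sub>R w i) \<le> norm x * (K * (\<Sum>i<n. norm (w i)))"
proof -
  have "norm (\<Sum>i<n. coord x i *\<^sub>R w i) \<le> (\<Sum>i<n. \<bar>coord x i\<bar> * norm (w i))"
    by (rule order_trans[OF norm_sum]) simp
  also have "\<dots> \<le> (\<Sum>i<n. (K * norm x) * norm (w i))"
    by (intro sum_mono mult_right_mono coord_bound) auto
  finally show ?thesis by (simp add: sum_distrib_left mult.assoc mult.left_commute)
qed

lemma bounded_linear_lin_of: "bounded_linear (\<lambda>x. \<Sum>i<n. coord x i *\<^sub>R w i)"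
proof (rule bounded_linear_intro)
  show "(\<Sum>i<n. coord (x + y) i *\<^sub>R w i) = (\<Sum>i<n. coord x i *\<^sub>R w i) + (\<Sum>i<n. coord y i *\<^sub>R w i)" for x y
    by (simp add: coord_add scaleR_left_distrib sum.distrib)
  show "(\<Sum>i<n. coord (r *\<^sub>R x) i *\<^sub>R w i) = r *\<^sub>R (\<Sum>i<n. coord x i *\<^sub>R w i)" for r x
    by (simp add: coord_scaleR scaleR_sum_right)
  show "norm (\<Sum>i<n. coord x i *\<^sub>R w i) \<le> norm x * (K * (\<Sum>i<n. norm (w i)))" for x
    by (rule lin_of_bound)
qed

lemma lin_of_apply: "blinfun_apply (lin_of w) x = (\<Sum>i<n. coord x i *\<^sub>R w i)"
  unfolding lin_of_def by (simp add: bounded_linear_Blinfun_apply bounded_linear_lin_of)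

lemma lin_of_basis: "i < n \<Longrightarrow> blinfun_apply (lin_of w) (b i) = w i"
proof -
  assume i: "i < n"
  have "(\<Sum>j<n. coord (b i) j *\<^sub>R w j) = (\<Sum>j<n. if j = i then w j else 0)"
    using i by (intro sum.cong) (auto simp: coord_basis)
  then show ?thesis using i by (simp add: lin_of_apply)
qed

lemma lin_of_values: "lin_of (\<lambda>i. blinfun_apply L (b i)) = L"
proof (rule blinfun_eqI)
  fix x
  have "blinfun_apply L x = blinfun_apply L (\<Sum>i<n. coord x i *\<^sub>R b i)" by (simp add: sum_coord)
  also have "\<dots> = (\<Sum>i<n. coord x i *\<^sub>R blinfun_apply L (b i))"
    by (simp add: blinfun.sum_right blinfun.scaleR_right)
  finally show "blinfun_apply (lin_of (\<lambda>i. blinfun_apply L (b i))) x = blinfun_apply L x"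
    by (simp add: lin_of_apply)
qed

lemma norm_blinfun_le_basis:
  "norm (L :: 'x \<Rightarrow>\<^sub>L 'y::real_normed_vector) \<le> K * (\<Sum>i<n. norm (blinfun_apply L (b i)))"
proof (rule norm_blinfun_bound)
  show "0 \<le> K * (\<Sum>i<n. norm (blinfun_apply L (b i)))"
    using K_pos by (simp add: sum_nonneg)
  show "norm (blinfun_apply L x) \<le> K * (\<Sum>i<n. norm (blinfun_apply L (b i))) * norm x" for x
    using lin_of_bound[of x "\<lambda>i. blinfun_apply L (b i)"] lin_of_apply[of "\<lambda>i. blinfun_apply L (b i)" x]
    by (simp add: lin_of_values mult.commute)
qed

text \<open>A ball is a closed subset of the coordinate box with bound
  \<open>K * (norm a + r)\<close>.\<close>

lemma compact_cball: "compact (cball (a::'x) r)"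
proof -
  let ?R = "K * (norm a + r)"
  have sub: "cball a r \<subseteq> {x. \<exists>c. x = (\<Sum>i<n. c i *\<^sub>R b i) \<and> (\<forall>i\<in>{..<n}. \<bar>c i\<bar> \<le> ?R)}"
  proof
    fix x assume "x \<in> cball a r"
    then have "norm (x - a) \<le> r" by (simp add: dist_norm norm_minus_commute)
    then have "norm x \<le> norm a + r" using norm_triangle_sub[of x a] by linarith
    then have "K * norm x \<le> ?R" using K_pos by simp
    then have "\<forall>i<n. \<bar>coord x i\<bar> \<le> ?R" using coord_bound[of _ x] by (meson order_trans)
    then show "x \<in> {x. \<exists>c. x = (\<Sum>i<n. c i *\<^sub>R b i) \<and> (\<forall>i\<in>{..<n}. \<bar>c i\<bar> \<le> ?R)}"
      using sum_coord[of x] by (auto intro!: exI[of _ "coord x"])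
  qed
  have "compact ({x. \<exists>c. x = (\<Sum>i<n. c i *\<^sub>R b i) \<and> (\<forall>i\<in>{..<n}. \<bar>c i\<bar> \<le> ?R)} \<inter> cball a r)"
    by (intro compact_Int_closed compact_coordinate_box finite_lessThan closed_cball)
  moreover have "{x. \<exists>c. x = (\<Sum>i<n. c i *\<^sub>R b i) \<and> (\<forall>i\<in>{..<n}. \<bar>c i\<bar> \<le> ?R)} \<inter> cball a r = cball a r"
    using sub by blast
  ultimately show ?thesis by simp
qed

text \<open>Rational combinations of the basis, because this countable dense set also serves as the
  set of directions for derivatives, where partial sums of an expansion have to stay inside.\<close>

definition ratspan :: "'x set" where
  "ratspan = (\<lambda>xs. \<Sum>i<n. of_rat (xs ! i) *\<^sub>R b i) ` {xs. length xs = n}"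

lemma countable_ratspan: "countable ratspan"
  unfolding ratspan_def by (intro countable_image) simp

lemma ratspanI: "(\<Sum>i<n. of_rat (q i) *\<^sub>R b i) \<in> ratspan"
  unfolding ratspan_def by (intro image_eqI[of _ _ "map q [0..<n]"]) auto

lemma ratspanE:
  assumes "x \<in> ratspan"
  obtains q where "x = (\<Sum>i<n. of_rat (q i) *\<^sub>R b i)"
  using assms unfolding ratspan_def by auto

lemma ratspan_dense:
  assumes "e > 0"
  shows "\<exists>v\<in>ratspan. norm (x - v) < e"
proof -
  \<comment> \<open>The summand 1 keeps the divisor positive and makes the final inequality
    strict.\<close>
  define s where "s = 1 + (\<Sum>i<n. norm (b i))"
  have s: "s > 0" unfolding s_def by (simp add: add_pos_nonneg sum_nonneg)
  have "\<exists>q. \<bar>coord x i - of_rat q\<bar> < e / s" for i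
  proof -
    have "coord x i < coord x i + e / s" using assms s by simp
    then obtain q where "coord x i < of_rat q" "of_rat q < coord x i + e / s"
      using of_rat_dense by blast
    then show ?thesis by (intro exI[of _ q]) auto
  qed
  then obtain q where q: "\<And>i. \<bar>coord x i - of_rat (q i)\<bar> < e / s" by metis
  have "norm (x - (\<Sum>i<n. of_rat (q i) *\<^sub>R b i)) = norm (\<Sum>i<n. (coord x i - of_rat (q i)) *\<^sub>R b i)"
    using sum_coord[of x] by (simp add: scaleR_left_diff_distrib sum_subtractf)
  also have "\<dots> \<le> (\<Sum>i<n. \<bar>coord x i - of_rat (q i)\<bar> * norm (b i))"
    by (rule order_trans[OF norm_sum]) simp
  also have "\<dots> \<le> (\<Sum>i<n. e / s * norm (b i))"
    by (intro sum_mono mult_right_mono[OF less_imp_le[OF q]]) auto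
  also have "\<dots> = e / s * (s - 1)" by (simp add: s_def sum_distrib_left)
  also have "\<dots> < e / s * s" using assms s by (intro mult_strict_left_mono) auto
  also have "\<dots> = e" using s by simp
  finally show ?thesis using ratspanI[of q] by blast
qed

end

section \<open>Haar measure\<close>

context fd_basis
begin

text \<open>The type \<open>'x\<close> is not of a second countable class, so a countable family of
  rectangles is supplied by hand: balls around \<open>ratspan\<close>, each with the largest open
  set \<open>T v k\<close> that keeps the rectangle inside \<open>W\<close>.\<close>

lemma open_in_borel_pair:
  assumes W: "open (W :: ('x \<times> real) set)"
  shows "W \<in> sets (borel \<Otimes>\<^sub>M borel)"
proof -
  define T where "T v k = \<Union>{B. open B \<and> ball v (1 / Suc k) \<times> B \<subseteq> W}" for v :: 'x and k :: nat
  have "W = (\<Union>v\<in>ratspan. \<Union>k. ball v (1 / Suc k) \<times> T v k)" (is "W = ?R")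
  proof
    show "?R \<subseteq> W" unfolding T_def by blast
  next
    show "W \<subseteq> ?R"
    proof
      fix p assume "p \<in> W"
      then obtain A B where AB: "open A" "open B" "p \<in> A \<times> B" "A \<times> B \<subseteq> W"
        using open_prod_elim[OF W] by blast
      obtain e where e: "e > 0" "ball (fst p) e \<subseteq> A"
        using AB(1,3) openE[of A "fst p"] by (auto simp: mem_Times_iff)
      obtain k :: nat where k: "1 / Suc k < e / 2"
        using nat_approx_posE[of "e / 2"] e(1) by auto
      obtain v where v: "v \<in> ratspan" "norm (fst p - v) < 1 / Suc k"
        using ratspan_dense[of "1 / Suc k" "fst p"] by auto
      have "ball v (1 / Suc k) \<subseteq> ball (fst p) e"
      proof
        fix y assume "y \<in> ball v (1 / Suc k)"
        then have "dist v y < 1 / Suc k" "dist (fst p) v < 1 / Suc k" using v(2) by (auto simp: dist_norm)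
        then show "y \<in> ball (fst p) e" using dist_triangle[of "fst p" y v] k by simp
      qed
      then have "ball v (1 / Suc k) \<times> B \<subseteq> W" using AB(4) e(2) by blast
      then have "snd p \<in> T v k" using AB(2,3) unfolding T_def by (auto simp: mem_Times_iff)
      moreover have "fst p \<in> ball v (1 / Suc k)" using v(2) by (simp add: dist_norm norm_minus_commute)
      ultimately have "p \<in> ball v (1 / Suc k) \<times> T v k" by (simp add: mem_Times_iff)
      then show "p \<in> ?R" using v(1) by blast
    qed
  qed
  moreover have "open (T v k)" for v k unfolding T_def by auto
  then have "ball v (1 / Suc k) \<times> T v k \<in> sets (borel \<Otimes>\<^sub>M borel)" for v k
    by (intro pair_measureI) auto
  then have "?R \<in> sets (borel \<Otimes>\<^sub>M borel)"
    by (intro sets.countable_UN''[OF countable_ratspan] sets.countable_UN) auto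
  ultimately show ?thesis by simp
qed

lemma measurable_pair_continuous:
  assumes "continuous_on UNIV (g :: 'x \<times> real \<Rightarrow> 'z::topological_space)"
  shows "g \<in> borel \<Otimes>\<^sub>M borel \<rightarrow>\<^sub>M borel"
proof (rule borel_measurableI)
  fix S :: "'z set" assume "open S"
  then have "open (g -` S)" using assms by (simp add: open_vimage)
  then show "g -` S \<inter> space (borel \<Otimes>\<^sub>M borel) \<in> sets (borel \<Otimes>\<^sub>M borel)"
    by (simp add: space_pair_measure open_in_borel_pair)
qed

text \<open>Compactness is applied to balls around rational points, so that the net consists of
  directions in which derivatives will be known.\<close>

lemma finite_net:
  assumes "e > 0"
  shows "\<exists>Z::'x set. finite Z \<and> cball 0 1 \<subseteq> (\<Union>z\<in>Z. ball z e) \<and> Z \<subseteq> ratspan"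
proof -
  have "cball 0 1 \<subseteq> (\<Union>z\<in>ratspan. ball z e)"
  proof
    fix x :: 'x
    show "x \<in> (\<Union>z\<in>ratspan. ball z e)"
      using ratspan_dense[OF assms, of x] by (auto simp: dist_norm norm_minus_commute)
  qed
  then obtain Z where "Z \<subseteq> ratspan" "finite Z" "cball 0 1 \<subseteq> (\<Union>z\<in>Z. ball z e)"
    using compactE_image[OF compact_cball[of 0 1], of ratspan "\<lambda>z. ball z e"] by auto
  then show ?thesis by blast
qed

end

section \<open>Doubling, sigma-finiteness and Fubini for Haar measure\<close>

locale fd_haar = fd_basis b n K for b :: "nat \<Rightarrow> 'x::real_normed_vector" and n K +
  fixes \<mu> :: "'x measure"
  assumes haar: "haar_measure \<mu>"
begin

lemma sets_mu [measurable_cong, simp]: "sets \<mu> = sets borel"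
  using haar by (simp add: haar_measure_def)

lemma space_mu [simp]: "space \<mu> = UNIV"
  using sets_eq_imp_space_eq[OF sets_mu] by simp

lemma distr_translation: "distr \<mu> borel (\<lambda>x. a + x) = \<mu>"
  using haar by (simp add: haar_measure_def)

lemma emeasure_cball_translation: "emeasure \<mu> (cball a r) = emeasure \<mu> (cball 0 r)"
proof -
  have "emeasure \<mu> (cball a r) = emeasure (distr \<mu> borel (\<lambda>x. a + x)) (cball a r)"
    by (simp add: distr_translation)
  also have "\<dots> = emeasure \<mu> ((\<lambda>x. a + x) -` cball a r \<inter> space \<mu>)"
    by (intro emeasure_distr) (auto intro!: borel_measurable_continuous_onI continuous_intros simp: measurable_cong_sets[OF sets_mu refl])
  also have "(\<lambda>x. a + x) -` cball a r \<inter> space \<mu> = cball 0 r"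
    by (auto simp: dist_norm)
  finally show ?thesis .
qed

lemma nn_integral_translation:
  assumes "g \<in> borel_measurable borel"
  shows "(\<integral>\<^sup>+x. g (x + a) \<partial>\<mu>) = (\<integral>\<^sup>+x. g x \<partial>\<mu>)"
proof -
  have m: "(\<lambda>x. a + x) \<in> \<mu> \<rightarrow>\<^sub>M borel"
    by (auto intro!: borel_measurable_continuous_onI continuous_intros simp: measurable_cong_sets[OF sets_mu refl])
  have "(\<integral>\<^sup>+x. g x \<partial>\<mu>) = (\<integral>\<^sup>+x. g x \<partial>(distr \<mu> borel (\<lambda>x. a + x)))"
    by (simp add: distr_translation)
  also have "\<dots> = (\<integral>\<^sup>+x. g (a + x) \<partial>\<mu>)"
    by (rule nn_integral_distr[OF m]) (use assms in simp)
  finally show ?thesis by (simp add: add.commute)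
qed

lemma emeasure_cball_finite: "emeasure \<mu> (cball a r) < \<infinity>"
  using haar compact_cball by (simp add: haar_measure_def)

text \<open>A finite \<open>e\<close>-net of the unit ball, scaled by \<open>r\<close>, covers a
  ball of radius \<open>r\<close> by translates of one ball of radius \<open>e * r\<close>. So
  \<open>N\<close> depends on \<open>e\<close> only, and the centres are free by translation
  invariance.\<close>

lemma emeasure_cball_scale:
  assumes "e > 0"
  obtains N :: nat where "N > 0"
    "\<And>r a c. r > 0 \<Longrightarrow> emeasure \<mu> (cball a r) \<le> of_nat N * emeasure \<mu> (cball c (e * r))"
proof -
  obtain Z where Z: "finite Z" "cball 0 1 \<subseteq> (\<Union>z\<in>Z. ball (z::'x) e)"
    using finite_net[OF assms] by blast
  have "emeasure \<mu> (cball a r) \<le> of_nat (Suc (card Z)) * emeasure \<mu> (cball c (e * r))" if r: "r > 0" for r a c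
  proof -
    have "cball 0 r \<subseteq> (\<Union>z\<in>Z. cball (r *\<^sub>R z) (e * r))"
    proof
      fix x :: 'x assume x: "x \<in> cball 0 r"
      then have "(1 / r) *\<^sub>R x \<in> cball 0 1" using r by (simp add: field_simps)
      then obtain z where z: "z \<in> Z" "norm (z - (1 / r) *\<^sub>R x) < e" using Z(2) by (force simp: dist_norm)
      have "norm (r *\<^sub>R z - x) = norm (r *\<^sub>R (z - (1 / r) *\<^sub>R x))" using r by (simp add: scaleR_right_diff_distrib)
      also have "\<dots> \<le> e * r" using z r by (simp add: mult.commute)
      finally show "x \<in> (\<Union>z\<in>Z. cball (r *\<^sub>R z) (e * r))" using z(1) by (auto simp: dist_norm)
    qed
    then have "emeasure \<mu> (cball 0 r) \<le> emeasure \<mu> (\<Union>z\<in>Z. cball (r *\<^sub>R z) (e * r))"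
      using Z(1) by (intro emeasure_mono) (auto intro!: sets.finite_UN)
    also have "\<dots> \<le> (\<Sum>z\<in>Z. emeasure \<mu> (cball (r *\<^sub>R z) (e * r)))"
      using Z(1) by (intro emeasure_subadditive_finite) auto
    also have "\<dots> = of_nat (card Z) * emeasure \<mu> (cball 0 (e * r))"
      by (subst emeasure_cball_translation) simp
    also have "\<dots> \<le> of_nat (Suc (card Z)) * emeasure \<mu> (cball 0 (e * r))"
      by (intro mult_right_mono) auto
    finally show ?thesis by (simp only: emeasure_cball_translation[of a] emeasure_cball_translation[of c])
  qed
  then show thesis by (intro that[of "Suc (card Z)"]) auto
qed

lemma UN_cball_nat: "(\<Union>m::nat. cball (0::'x) (real m)) = UNIV"
  by (auto simp: real_arch_simple)

text \<open>If one ball were null, the scaling estimate would make every ball null, hence the whole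
  space.\<close>

lemma emeasure_cball_pos:
  assumes "r > 0"
  shows "emeasure \<mu> (cball a r) > 0"
proof (rule ccontr)
  assume "\<not> ?thesis"
  then have 0: "emeasure \<mu> (cball 0 r) = 0" using emeasure_cball_translation[of a] by simp
  have "emeasure \<mu> (cball 0 (real m)) = 0" for m :: nat
  proof (cases "m = 0")
    case True
    then show ?thesis using 0 assms emeasure_mono[of "cball (0::'x) 0" "cball 0 r" \<mu>] by auto
  next
    case False
    then have "r / real m > 0" using assms by simp
    then obtain N :: nat where "\<And>r' a c. r' > 0 \<Longrightarrow> emeasure \<mu> (cball a r') \<le> of_nat N * emeasure \<mu> (cball c (r / real m * r'))"
      by (rule emeasure_cball_scale) blast
    from this[of "real m" 0 0] False 0 show ?thesis by simp
  qed
  then have "cball 0 (real m) \<in> null_sets \<mu>" for m :: nat by (intro null_setsI) auto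
  then have "(\<Union>m::nat. cball (0::'x) (real m)) \<in> null_sets \<mu>" by (intro null_sets_UN')  auto
  then have "emeasure \<mu> UNIV = 0" by (simp add: UN_cball_nat null_setsD1)
  then show False using haar by (simp add: haar_measure_def)
qed

lemma sigma_finite_mu: "sigma_finite_measure \<mu>"
proof
  show "\<exists>A. countable A \<and> A \<subseteq> sets \<mu> \<and> \<Union>A = space \<mu> \<and> (\<forall>a\<in>A. emeasure \<mu> a \<noteq> \<infinity>)"
    using emeasure_cball_finite UN_cball_nat
    by (intro exI[of _ "range (\<lambda>m::nat. cball (0::'x) (real m))"]) (auto simp: less_top)
qed

text \<open>Fubini is applied to the point and a shift along \<open>v\<close>: for each
  \<open>t\<close> the translate of \<open>N\<close> by \<open>t v\<close> has the measure of
  \<open>N\<close>, so integrating over \<open>t\<close> in \<open>{0..1}\<close> returns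
  \<open>emeasure \<mu> N\<close>, while the other order of integration gives 0.\<close>

lemma null_set_if_null_on_lines:
  assumes N: "N \<in> sets borel" and null: "\<And>x. {t. x + t *\<^sub>R v \<in> N} \<in> null_sets lborel"
  shows "N \<in> null_sets \<mu>"
proof -
  interpret sigma_finite_measure \<mu> by (rule sigma_finite_mu)
  interpret pair_sigma_finite \<mu> lborel by unfold_locales
  let ?g = "\<lambda>x t. indicator N (x + t *\<^sub>R v) * indicator {0..1} (t::real) :: ennreal"
  have cm: "(\<lambda>p. fst p + snd p *\<^sub>R v) \<in> borel \<Otimes>\<^sub>M borel \<rightarrow>\<^sub>M borel"
    by (intro measurable_pair_continuous continuous_intros)
  have cm': "(\<lambda>p. fst p + snd p *\<^sub>R v) \<in> \<mu> \<Otimes>\<^sub>M lborel \<rightarrow>\<^sub>M borel"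
    using cm measurable_cong_sets[OF sets_pair_measure_cong[OF sets_mu sets_lborel] refl, of borel] by blast
  have "(\<lambda>p. indicator N (fst p + snd p *\<^sub>R v) :: ennreal) \<in> borel_measurable (\<mu> \<Otimes>\<^sub>M lborel)"
    using measurable_compose[OF cm' borel_measurable_indicator[OF N]] .
  moreover have "(\<lambda>p. indicator {0..1} (snd p :: real) :: ennreal) \<in> borel_measurable (\<mu> \<Otimes>\<^sub>M lborel)"
    by measurable
  ultimately have "(\<lambda>p. indicator N (fst p + snd p *\<^sub>R v) * indicator {0..1} (snd p) :: ennreal) \<in> borel_measurable (\<mu> \<Otimes>\<^sub>M lborel)"
    by (rule borel_measurable_times_ennreal)
  then have m: "case_prod ?g \<in> borel_measurable (\<mu> \<Otimes>\<^sub>M lborel)"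
    by (simp add: case_prod_unfold)
  have "(\<integral>\<^sup>+t. \<integral>\<^sup>+x. ?g x t \<partial>\<mu> \<partial>lborel) = (\<integral>\<^sup>+x. \<integral>\<^sup>+t. ?g x t \<partial>lborel \<partial>\<mu>)"
    by (rule Fubini'[OF m])
  moreover have "(\<integral>\<^sup>+t. ?g x t \<partial>lborel) = 0" for x
  proof -
    have "AE t in lborel. t \<notin> {t. x + t *\<^sub>R v \<in> N}" by (rule AE_not_in[OF null])
    then have "AE t in lborel. ?g x t = 0" by eventually_elim auto
    then have "(\<integral>\<^sup>+t. ?g x t \<partial>lborel) = (\<integral>\<^sup>+t. 0 \<partial>(lborel :: real measure))"
      by (rule nn_integral_cong_AE)
    then show ?thesis by simp
  qed
  moreover have "(\<integral>\<^sup>+x. ?g x t \<partial>\<mu>) = emeasure \<mu> N * indicator {0..1} t" for t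
  proof -
    have "(\<integral>\<^sup>+x. indicator N (x + t *\<^sub>R v) \<partial>\<mu>) = (\<integral>\<^sup>+x. indicator N x \<partial>\<mu>)"
      by (rule nn_integral_translation) (use N in simp)
    then have *: "(\<integral>\<^sup>+x. indicator N (x + t *\<^sub>R v) \<partial>\<mu>) = emeasure \<mu> N" using N by simp
    have "(\<lambda>x. indicator N (x + t *\<^sub>R v) :: ennreal) \<in> borel_measurable \<mu>"
      by (intro measurable_compose[OF _ borel_measurable_indicator[OF N]])
        (auto intro!: borel_measurable_continuous_onI continuous_intros simp: measurable_cong_sets[OF sets_mu refl])
    then show ?thesis by (simp add: nn_integral_multc *)
  qed
  ultimately have "(\<integral>\<^sup>+t. emeasure \<mu> N * indicator {0..1} (t::real) \<partial>lborel) = 0" by simp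
  then have "emeasure \<mu> N = 0" by (simp add: nn_integral_cmult_indicator)
  then show ?thesis using N by (intro null_setsI) auto
qed

end

section \<open>Lebesgue density and limits of set functions on the line\<close>

lemma AE_lborel_negligible:
  assumes "negligible S"
  shows "AE x in lborel. x \<notin> S"
proof -
  have "S \<in> null_sets (completion lborel)" using assms by (simp add: negligible_iff_null_sets)
  then obtain N' where "N' \<in> null_sets lborel" "S \<subseteq> N'"
    using null_sets_completion_iff2[of S lborel] by auto
  then show ?thesis by (auto intro!: AE_I'[of N'])
qed

text \<open>Vitali covering inside an open set \<open>U\<close> barely larger than \<open>A\<close>:
  the selected balls are disjoint and each has more than the fraction \<open>c / 2\<close> of its
  length outside \<open>A\<close>, so their total length is at most \<open>2 / c\<close> times the
  measure of \<open>U - A\<close>.\<close>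

lemma negligible_low_density:
  fixes A :: "real set"
  assumes A: "A \<in> sets borel" and c: "c > 0"
    and S: "S \<subseteq> A" "\<And>x d. x \<in> S \<Longrightarrow> d > 0 \<Longrightarrow> \<exists>r. 0 < r \<and> r < d \<and> c * r < measure lborel (ball x r - A)"
  shows "negligible S"
  unfolding negligible_outer_le
proof (intro allI impI)
  fix e :: real assume e: "e > 0"
  \<comment> \<open>Compensates the factor \<open>2 / c\<close> in the bound on the total length of
    the balls.\<close>
  define e' where "e' = e * c / 2"
  have e': "e' > 0" using e c by (simp add: e'_def)
  have "A \<in> sets lebesgue" using A by simp
  then obtain U where U: "open U" "A \<subseteq> U" "(U - A) \<in> lmeasurable" "emeasure lebesgue (U - A) < ennreal e'"
    using sets_lebesgue_outer_open[OF _ e'] by metis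
  define K where "K = {(x, r). x \<in> S \<and> 0 < r \<and> ball x r \<subseteq> U \<and> c * r < measure lborel (ball x r - A)}"
  have "\<exists>i. i \<in> K \<and> x \<in> ball (fst i) (snd i) \<and> snd i < d" if x: "x \<in> S" "d > 0" for x d
  proof -
    obtain d' where d': "d' > 0" "ball x d' \<subseteq> U" using U(1,2) S(1) x(1) by (meson openE subsetD)
    obtain r where r: "0 < r" "r < min d d'" "c * r < measure lborel (ball x r - A)"
      using S(2)[of x "min d d'"] x d'(1) by auto
    have "ball x r \<subseteq> ball x d'" using r(2) by (intro subset_ball) simp
    then have "(x, r) \<in> K" using x(1) r d'(2) unfolding K_def by auto
    then show ?thesis using r by (intro exI[of _ "(x, r)"]) auto
  qed
  then obtain C where C: "countable C" "C \<subseteq> K"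
     "pairwise (\<lambda>i j. disjnt (ball (fst i) (snd i)) (ball (fst j) (snd j))) C"
     "negligible (S - (\<Union>i \<in> C. ball (fst i) (snd i)))"
    by (rule Vitali_covering_theorem_balls[of S K fst snd]) blast
  let ?B = "\<lambda>i. ball (fst i) (snd i) :: real set"
  have disj: "disjoint_family_on ?B C"
    using C(3) by (auto simp: disjoint_family_on_def pairwise_def disjnt_def)
  have disj': "disjoint_family_on (\<lambda>i. ?B i - A) C"
    using disj unfolding disjoint_family_on_def by blast
  have "emeasure lborel (\<Union>i\<in>C. ?B i) = (\<integral>\<^sup>+i. emeasure lborel (?B i) \<partial>count_space C)"
    using C(1) disj by (intro emeasure_UN_countable) auto
  also have "\<dots> \<le> (\<integral>\<^sup>+i. ennreal (2 / c) * emeasure lborel (?B i - A) \<partial>count_space C)"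
  proof (intro nn_integral_mono)
    fix i assume "i \<in> space (count_space C)"
    then have i: "0 < snd i" "c * snd i < measure lborel (?B i - A)" using C(2) by (auto simp: K_def)
    have fin: "emeasure lborel (?B i - A) < \<infinity>"
      using emeasure_mono[of "?B i - A" "?B i" lborel] emeasure_lborel_ball_finite[of "fst i" "snd i"] by (auto simp: less_top[symmetric] top_unique)
    have "emeasure lborel (?B i) = ennreal (2 * snd i)" using i(1) by (simp add: ball_eq_greaterThanLessThan)
    also have "\<dots> \<le> ennreal (2 / c * measure lborel (?B i - A))"
      using i c by (intro ennreal_leI) (simp add: field_simps)
    also have "\<dots> = ennreal (2 / c) * emeasure lborel (?B i - A)"
    proof -
      have "emeasure lborel (?B i - A) = ennreal (measure lborel (?B i - A))"
        using fin by (simp add: emeasure_eq_ennreal_measure less_top[symmetric])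
      then show ?thesis using c by (simp only:) (rule ennreal_mult, auto)
    qed
    finally show "emeasure lborel (?B i) \<le> ennreal (2 / c) * emeasure lborel (?B i - A)" .
  qed
  also have "\<dots> = ennreal (2 / c) * (\<integral>\<^sup>+i. emeasure lborel (?B i - A) \<partial>count_space C)"
    by (rule nn_integral_cmult) simp
  also have "(\<integral>\<^sup>+i. emeasure lborel (?B i - A) \<partial>count_space C) = emeasure lborel (\<Union>i\<in>C. ?B i - A)"
    using C(1) disj' A by (intro emeasure_UN_countable[symmetric]) auto
  also have "\<dots> \<le> emeasure lebesgue (U - A)"
  proof -
    have "(\<Union>i\<in>C. ?B i - A) \<subseteq> U - A" using C(2) by (force simp: K_def)
    then have "emeasure lborel (\<Union>i\<in>C. ?B i - A) \<le> emeasure lborel (U - A)"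
      using U(1) A by (intro emeasure_mono) auto
    also have "\<dots> = emeasure lebesgue (U - A)" using U(1) A by simp
    finally show ?thesis .
  qed
  also have "\<dots> \<le> ennreal e'" using U(4) by simp
  finally have le: "emeasure lborel (\<Union>i\<in>C. ?B i) \<le> ennreal e"
    using c e by (simp add: mult_left_mono ennreal_mult[symmetric] e'_def)
  have "open (\<Union>i\<in>C. ?B i)" by auto
  then have opn: "(\<Union>i\<in>C. ?B i) \<in> sets lborel" by simp
  let ?T = "(S - (\<Union>i\<in>C. ?B i)) \<union> (\<Union>i\<in>C. ?B i)"
  have lm: "(\<Union>i\<in>C. ?B i) \<in> lmeasurable"
    using le opn by (intro fmeasurableI) (auto simp: le_less_trans)
  have n: "S - (\<Union>i\<in>C. ?B i) \<in> lmeasurable" using C(4) by (rule negligible_imp_measurable)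
  have "measure lebesgue ?T \<le> measure lebesgue (S - (\<Union>i\<in>C. ?B i)) + measure lebesgue (\<Union>i\<in>C. ?B i)"
    using lm n by (intro measure_Un_le) auto
  also have "\<dots> = measure lborel (\<Union>i\<in>C. ?B i)" using C(4) opn by (simp add: negligible_imp_measure0)
  also have "\<dots> \<le> e" using le e by (simp add: measure_def enn2real_leI)
  finally have "measure lebesgue ?T \<le> e" .
  moreover have "?T \<in> lmeasurable" using n lm by (rule fmeasurable.Un)
  moreover have "S \<subseteq> ?T" by blast
  ultimately show "\<exists>T. S \<subseteq> T \<and> T \<in> lmeasurable \<and> measure lebesgue T \<le> e"
    by blast
qed

text \<open>The thresholds \<open>1 / Suc m\<close> suffice, which leaves countably many exceptional
  sets.\<close>

lemma AE_density_1d: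
  fixes A :: "real set"
  assumes A: "A \<in> sets borel"
  shows "AE x in lborel. x \<in> A \<longrightarrow> (\<forall>c>0. \<exists>d>0. \<forall>r. 0 < r \<and> r < d \<longrightarrow> measure lborel (ball x r - A) \<le> c * r)"
proof -
  define S where "S m = {x\<in>A. \<forall>d>0. \<exists>r. 0 < r \<and> r < d \<and> 1 / Suc m * r < measure lborel (ball x r - A)}" for m :: nat
  have "negligible (S m)" for m
    by (rule negligible_low_density[OF A, of "1 / Suc m"]) (auto simp: S_def)
  then have "AE x in lborel. \<forall>m. x \<notin> S m"
    unfolding AE_all_countable using AE_lborel_negligible by blast
  then show ?thesis
  proof eventually_elim
    case (elim x)
    show ?case
    proof (intro impI allI)
      fix c :: real assume x: "x \<in> A" and c: "c > 0"
      obtain m :: nat where m: "1 / Suc m < c" using nat_approx_posE[OF c] by auto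
      have "\<not> (\<forall>d>0. \<exists>r. 0 < r \<and> r < d \<and> 1 / Suc m * r < measure lborel (ball x r - A))"
        using elim x unfolding S_def by blast
      then obtain d where d: "d > 0" "\<And>r. 0 < r \<Longrightarrow> r < d \<Longrightarrow> measure lborel (ball x r - A) \<le> 1 / Suc m * r"
        by (meson not_less)
      have "measure lborel (ball x r - A) \<le> c * r" if "0 < r" "r < d" for r
      proof -
        have "1 / Suc m * r \<le> c * r" using m that by (intro mult_right_mono) auto
        then show ?thesis using d(2)[OF that] by linarith
      qed
      then show "\<exists>d>0. \<forall>r. 0 < r \<and> r < d \<longrightarrow> measure lborel (ball x r - A) \<le> c * r"
        using d(1) by blast
    qed
  qed
qed

section \<open>Limits of uniformly dominated set functions\<close>

lemma convergent_if_uniformly_approximated: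
  fixes x :: "nat \<Rightarrow> 'a::banach"
  assumes "\<And>e. e > 0 \<Longrightarrow> \<exists>c. convergent c \<and> (\<forall>n. norm (x n - c n) \<le> e)"
  shows "convergent x"
proof -
  have "Cauchy x"
  proof (rule metric_CauchyI)
    fix e :: real assume "e > 0"
    then have "e / 4 > 0" by simp
    then obtain c where c: "convergent c" "\<And>n. norm (x n - c n) \<le> e / 4" using assms by blast
    then obtain N where N: "\<And>m n. m \<ge> N \<Longrightarrow> n \<ge> N \<Longrightarrow> dist (c m) (c n) < e / 4"
      using metric_CauchyD[OF convergent_Cauchy[OF c(1)] \<open>e / 4 > 0\<close>] by blast
    have "dist (x m) (x n) < e" if "m \<ge> N" "n \<ge> N" for m n
    proof -
      have "norm (x m - x n) = norm ((x m - c m) + (c m - c n) - (x n - c n))" by simp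
      then have "norm (x m - x n) \<le> norm (x m - c m) + norm (c m - c n) + norm (x n - c n)"
        using norm_triangle_ineq4[of "(x m - c m) + (c m - c n)" "x n - c n"] norm_triangle_ineq[of "x m - c m" "c m - c n"]
        by linarith
      then show ?thesis using c(2)[of m] c(2)[of n] N[OF that] \<open>e > 0\<close> by (simp add: dist_norm)
    qed
    then show "\<exists>M. \<forall>m\<ge>M. \<forall>n\<ge>M. dist (x m) (x n) < e" by blast
  qed
  then show ?thesis by (rule Cauchy_convergent)
qed

text \<open>Additive set functions with one Lipschitz bound against \<open>M\<close>. The common
  bound makes their countable additivity uniform in the index, so that convergence on an
  intersection-stable generator spreads to the sigma-algebra, in the spirit of the Vitali-Hahn-Saks
  theorem.\<close>

locale lipschitz_charges = finite_measure M for M :: "'w measure" +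
  fixes I :: "nat \<Rightarrow> 'w set \<Rightarrow> 'y::banach" and L :: real and G :: "'w set set"
  assumes L_nonneg: "0 \<le> L"
    and add: "A \<in> sets M \<Longrightarrow> B \<in> sets M \<Longrightarrow> A \<inter> B = {} \<Longrightarrow> I j (A \<union> B) = I j A + I j B"
    and bound: "A \<in> sets M \<Longrightarrow> norm (I j A) \<le> L * measure M A"
    and gen: "sets M = sigma_sets (space M) G" "Int_stable G" "G \<subseteq> Pow (space M)"
    and conv_gen: "A \<in> G \<Longrightarrow> convergent (\<lambda>j. I j A)"
    and conv_space: "convergent (\<lambda>j. I j (space M))"
begin

lemma I_empty: "I j {} = 0"
  using bound[of "{}" j] by simp

lemma I_UN_finite:
  fixes A :: "nat \<Rightarrow> 'w set"
  assumes "range A \<subseteq> sets M" "disjoint_family A"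
  shows "I j (\<Union>i<N. A i) = (\<Sum>i<N. I j (A i))"
proof (induction N)
  case (Suc N)
  have "(\<Union>i<N. A i) \<inter> A N = {}" using disjoint_family_onD[OF assms(2), of _ N] by fastforce
  then have "I j ((\<Union>i<N. A i) \<union> A N) = I j (\<Union>i<N. A i) + I j (A N)"
    using assms(1) by (intro add sets.finite_UN) auto
  moreover have "(\<Union>i<Suc N. A i) = (\<Union>i<N. A i) \<union> A N" by (auto simp: less_Suc_eq)
  ultimately show ?case using Suc by simp
qed (simp add: I_empty)

lemma tail_measure:
  fixes A :: "nat \<Rightarrow> 'w set"
  assumes "range A \<subseteq> sets M"
  shows "(\<lambda>N. measure M ((\<Union>i. A i) - (\<Union>i<N. A i))) \<longlonglongrightarrow> 0"
proof -
  have "(\<lambda>N. measure M ((\<Union>i. A i) - (\<Union>i<N. A i))) \<longlonglongrightarrow> measure M (\<Inter>N. (\<Union>i. A i) - (\<Union>i<N. A i))"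
    using assms by (intro finite_Lim_measure_decseq) (auto simp: decseq_def intro!: sets.Diff sets.countable_UN sets.finite_UN)
  moreover have "(\<Inter>N. (\<Union>i. A i) - (\<Union>i<N. A i)) = {}" by auto
  ultimately show ?thesis by (simp only: measure_empty)
qed

text \<open>The right-hand side is free of \<open>j\<close>: this is the uniform countable
  additivity.\<close>

lemma I_UN_tail:
  fixes A :: "nat \<Rightarrow> 'w set"
  assumes "range A \<subseteq> sets M" "disjoint_family A"
  shows "norm (I j (\<Union>i. A i) - (\<Sum>i<N. I j (A i))) \<le> L * measure M ((\<Union>i. A i) - (\<Union>i<N. A i))"
proof -
  have "(\<Union>i. A i) \<in> sets M" using assms(1) by (rule sets.countable_UN)
  moreover have "(\<Union>i<N. A i) \<in> sets M" using assms(1) by (intro sets.finite_UN) auto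
  ultimately have s: "(\<Union>i<N. A i) \<in> sets M" "(\<Union>i. A i) - (\<Union>i<N. A i) \<in> sets M"
    by (blast, blast)
  have "(\<Union>i. A i) = (\<Union>i<N. A i) \<union> ((\<Union>i. A i) - (\<Union>i<N. A i))" by blast
  moreover have "I j ((\<Union>i<N. A i) \<union> ((\<Union>i. A i) - (\<Union>i<N. A i))) = I j (\<Union>i<N. A i) + I j ((\<Union>i. A i) - (\<Union>i<N. A i))"
    by (rule add[OF s]) blast
  ultimately have "I j (\<Union>i. A i) = I j (\<Union>i<N. A i) + I j ((\<Union>i. A i) - (\<Union>i<N. A i))"
    by (simp only:)
  then show ?thesis using bound[OF s(2), of j] I_UN_finite[OF assms, of j N] by simp
qed

text \<open>Dynkin's argument. For a disjoint union the finite partial sums converge, and they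
  differ from the charge of the union by a tail that is small uniformly in \<open>j\<close>.\<close>

lemma convergent_charges: "A \<in> sets M \<Longrightarrow> convergent (\<lambda>j. I j A)"
  unfolding gen(1)
proof (induction rule: sigma_sets_induct_disjoint[OF gen(2,3), consumes 1, case_names basic empty compl union])
  case (basic A)
  then show ?case by (rule conv_gen)
next
  case empty
  then show ?case by (simp add: I_empty convergent_const)
next
  case (compl A)
  then have A: "A \<in> sets M" by (simp add: gen(1))
  have "I j (space M - A) = I j (space M) - I j A" for j
  proof -
    have "I j (A \<union> (space M - A)) = I j A + I j (space M - A)" using A by (intro add) auto
    moreover have "A \<union> (space M - A) = space M" using sets.sets_into_space[OF A] by blast
    ultimately show ?thesis by simp
  qed
  then show ?case using convergent_diff[OF conv_space compl(2)] by simp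
next
  case (union A)
  then have A: "range A \<subseteq> sets M" by (simp add: gen(1))
  show ?case
  proof (rule convergent_if_uniformly_approximated)
    fix e :: real assume e: "e > 0"
    have "e / (L + 1) > 0" using e L_nonneg by simp
    then obtain N where "norm (measure M ((\<Union>i. A i) - (\<Union>i<N. A i)) - 0) < e / (L + 1)"
      using LIMSEQ_D[OF tail_measure[OF A]] by blast
    then have "(L + 1) * measure M ((\<Union>i. A i) - (\<Union>i<N. A i)) \<le> e"
      using L_nonneg by (simp add: field_simps)
    moreover have "L * measure M ((\<Union>i. A i) - (\<Union>i<N. A i)) \<le> (L + 1) * measure M ((\<Union>i. A i) - (\<Union>i<N. A i))"
      by (intro mult_right_mono) auto
    ultimately have "norm (I j (\<Union>i. A i) - (\<Sum>i<N. I j (A i))) \<le> e" for j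
      using I_UN_tail[OF A union(1), of j N] by linarith
    moreover have "convergent (\<lambda>j. \<Sum>i<N. I j (A i))"
      using union(3) by (intro convergent_sum) auto
    ultimately show "\<exists>c. convergent c \<and> (\<forall>n. norm (I n (\<Union>i. A i) - c n) \<le> e)" by blast
  qed
qed

definition lim_charge :: "'w set \<Rightarrow> 'y" where
  "lim_charge A = lim (\<lambda>j. I j A)"

lemma lim_charge: "A \<in> sets M \<Longrightarrow> (\<lambda>j. I j A) \<longlonglongrightarrow> lim_charge A"
  unfolding lim_charge_def using convergent_charges convergent_LIMSEQ_iff by blast

lemma norm_lim_charge: "A \<in> sets M \<Longrightarrow> norm (lim_charge A) \<le> L * measure M A"
  by (rule LIMSEQ_le_const2[OF tendsto_norm[OF lim_charge]]) (auto simp: bound)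

text \<open>The tail bound \<open>I_UN_tail\<close> survives the limit in \<open>j\<close>.\<close>

lemma vector_measure_lim_charge: "vector_measure M lim_charge"
  unfolding vector_measure_def
proof (intro allI impI)
  fix A :: "nat \<Rightarrow> 'w set" assume A: "range A \<subseteq> sets M" "disjoint_family A"
  have "norm (lim_charge (\<Union>i. A i) - (\<Sum>i<N. lim_charge (A i))) \<le> L * measure M ((\<Union>i. A i) - (\<Union>i<N. A i))" for N
  proof (rule LIMSEQ_le_const2)
    show "(\<lambda>j. norm (I j (\<Union>i. A i) - (\<Sum>i<N. I j (A i)))) \<longlonglongrightarrow> norm (lim_charge (\<Union>i. A i) - (\<Sum>i<N. lim_charge (A i)))"
      using A(1) by (intro tendsto_norm tendsto_diff tendsto_sum lim_charge) auto
  qed (use I_UN_tail[OF A] in blast)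
  moreover have "(\<lambda>N. L * measure M ((\<Union>i. A i) - (\<Union>i<N. A i))) \<longlonglongrightarrow> 0"
    using tendsto_mult_right_zero[OF tail_measure[OF A(1)]] .
  ultimately have "(\<lambda>N. lim_charge (\<Union>i. A i) - (\<Sum>i<N. lim_charge (A i))) \<longlonglongrightarrow> 0"
    by (intro Lim_null_comparison[of "\<lambda>N. lim_charge (\<Union>i. A i) - (\<Sum>i<N. lim_charge (A i))"] always_eventually) auto
  then have "(\<lambda>N. lim_charge (\<Union>i. A i) - (lim_charge (\<Union>i. A i) - (\<Sum>i<N. lim_charge (A i)))) \<longlonglongrightarrow> lim_charge (\<Union>i. A i) - 0"
    by (intro tendsto_diff tendsto_const)
  then show "(\<lambda>n. lim_charge (A n)) sums lim_charge (\<Union>n. A n)" by (simp add: sums_def)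
qed

lemma bounded_variation_lim_charge: "bounded_variation M lim_charge"
  unfolding bounded_variation_def
proof (intro exI allI impI)
  fix P assume P: "finite P" "P \<subseteq> sets M" "disjoint P"
  have "(\<Sum>A\<in>P. norm (lim_charge A)) \<le> (\<Sum>A\<in>P. L * measure M A)"
    using P by (intro sum_mono norm_lim_charge) auto
  also have "\<dots> = L * measure M (\<Union>A\<in>P. A)"
    using P by (subst finite_measure_finite_Union) (auto simp: sum_distrib_left disjoint_family_on_def pairwise_def disjnt_def)
  also have "\<dots> \<le> L * measure M (space M)"
    using L_nonneg bounded_measure by (intro mult_left_mono) auto
  finally show "(\<Sum>A\<in>P. norm (lim_charge A)) \<le> L * measure M (space M)" .
qed

end

section \<open>Lipschitz curves in spaces with the Radon-Nikodym property\<close>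

lemma set_integral_near_const:
  fixes f :: "'a \<Rightarrow> 'y::{banach, second_countable_topology}"
  assumes f: "set_integrable M A f" and A: "A \<in> sets M" "emeasure M A < \<infinity>"
    and near: "\<And>s. s \<in> A \<Longrightarrow> norm (f s - y) \<le> e"
  shows "norm ((LINT s:A|M. f s) - measure M A *\<^sub>R y) \<le> e * measure M A"
proof -
  have iA: "integrable M (indicator A :: 'a \<Rightarrow> real)" using A by (simp add: integrable_indicator_iff)
  have c: "set_integrable M A (\<lambda>_. y)"
    unfolding set_integrable_def using integrable_scaleR_left[OF iA, of y] by simp
  have cy: "(LINT s:A|M. y) = measure M A *\<^sub>R y"
    unfolding set_lebesgue_integral_def using iA sets.sets_into_space[OF A(1)] by (simp add: Int_absorb2 Int_absorb1)
  have "(LINT s:A|M. f s) - measure M A *\<^sub>R y = (LINT s:A|M. f s - y)"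
    using set_integral_diff(2)[OF f c] cy by simp
  also have "norm \<dots> \<le> (LINT s|M. norm (indicat_real A s *\<^sub>R (f s - y)))"
    unfolding set_lebesgue_integral_def by (rule integral_norm_bound)
  also have "\<dots> \<le> (LINT s|M. e * indicator A s)"
  proof (rule integral_mono)
    show "integrable M (\<lambda>s. norm (indicat_real A s *\<^sub>R (f s - y)))"
      using set_integral_diff(1)[OF f c] unfolding set_integrable_def by (rule integrable_norm)
    show "integrable M (\<lambda>s. e * indicat_real A s)" using iA by simp
    show "norm (indicat_real A s *\<^sub>R (f s - y)) \<le> e * indicat_real A s" if "s \<in> space M" for s
      using near[of s] by (auto simp: indicator_def)
  qed
  also have "\<dots> = e * measure M A"
    using sets.sets_into_space[OF A(1)] by (simp add: Int_absorb1 Int_absorb2)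
  finally show ?thesis .
qed

lemma lipschitz_imp_continuous_UNIV:
  fixes g :: "'a::metric_space \<Rightarrow> 'b::metric_space"
  assumes "\<And>s t. dist (g s) (g t) \<le> L * dist s t"
  shows "continuous_on UNIV g"
proof (rule continuous_on_iff[THEN iffD2], intro ballI allI impI)
  fix x and e :: real assume e: "e > 0"
  have "dist (g x') (g x) < e" if "dist x' x < e / (\<bar>L\<bar> + 1)" for x'
  proof -
    have "dist (g x') (g x) \<le> L * dist x' x" by (rule assms)
    also have "\<dots> \<le> (\<bar>L\<bar> + 1) * dist x' x" by (intro mult_right_mono) auto
    also have "\<dots> < e" using that by (simp add: pos_less_divide_eq mult.commute add_nonneg_pos)
    finally show ?thesis .
  qed
  then show "\<exists>d>0. \<forall>x'\<in>UNIV. dist x' x < d \<longrightarrow> dist (g x') (g x) < e"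
    using e by (intro exI[of _ "e / (\<bar>L\<bar> + 1)"]) (auto simp: add_nonneg_pos)
qed

locale lipschitz_curve =
  fixes g :: "real \<Rightarrow> 'y::{banach, second_countable_topology}" and L :: real
  assumes L0: "0 \<le> L" and lip: "norm (g s - g t) \<le> L * \<bar>s - t\<bar>"
begin

lemma cont: "continuous_on UNIV g"
  using lip by (intro lipschitz_imp_continuous_UNIV[of g L]) (simp add: dist_norm)

lemma borel_g [measurable]: "g \<in> borel_measurable borel"
  using cont by (rule borel_measurable_continuous_onI)

lemma integrable_g: "set_integrable lborel {a<..b} g"
proof (rule set_integrable_subset)
  show "set_integrable lborel {a..b} g"
    using cont by (intro borel_integrable_atLeastAtMost') (rule continuous_on_subset, auto)
qed auto

text \<open>Half-open, so that neighbouring intervals add up exactly.\<close>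

definition U :: "real \<Rightarrow> real \<Rightarrow> 'y" where
  "U a b = (LINT s:{a<..b}|lborel. g s)"

lemma U_add: "a \<le> b \<Longrightarrow> b \<le> c \<Longrightarrow> U a c = U a b + U b c"
  unfolding U_def
  by (subst set_integral_Un[symmetric]) (auto intro!: integrable_g simp: ivl_disj_un)

lemma U_shift: "(LINT s:{a<..b}|lborel. g (s + d)) = U (a + d) (b + d)"
proof -
  have "U (a + d) (b + d) = (\<integral>s. indicator {a + d<..b + d} (d + 1 * s) *\<^sub>R g (d + 1 * s) \<partial>lborel)"
    unfolding U_def set_lebesgue_integral_def
    using lborel_integral_real_affine[of 1 "\<lambda>s. indicator {a + d<..b + d} s *\<^sub>R g s" d] by simp
  also have "\<dots> = (LINT s:{a<..b}|lborel. g (s + d))"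
    unfolding set_lebesgue_integral_def
    by (intro Bochner_Integration.integral_cong) (auto simp: indicator_def add.commute)
  finally show ?thesis by simp
qed

lemma U_short: "d \<ge> 0 \<Longrightarrow> norm (U b (b + d) - d *\<^sub>R g b) \<le> L * d * d"
proof -
  assume d: "d \<ge> 0"
  have "norm ((LINT s:{b<..b+d}|lborel. g s) - measure lborel {b<..b+d} *\<^sub>R g b) \<le> (L * d) * measure lborel {b<..b+d}"
  proof (rule set_integral_near_const[OF integrable_g])
    fix s assume s: "s \<in> {b<..b+d}"
    have "norm (g s - g b) \<le> L * \<bar>s - b\<bar>" by (rule lip)
    also have "\<dots> \<le> L * d" using s L0 by (intro mult_left_mono) auto
    finally show "norm (g s - g b) \<le> L * d" .
  qed (use d in auto)
  then show ?thesis using d by (simp add: U_def)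
qed

definition dq :: "nat \<Rightarrow> real \<Rightarrow> 'y" where
  "dq n s = real (Suc n) *\<^sub>R (g (s + 1 / Suc n) - g s)"

lemma norm_dq: "norm (dq n s) \<le> L"
proof -
  have "norm (dq n s) \<le> real (Suc n) * (L * \<bar>(s + 1 / Suc n) - s\<bar>)"
    unfolding dq_def norm_scaleR using lip[of "s + 1 / Suc n" s] by (intro mult_mono) auto
  also have "\<dots> = L" by (simp add: field_simps)
  finally show ?thesis .
qed

lemma borel_dq [measurable]: "dq n \<in> borel_measurable borel"
  unfolding dq_def[abs_def] by measurable

text \<open>Shifting the integral makes the interior cancel. Only averages over intervals of length
  \<open>1 / Suc n\<close> at the two endpoints remain, and these tend to the values of
  \<open>g\<close> there.\<close>

lemma integral_dq:
  assumes "a \<le> b"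
  shows "(LINT s:{a<..b}|lborel. dq n s)
    = real (Suc n) *\<^sub>R (U b (b + 1 / Suc n) - U a (a + 1 / Suc n))"
proof -
  let ?d = "1 / real (Suc n)"
  have i: "set_integrable lborel {a<..b} (\<lambda>s. g (s + ?d))"
  proof (rule set_integrable_subset)
    show "set_integrable lborel {a..b} (\<lambda>s. g (s + ?d))"
      by (intro borel_integrable_atLeastAtMost' continuous_on_compose2[OF cont] continuous_intros) auto
  qed auto
  have "(LINT s:{a<..b}|lborel. dq n s) = real (Suc n) *\<^sub>R (LINT s:{a<..b}|lborel. g (s + ?d) - g s)"
    unfolding dq_def by (rule set_integral_scaleR_right)
  also have "(LINT s:{a<..b}|lborel. g (s + ?d) - g s) = U (a + ?d) (b + ?d) - U a b"
    using set_integral_diff(2)[OF i integrable_g] U_shift[of a b ?d] by (simp add: U_def)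
  also have "\<dots> = U b (b + ?d) - U a (a + ?d)"
  proof -
    have "U a (a + ?d) + U (a + ?d) (b + ?d) = U a b + U b (b + ?d)"
      using U_add[of a "a + ?d" "b + ?d"] U_add[of a b "b + ?d"] assms by simp
    then show ?thesis by (simp add: algebra_simps)
  qed
  finally show ?thesis .
qed

lemma U_quotient_lim: "(\<lambda>n. real (Suc n) *\<^sub>R U b (b + 1 / Suc n)) \<longlonglongrightarrow> g b"
proof -
  have "norm (real (Suc n) *\<^sub>R U b (b + 1 / Suc n) - g b) \<le> L * inverse (real (Suc n))" for n
  proof -
    let ?d = "1 / real (Suc n)"
    have "real (Suc n) *\<^sub>R U b (b + ?d) - g b = real (Suc n) *\<^sub>R (U b (b + ?d) - ?d *\<^sub>R g b)"
      by (simp add: scaleR_right_diff_distrib)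
    then have "norm (real (Suc n) *\<^sub>R U b (b + ?d) - g b) = real (Suc n) * norm (U b (b + ?d) - ?d *\<^sub>R g b)"
      by (simp only: norm_scaleR)
    also have "\<dots> \<le> real (Suc n) * (L * ?d * ?d)"
      using U_short[of ?d b] by (intro mult_left_mono) auto
    also have "\<dots> = L * inverse (real (Suc n))" by (simp add: divide_simps)
    finally show ?thesis .
  qed
  moreover have "(\<lambda>n. L * inverse (real (Suc n))) \<longlonglongrightarrow> 0"
    using tendsto_mult_right_zero[OF LIMSEQ_inverse_real_of_nat] by simp
  ultimately have "(\<lambda>n. real (Suc n) *\<^sub>R U b (b + 1 / Suc n) - g b) \<longlonglongrightarrow> 0"
    by (intro Lim_null_comparison[of "\<lambda>n. real (Suc n) *\<^sub>R U b (b + 1 / Suc n) - g b"] always_eventually) auto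
  then show ?thesis by (rule LIM_zero_cancel)
qed

lemma integral_dq_lim:
  assumes "a \<le> b"
  shows "(\<lambda>n. LINT s:{a<..b}|lborel. dq n s) \<longlonglongrightarrow> g b - g a"
  unfolding integral_dq[OF assms] scaleR_right_diff_distrib
  by (intro tendsto_diff U_quotient_lim)

end

section \<open>The Radon-Nikodym density of a Lipschitz curve\<close>

locale lipschitz_curve_window = lipschitz_curve g L
  for g :: "real \<Rightarrow> 'y::{banach, second_countable_topology}" and L +
  fixes k :: real
  assumes k0: "k > 0"
begin

text \<open>Lebesgue measure on the window, kept as a measure on all Borel sets of the line because
  \<open>radon_nikodym_property\<close> speaks of finite measures on the reals.\<close>

definition W :: "real measure" where
  "W = density lborel (\<lambda>s. ennreal (indicator {-k<..k} s))"

lemma sets_W [measurable_cong, simp]: "sets W = sets borel"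
  by (simp add: W_def)

lemma space_W [simp]: "space W = UNIV"
  by (simp add: W_def)

lemma emeasure_W: "A \<in> sets borel \<Longrightarrow> emeasure W A = emeasure lborel (A \<inter> {-k<..k})"
  unfolding W_def
  by (subst emeasure_density)
    (auto simp flip: nn_integral_indicator simp: indicator_def intro!: nn_integral_cong)

lemma measure_W: "A \<in> sets borel \<Longrightarrow> measure W A = measure lborel (A \<inter> {-k<..k})"
  by (simp add: measure_def emeasure_W)

lemma finite_measure_W: "finite_measure W"
proof
  show "emeasure W (space W) \<noteq> \<infinity>" using k0 by (simp add: emeasure_W)
qed

lemma integral_W:
  fixes f :: "real \<Rightarrow> 'y"
  assumes A: "A \<in> sets borel" and [measurable]: "f \<in> borel_measurable borel"
  shows "(LINT s:A|W. f s) = (LINT s:A \<inter> {-k<..k}|lborel. f s)"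
proof -
  have [measurable]: "A \<in> sets borel" by (rule A)
  have "(LINT s:A|W. f s) = (\<integral>s. indicat_real {-k<..k} s *\<^sub>R indicat_real A s *\<^sub>R f s \<partial>lborel)"
    unfolding set_lebesgue_integral_def W_def by (rule integral_density) auto
  also have "\<dots> = (LINT s:A \<inter> {-k<..k}|lborel. f s)"
    unfolding set_lebesgue_integral_def by (intro Bochner_Integration.integral_cong) (auto simp: indicator_def)
  finally show ?thesis .
qed

definition I :: "nat \<Rightarrow> real set \<Rightarrow> 'y" where
  "I n A = (LINT s:A|W. dq n s)"

lemma integrable_dq_W: "A \<in> sets borel \<Longrightarrow> set_integrable W A (dq n)"
proof -
  assume A [measurable]: "A \<in> sets borel"
  interpret finite_measure W by (rule finite_measure_W)
  have "dq n \<in> borel_measurable W" by measurable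
  then have "integrable W (dq n)"
    by (intro integrable_const_bound[of _ L]) (auto simp: norm_dq)
  then have "set_integrable W UNIV (dq n)" by (simp add: set_integrable_def)
  then show ?thesis by (rule set_integrable_subset) (simp_all add: A)
qed

lemma I_interval:
  assumes "- k \<le> a" "a \<le> b" "b \<le> k"
  shows "(\<lambda>n. I n {a<..b}) \<longlonglongrightarrow> g b - g a"
proof -
  have "{a<..b} \<inter> {-k<..k} = {a<..b}" using assms by auto
  then have "I n {a<..b} = (LINT s:{a<..b}|lborel. dq n s)" for n
    unfolding I_def by (subst integral_W) auto
  then show ?thesis using integral_dq_lim[OF assms(2)] by simp
qed

text \<open>Half-lines are the intersection-stable generator. Within the window, such a half-line is
  the interval that ends at the clamped point \<open>?b\<close>.\<close>

lemma I_atMost: "convergent (\<lambda>n. I n {..a})"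
proof -
  let ?b = "max (- k) (min a k)"
  have "{..a} \<inter> {-k<..k} = {-k<..?b} \<inter> {-k<..k}" using k0 by auto
  then have "I n {..a} = I n {-k<..?b}" for n
    unfolding I_def by (simp add: integral_W)
  moreover have "(\<lambda>n. I n {-k<..?b}) \<longlonglongrightarrow> g ?b - g (-k)"
    using k0 by (intro I_interval) auto
  ultimately show ?thesis by (auto simp: convergent_def)
qed

text \<open>The bound \<open>norm_dq\<close> on every difference quotient yields the common bound
  \<open>L\<close> against \<open>W\<close>.\<close>

sublocale lipschitz_charges W I L "range (\<lambda>a. {..a::real})"
proof (rule lipschitz_charges.intro[OF finite_measure_W], unfold_locales)
  show "0 \<le> L" by (rule L0)
  show "I j (A \<union> B) = I j A + I j B" if "A \<in> sets W" "B \<in> sets W" "A \<inter> B = {}" for A B j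
    unfolding I_def using that by (intro set_integral_Un integrable_dq_W) auto
  show "norm (I j A) \<le> L * measure W A" if "A \<in> sets W" for A j
    using set_integral_near_const[of W A "dq j" 0 L] that integrable_dq_W[of A j]
      finite_measure.emeasure_finite[OF finite_measure_W, of A]
    by (auto simp: I_def norm_dq less_top)
  show "sets W = sigma_sets (space W) (range atMost)"
    by (simp add: borel_eq_atMost)
  show "Int_stable (range (atMost :: real \<Rightarrow> real set))"
    by (auto simp: Int_stable_def)
  show "range atMost \<subseteq> Pow (space W)" by simp
  show "convergent (\<lambda>j. I j A)" if "A \<in> range atMost" for A
    using that I_atMost by auto
  have "I n (space W) = I n {..k}" for n
    unfolding I_def by (subst (1 2) integral_W) (auto intro!: arg_cong[where f = "\<lambda>A. set_lebesgue_integral lborel A _"])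
  then show "convergent (\<lambda>j. I j (space W))" using I_atMost[of k] by simp
qed

lemma lim_charge_interval:
  assumes "- k \<le> a" "a \<le> b" "b \<le> k"
  shows "lim_charge {a<..b} = g b - g a"
  using LIMSEQ_unique[OF lim_charge I_interval[OF assms]] by simp

lemma density_RNP:
  assumes "radon_nikodym_property TYPE('y)"
  obtains h where "h \<in> borel_measurable borel" "set_integrable lborel {-k<..k} h"
    "\<And>A. A \<in> sets borel \<Longrightarrow> lim_charge A = (LINT s:A \<inter> {-k<..k}|lborel. h s)"
proof -
  have "lim_charge A = 0" if "A \<in> null_sets W" for A
    using norm_lim_charge[of A] that by (auto simp: measure_def null_setsD1 null_setsD2)
  then have "\<exists>h. integrable W h \<and> (\<forall>A\<in>sets W. lim_charge A = (LINT w:A|W. h w))"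
    using assms[unfolded radon_nikodym_property_def, rule_format, OF finite_measure_W vector_measure_lim_charge bounded_variation_lim_charge]
    by simp
  then obtain h where h: "integrable W h" "\<And>A. A \<in> sets W \<Longrightarrow> lim_charge A = (LINT w:A|W. h w)"
    by blast
  have m[measurable]: "h \<in> borel_measurable borel"
    using borel_measurable_integrable[OF h(1)] by (simp add: measurable_cong_sets[OF sets_W refl])
  have "set_integrable lborel {-k<..k} h"
    using h(1) unfolding W_def set_integrable_def by (subst (asm) integrable_density) auto
  then show thesis using that[of h] m h(2) by (simp add: integral_W)
qed

text \<open>The density \<open>h\<close> is vector-valued and may be unbounded, so density points
  are taken of the sets \<open>A y m\<close>, where \<open>h\<close> is close to a vector
  \<open>y\<close> from a countable dense set.\<close>

theorem RNP_derivative: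
  assumes "radon_nikodym_property TYPE('y)"
  obtains h where "set_integrable lborel {-k<..k} h"
    "\<And>a b. - k \<le> a \<Longrightarrow> a \<le> b \<Longrightarrow> b \<le> k \<Longrightarrow> g b - g a = (LINT s:{a<..b}|lborel. h s)"
    "AE t in lborel. - k < t \<and> t < k \<longrightarrow> (g has_vector_derivative h t) (at t)"
proof -
  obtain h where h [measurable]: "h \<in> borel_measurable borel" and hi: "set_integrable lborel {-k<..k} h"
    and hl: "\<And>A. A \<in> sets borel \<Longrightarrow> lim_charge A = (LINT s:A \<inter> {-k<..k}|lborel. h s)"
    using density_RNP[OF assms] by blast
  obtain D :: "'y set" where D: "countable D" "\<And>X. open X \<Longrightarrow> X \<noteq> {} \<Longrightarrow> \<exists>d\<in>D. d \<in> X"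
    using countable_dense_setE by blast
  define A where "A y m = {s. - k < s \<and> s < k \<and> dist (h s) y < 1 / Suc m}" for y m
  have A [measurable]: "A y m \<in> sets borel" for y m unfolding A_def by measurable
  have ftc: "g b - g a = (LINT s:{a<..b}|lborel. h s)" if "- k \<le> a" "a \<le> b" "b \<le> k" for a b
  proof -
    have "{a<..b} \<inter> {-k<..k} = {a<..b}" using that by auto
    then show ?thesis using lim_charge_interval[OF that] hl[of "{a<..b}"] by simp
  qed
  \<comment> \<open>The part of the interval where \<open>h\<close> is within
    \<open>1 / Suc m\<close> of \<open>y\<close> is estimated through the integral; on the rest the
    bound \<open>L * measure\<close> of the limit charge stands in for a bound on
    \<open>h\<close>.\<close>
  have est: "norm (g b - g a - (b - a) *\<^sub>R y) \<le> 1 / Suc m * (b - a) + (L + norm y) * measure lborel ({a<..b} - A y m)"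
    if ab: "- k \<le> a" "a \<le> b" "b \<le> k" for a b y m
  proof -
    let ?J = "{a<..b}"
    let ?P = "?J \<inter> A y m" and ?N = "?J - A y m"
    have sP: "?P \<in> sets borel" "?N \<in> sets borel" by measurable
    have J: "?P \<inter> {-k<..k} = ?P" "?N \<inter> {-k<..k} = ?N" using ab by auto
    have fin: "emeasure lborel ?P < \<infinity>" "emeasure lborel ?N < \<infinity>"
      using emeasure_mono[of ?P ?J lborel] emeasure_mono[of ?N ?J lborel] ab by (auto simp: le_less_trans)
    have "lim_charge (?P \<union> ?N) = lim_charge ?P + lim_charge ?N"
    proof (rule LIMSEQ_unique)
      show "(\<lambda>j. I j (?P \<union> ?N)) \<longlonglongrightarrow> lim_charge (?P \<union> ?N)"
        using sP by (intro lim_charge) auto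
      have "I j (?P \<union> ?N) = I j ?P + I j ?N" for j
        using sP by (intro add) auto
      then show "(\<lambda>j. I j (?P \<union> ?N)) \<longlonglongrightarrow> lim_charge ?P + lim_charge ?N"
        using sP by (simp only:) (intro tendsto_add lim_charge, auto)
    qed
    moreover have "?P \<union> ?N = ?J" by blast
    ultimately have 1: "g b - g a = lim_charge ?P + lim_charge ?N" using lim_charge_interval[OF ab] by simp
    have "set_integrable lborel ?P h" using hi sP ab by (auto intro: set_integrable_subset)
    then have "norm ((LINT s:?P|lborel. h s) - measure lborel ?P *\<^sub>R y) \<le> 1 / Suc m * measure lborel ?P"
      using sP fin by (intro set_integral_near_const) (auto simp: A_def dist_norm)
    then have 2: "norm (lim_charge ?P - measure lborel ?P *\<^sub>R y) \<le> 1 / Suc m * measure lborel ?P"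
      using hl[OF sP(1)] J by simp
    have 3: "norm (lim_charge ?N) \<le> L * measure lborel ?N"
      using norm_lim_charge[of ?N] sP measure_W[of ?N] J by simp
    have "measure lborel (?P \<union> ?N) = measure lborel ?P + measure lborel ?N"
      using sP fin by (intro measure_Union) auto
    then have 4: "b - a = measure lborel ?P + measure lborel ?N"
      using \<open>?P \<union> ?N = ?J\<close> ab by simp
    have "g b - g a - (b - a) *\<^sub>R y
      = (lim_charge ?P - measure lborel ?P *\<^sub>R y) + (lim_charge ?N - measure lborel ?N *\<^sub>R y)"
      unfolding 1 4 by (simp add: scaleR_left_distrib)
    also have "norm \<dots> \<le> norm (lim_charge ?P - measure lborel ?P *\<^sub>R y) + norm (lim_charge ?N - measure lborel ?N *\<^sub>R y)"
      by (rule norm_triangle_ineq)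
    also have "norm (lim_charge ?N - measure lborel ?N *\<^sub>R y) \<le> norm (lim_charge ?N) + measure lborel ?N * norm y"
      using norm_triangle_ineq4[of "lim_charge ?N" "measure lborel ?N *\<^sub>R y"] by simp
    also have "norm (lim_charge ?P - measure lborel ?P *\<^sub>R y) + (norm (lim_charge ?N) + measure lborel ?N * norm y)
       \<le> 1 / Suc m * (b - a) + (L * measure lborel ?N + measure lborel ?N * norm y)"
    proof -
      have "1 / real (Suc m) * measure lborel ?P \<le> 1 / real (Suc m) * (b - a)"
        unfolding 4 by (intro mult_left_mono) auto
      then show ?thesis using 2 3 by linarith
    qed
    finally show ?thesis by (simp add: algebra_simps)
  qed
  have "AE t in lborel. \<forall>y\<in>D. \<forall>m. t \<in> A y m \<longrightarrow>
      (\<forall>c>0. \<exists>d>0. \<forall>r. 0 < r \<and> r < d \<longrightarrow> measure lborel (ball t r - A y m) \<le> c * r)"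
    using D(1) AE_density_1d[OF A] by (simp add: AE_ball_countable AE_all_countable)
  then have "AE t in lborel. - k < t \<and> t < k \<longrightarrow> (g has_vector_derivative h t) (at t)"
  proof eventually_elim
    case (elim t)
    show ?case
    proof
      assume t: "- k < t \<and> t < k"
      show "(g has_vector_derivative h t) (at t)"
        unfolding has_vector_derivative_def has_derivative_at_alt
      proof (intro conjI allI impI bounded_linear_scaleR_left)
        fix e :: real assume e: "e > 0"
        then obtain m :: nat where m: "1 / Suc m < e / 3" using nat_approx_posE[of "e / 3"] by auto
        obtain y where y: "y \<in> D" "dist (h t) y < 1 / Suc m"
          using D(2)[of "ball (h t) (1 / Suc m)"] by auto
        have tA: "t \<in> A y m" using t y(2) by (simp add: A_def)
        \<comment> \<open>Makes the bad part of the interval contribute at most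
          \<open>e / 3 * \<bar>s - t\<bar>\<close>; the factor 2 answers the radius
          \<open>?r\<close> below.\<close>
        define C where "C = 2 * (L + norm y + 1)"
        have C: "C > 0" using L0 by (simp add: C_def add_nonneg_pos)
        have eC: "e / 3 / C > 0" using e C by simp
        have "\<exists>d>0. \<forall>r. 0 < r \<and> r < d \<longrightarrow> measure lborel (ball t r - A y m) \<le> e / 3 / C * r"
          by (rule bspec[OF elim y(1), THEN spec, THEN mp, OF tA, THEN spec, THEN mp, OF eC])
        then obtain d where d: "d > 0" "\<And>r. 0 < r \<Longrightarrow> r < d \<Longrightarrow> measure lborel (ball t r - A y m) \<le> e / 3 / C * r"
          by blast
        let ?d = "min (d / 2) (min (k - t) (k + t))"
        have "?d > 0" using d(1) t by auto
        moreover have "norm (g s - g t - (s - t) *\<^sub>R h t) \<le> e * norm (s - t)" if s: "norm (s - t) < ?d" for s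
        proof (cases "s = t")
          case False
          define a b where "a = min s t" and "b = max s t"
          have ab: "- k \<le> a" "a \<le> b" "b \<le> k" "b - a = \<bar>s - t\<bar>"
            using s t unfolding a_def b_def real_norm_def by linarith+
          \<comment> \<open>Twice the distance, so that the closed end of the interval lies inside
            the open ball.\<close>
          let ?r = "2 * \<bar>s - t\<bar>"
          have r: "0 < ?r" "?r < d" using False s by auto
          have sub: "{a<..b} - A y m \<subseteq> ball t ?r - A y m"
          proof
            fix x assume "x \<in> {a<..b} - A y m"
            then have x: "min s t < x" "x \<le> max s t" "x \<notin> A y m" by (auto simp: a_def b_def)
            have "\<bar>t - x\<bar> < ?r" using x(1,2) r(1) by (cases "s \<le> t") (auto simp: min_def max_def)
            then show "x \<in> ball t ?r - A y m" using x(3) by (simp add: dist_real_def)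
          qed
          have fin: "emeasure lborel (ball t ?r - A y m) < \<infinity>"
            using emeasure_mono[of "ball t ?r - A y m" "ball t ?r" lborel] emeasure_lborel_ball_finite[of t ?r]
            by (auto simp: less_top[symmetric] top_unique)
          have "measure lborel ({a<..b} - A y m) \<le> measure lborel (ball t ?r - A y m)"
            using sub fin by (intro measure_mono_fmeasurable) (auto simp: fmeasurable_def)
          also have "\<dots> \<le> e / 3 / C * ?r" by (rule d(2)[OF r])
          finally have "(L + norm y) * measure lborel ({a<..b} - A y m) \<le> (L + norm y + 1) * (e / 3 / C * ?r)"
            using L0 by (intro mult_mono) auto
          also have "\<dots> = e / 3 * \<bar>s - t\<bar>" using C by (simp add: C_def field_simps)
          finally have "norm (g b - g a - (b - a) *\<^sub>R y) \<le> 1 / Suc m * (b - a) + e / 3 * \<bar>s - t\<bar>"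
            using est[OF ab(1-3), of y m] by linarith
          moreover have "norm (g b - g a - (b - a) *\<^sub>R y) = norm (g s - g t - (s - t) *\<^sub>R y)"
          proof (cases "s \<le> t")
            case True
            then have "g b - g a - (b - a) *\<^sub>R y = - (g s - g t - (s - t) *\<^sub>R y)"
              by (simp add: a_def b_def algebra_simps)
            then show ?thesis by (metis norm_minus_cancel)
          qed (simp add: a_def b_def)
          moreover have "1 / Suc m * (b - a) \<le> e / 3 * \<bar>s - t\<bar>"
            unfolding ab(4) using m by (intro mult_right_mono) auto
          moreover have "norm ((s - t) *\<^sub>R (y - h t)) \<le> e / 3 * \<bar>s - t\<bar>"
          proof -
            have "norm (y - h t) \<le> e / 3" using y(2) m by (simp add: dist_norm norm_minus_commute)
            then have "\<bar>s - t\<bar> * norm (y - h t) \<le> \<bar>s - t\<bar> * (e / 3)" by (intro mult_left_mono) auto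
            then show ?thesis by (simp add: mult.commute)
          qed
          moreover have "g s - g t - (s - t) *\<^sub>R h t = (g s - g t - (s - t) *\<^sub>R y) + (s - t) *\<^sub>R (y - h t)"
            by (simp add: algebra_simps)
          then have "norm (g s - g t - (s - t) *\<^sub>R h t) \<le> norm (g s - g t - (s - t) *\<^sub>R y) + norm ((s - t) *\<^sub>R (y - h t))"
            by (metis norm_triangle_ineq)
          ultimately have "norm (g s - g t - (s - t) *\<^sub>R h t) \<le> 3 * (e / 3 * \<bar>s - t\<bar>)"
            by linarith
          then show ?thesis by simp
        qed simp
        ultimately show "\<exists>d>0. \<forall>s. norm (s - t) < d \<longrightarrow> norm (g s - g t - (s - t) *\<^sub>R h t) \<le> e * norm (s - t)"
          by blast
      qed
    qed
  qed
  then show thesis using that hi ftc by blast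
qed

end

lemma (in lipschitz_curve) AE_differentiable:
  assumes "radon_nikodym_property TYPE('y)"
  shows "AE t in lborel. \<exists>v. (g has_vector_derivative v) (at t)"
proof -
  have "AE t in lborel. - real (Suc k) < t \<and> t < real (Suc k) \<longrightarrow> (\<exists>v. (g has_vector_derivative v) (at t))" for k
  proof -
    interpret lipschitz_curve_window g L "real (Suc k)" by unfold_locales simp
    obtain h where "AE t in lborel. - real (Suc k) < t \<and> t < real (Suc k) \<longrightarrow> (g has_vector_derivative h t) (at t)"
      by (rule RNP_derivative[OF assms])
    then show ?thesis by eventually_elim blast
  qed
  then have "AE t in lborel. \<forall>k. - real (Suc k) < t \<and> t < real (Suc k) \<longrightarrow> (\<exists>v. (g has_vector_derivative v) (at t))"
    unfolding AE_all_countable by blast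
  then show ?thesis
  proof eventually_elim
    case (elim t)
    obtain k :: nat where "\<bar>t\<bar> < real k" using reals_Archimedean2 by blast
    then have "- real (Suc k) < t \<and> t < real (Suc k)" by auto
    then show ?case using elim by blast
  qed
qed

section \<open>Rademacher's theorem\<close>

locale lipschitz_RNP_map = fd_haar b n K \<mu>
  for b :: "nat \<Rightarrow> 'x::real_normed_vector" and n K \<mu> +
  fixes F :: "'x \<Rightarrow> 'y::{banach, second_countable_topology}" and L :: real
  assumes L0: "0 \<le> L" and lip: "norm (F x - F y) \<le> L * norm (x - y)"
    and rnp: "radon_nikodym_property TYPE('y)"
begin

lemma cont_F: "continuous_on UNIV F"
  using lip by (intro lipschitz_imp_continuous_UNIV[of F L]) (simp add: dist_norm)

lemma cont_F_translate: "continuous_on UNIV (\<lambda>x. F (x + a))"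
  by (intro continuous_on_compose2[OF cont_F] continuous_intros) auto

definition quot :: "'x \<Rightarrow> 'x \<Rightarrow> real \<Rightarrow> 'y" where
  "quot v x t = inverse t *\<^sub>R (F (x + t *\<^sub>R v) - F x)"

definition has_dir_deriv :: "'x \<Rightarrow> 'x \<Rightarrow> 'y \<Rightarrow> bool" where
  "has_dir_deriv v x d \<longleftrightarrow> (quot v x \<longlongrightarrow> d) (at 0)"

lemma continuous_quot: "continuous_on UNIV (\<lambda>x. quot v x t)"
  unfolding quot_def by (intro continuous_intros cont_F_translate cont_F)

lemma has_dir_deriv_iff:
  "has_dir_deriv v x d \<longleftrightarrow> (\<forall>e>0. \<exists>r>0. \<forall>t. 0 < \<bar>t\<bar> \<and> \<bar>t\<bar> < r \<longrightarrow> norm (quot v x t - d) < e)"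
  unfolding has_dir_deriv_def Lim_at by (auto simp: dist_norm)

lemma has_dir_deriv_small:
  assumes "has_dir_deriv v x d" "e > 0"
  obtains m :: nat where "\<And>t. 0 < \<bar>t\<bar> \<Longrightarrow> \<bar>t\<bar> < 1 / Suc m \<Longrightarrow> norm (quot v x t - d) < e"
proof -
  obtain r where r: "r > 0" "\<And>t. 0 < \<bar>t\<bar> \<Longrightarrow> \<bar>t\<bar> < r \<Longrightarrow> norm (quot v x t - d) < e"
    using assms unfolding has_dir_deriv_iff by blast
  obtain m :: nat where "1 / Suc m < r" using nat_approx_posE[OF r(1)] by blast
  then show thesis using that[of m] r(2) by (meson less_trans)
qed

lemma has_dir_deriv_if_curve:
  assumes "((\<lambda>t. F (x + t *\<^sub>R v)) has_vector_derivative d) (at s)"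
  shows "has_dir_deriv v (x + s *\<^sub>R v) d"
  unfolding has_dir_deriv_iff
proof (intro allI impI)
  fix e :: real assume e: "e > 0"
  then have "e / 2 > 0" by simp
  then obtain r where r: "r > 0"
    "\<And>y. norm (y - s) < r \<Longrightarrow> norm (F (x + y *\<^sub>R v) - F (x + s *\<^sub>R v) - (y - s) *\<^sub>R d) \<le> e / 2 * norm (y - s)"
    using assms unfolding has_vector_derivative_def has_derivative_at_alt by blast
  have "norm (quot v (x + s *\<^sub>R v) t - d) < e" if t: "0 < \<bar>t\<bar> \<and> \<bar>t\<bar> < r" for t
  proof -
    have "quot v (x + s *\<^sub>R v) t - d = inverse t *\<^sub>R (F (x + (s + t) *\<^sub>R v) - F (x + s *\<^sub>R v) - t *\<^sub>R d)"
      using t by (simp add: quot_def scaleR_right_diff_distrib scaleR_left_distrib add.assoc)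
    moreover have "norm (F (x + (s + t) *\<^sub>R v) - F (x + s *\<^sub>R v) - t *\<^sub>R d) \<le> e / 2 * \<bar>t\<bar>"
      using r(2)[of "s + t"] t by simp
    ultimately have "norm (quot v (x + s *\<^sub>R v) t - d) \<le> inverse \<bar>t\<bar> * (e / 2 * \<bar>t\<bar>)"
      by (simp only: norm_scaleR abs_inverse) (rule mult_left_mono, auto)
    also have "\<dots> = e / 2" using t by simp
    finally show ?thesis using e by simp
  qed
  then show "\<exists>r>0. \<forall>t. 0 < \<bar>t\<bar> \<and> \<bar>t\<bar> < r \<longrightarrow> norm (quot v (x + s *\<^sub>R v) t - d) < e"
    using r(1) by blast
qed

text \<open>The Cauchy criterion for the difference quotients. All real \<open>s\<close> and
  \<open>t\<close> are allowed, since any intersection of closed sets is closed; the set of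
  directional differentiability becomes Borel without naming the limit.\<close>

definition Cauchy_dir :: "'x \<Rightarrow> nat \<Rightarrow> nat \<Rightarrow> 'x set" where
  "Cauchy_dir v k m = (\<Inter>s\<in>{s. 0 < \<bar>s\<bar> \<and> \<bar>s\<bar> < 1 / Suc m}. \<Inter>t\<in>{t. 0 < \<bar>t\<bar> \<and> \<bar>t\<bar> < 1 / Suc m}.
     {x. norm (quot v x s - quot v x t) \<le> 1 / Suc k})"

lemma closed_Cauchy_dir: "closed (Cauchy_dir v k m)"
  unfolding Cauchy_dir_def
  by (intro closed_INT ballI closed_Collect_le continuous_intros continuous_quot)

definition dir_diff :: "'x \<Rightarrow> 'x set" where
  "dir_diff v = (\<Inter>k. \<Union>m. Cauchy_dir v k m)"

lemma borel_dir_diff: "dir_diff v \<in> sets borel"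
  unfolding dir_diff_def using closed_Cauchy_dir by (intro sets.countable_INT sets.countable_UN) auto

lemma dir_diff_if_has_dir_deriv:
  assumes "has_dir_deriv v x d"
  shows "x \<in> dir_diff v"
  unfolding dir_diff_def
proof (intro INT_I)
  fix k :: nat
  define e where "e = 1 / real (Suc k)"
  have "e / 2 > 0" by (simp add: e_def)
  then obtain m :: nat where m: "\<And>t. 0 < \<bar>t\<bar> \<Longrightarrow> \<bar>t\<bar> < 1 / Suc m \<Longrightarrow> norm (quot v x t - d) < e / 2"
    using has_dir_deriv_small[OF assms] by blast
  have "norm (quot v x s - quot v x t) \<le> 1 / Suc k"
    if "0 < \<bar>s\<bar>" "\<bar>s\<bar> < 1 / Suc m" "0 < \<bar>t\<bar>" "\<bar>t\<bar> < 1 / Suc m" for s t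
    using m[OF that(1,2)] m[OF that(3,4)] norm_triangle_ineq4[of "quot v x s - d" "quot v x t - d"]
    unfolding e_def[symmetric] by simp
  then have "x \<in> Cauchy_dir v k m" unfolding Cauchy_dir_def by blast
  then show "x \<in> (\<Union>m. Cauchy_dir v k m)" by blast
qed

text \<open>Completeness yields a limit along \<open>1 / Suc j\<close>, and the Cauchy estimate
  carries it over to all small \<open>t\<close> of either sign.\<close>

lemma has_dir_deriv_if_dir_diff:
  assumes "x \<in> dir_diff v"
  obtains d where "has_dir_deriv v x d"
proof -
  have "\<exists>m. x \<in> Cauchy_dir v k m" for k using assms unfolding dir_diff_def by blast
  then obtain m where m: "\<And>k. x \<in> Cauchy_dir v k (m k)" by metis
  have close: "norm (quot v x s - quot v x t) \<le> 1 / Suc k"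
    if "0 < \<bar>s\<bar>" "\<bar>s\<bar> < 1 / Suc (m k)" "0 < \<bar>t\<bar>" "\<bar>t\<bar> < 1 / Suc (m k)" for s t k
    using m[of k] that unfolding Cauchy_dir_def by blast
  define u where "u j = 1 / real (Suc j)" for j
  have u0: "0 < \<bar>u j\<bar>" for j by (simp add: u_def)
  have u_small: "\<bar>u j\<bar> < 1 / Suc i" if "j > i" for i j using that by (simp add: u_def frac_less2)
  have "Cauchy (\<lambda>j. quot v x (u j))"
  proof (rule metric_CauchyI)
    fix e :: real assume "e > 0"
    then obtain k :: nat where k: "1 / Suc k < e" using nat_approx_posE by blast
    have "dist (quot v x (u i)) (quot v x (u j)) < e" if "i \<ge> Suc (m k)" "j \<ge> Suc (m k)" for i j
    proof -
      have "norm (quot v x (u i) - quot v x (u j)) \<le> 1 / Suc k"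
        using that by (intro close u0 u_small) auto
      then show ?thesis using k by (simp add: dist_norm)
    qed
    then show "\<exists>M. \<forall>i\<ge>M. \<forall>j\<ge>M. dist (quot v x (u i)) (quot v x (u j)) < e" by blast
  qed
  then obtain d where d: "(\<lambda>j. quot v x (u j)) \<longlonglongrightarrow> d"
    using Cauchy_convergent convergent_def by blast
  have "norm (quot v x t - d) \<le> 1 / Suc k" if t: "0 < \<bar>t\<bar>" "\<bar>t\<bar> < 1 / Suc (m k)" for t k
  proof (rule LIMSEQ_le_const2)
    show "(\<lambda>j. norm (quot v x t - quot v x (u j))) \<longlonglongrightarrow> norm (quot v x t - d)"
      by (intro tendsto_intros d)
    show "\<exists>N. \<forall>j\<ge>N. norm (quot v x t - quot v x (u j)) \<le> 1 / Suc k"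
    proof (intro exI allI impI)
      fix j assume "j \<ge> Suc (m k)"
      then show "norm (quot v x t - quot v x (u j)) \<le> 1 / Suc k"
        by (intro close t u0 u_small) auto
    qed
  qed
  note lim = this
  have "has_dir_deriv v x d"
    unfolding has_dir_deriv_iff
  proof (intro allI impI)
    fix e :: real assume "e > 0"
    then obtain k :: nat where k: "1 / Suc k < e" using nat_approx_posE by blast
    have "norm (quot v x t - d) < e" if "0 < \<bar>t\<bar> \<and> \<bar>t\<bar> < 1 / Suc (m k)" for t
      using lim[of t k] that k by linarith
    then show "\<exists>r>0. \<forall>t. 0 < \<bar>t\<bar> \<and> \<bar>t\<bar> < r \<longrightarrow> norm (quot v x t - d) < e"
      by (intro exI[of _ "1 / real (Suc (m k))"]) auto
  qed
  then show thesis by (rule that)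
qed

lemma AE_has_dir_deriv: "AE x in \<mu>. \<exists>d. has_dir_deriv v x d"
proof -
  have "- dir_diff v \<in> null_sets \<mu>"
  proof (rule null_set_if_null_on_lines[of _ v])
    show N: "- dir_diff v \<in> sets borel" using borel_dir_diff[of v] by (simp add: borel_comp)
    fix x
    have c: "(\<lambda>t. x + t *\<^sub>R v) \<in> borel_measurable (borel :: real measure)"
      by (intro borel_measurable_continuous_onI continuous_intros)
    have "(\<lambda>t. x + t *\<^sub>R v) -` (- dir_diff v) \<inter> space borel \<in> sets (borel :: real measure)"
      by (rule measurable_sets[OF c N])
    then have m: "{t. x + t *\<^sub>R v \<in> - dir_diff v} \<in> sets lborel" by (simp add: vimage_def)
    interpret lipschitz_curve "\<lambda>t. F (x + t *\<^sub>R v)" "L * norm v"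
    proof
      show "0 \<le> L * norm v" using L0 by simp
      show "norm (F (x + s *\<^sub>R v) - F (x + t *\<^sub>R v)) \<le> L * norm v * \<bar>s - t\<bar>" for s t
        using lip[of "x + s *\<^sub>R v" "x + t *\<^sub>R v"] by (simp flip: scaleR_left_diff_distrib add: mult.assoc mult.commute mult.left_commute)
    qed
    have "AE t in lborel. t \<notin> {t. x + t *\<^sub>R v \<in> - dir_diff v}"
      using AE_differentiable[OF rnp]
    proof eventually_elim
      case (elim t)
      then obtain d where "has_dir_deriv v (x + t *\<^sub>R v) d" using has_dir_deriv_if_curve by blast
      then show ?case using dir_diff_if_has_dir_deriv by simp
    qed
    then show "{t. x + t *\<^sub>R v \<in> - dir_diff v} \<in> null_sets lborel"
      using AE_iff_null_sets[OF m] by simp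
  qed
  then have "AE x in \<mu>. x \<notin> - dir_diff v" by (rule AE_not_in)
  then show ?thesis by eventually_elim (meson has_dir_deriv_if_dir_diff ComplI)
qed

text \<open>Fixing an approximate derivative \<open>y\<close> and a scale makes the set closed. For
  each \<open>k\<close>, every point with a derivative in direction \<open>w\<close> lies in one of
  countably many such sets, \<open>y\<close> running through a dense set.\<close>

definition near_dir :: "'x \<Rightarrow> 'y \<Rightarrow> nat \<Rightarrow> nat \<Rightarrow> 'x set" where
  "near_dir w y k m = (\<Inter>t\<in>{t. 0 < \<bar>t\<bar> \<and> \<bar>t\<bar> < 1 / Suc m}. {x. norm (quot w x t - y) \<le> 1 / Suc k})"

lemma closed_near_dir: "closed (near_dir w y k m)"
  unfolding near_dir_def
  by (intro closed_INT ballI closed_Collect_le continuous_intros continuous_quot)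

end

section \<open>Points of a closed set that are isolated along a direction\<close>

context fd_haar
begin

text \<open>On a line, points without a neighbour in \<open>A\<close> at parameter distance below
  \<open>1 / Suc j\<close> are separated by that gap, hence countable. Their set is Borel because it
  is \<open>A\<close> minus countably many sums of \<open>A\<close> with compact sets.\<close>

lemma AE_not_isolated_on_line:
  assumes A: "closed A"
  shows "AE x in \<mu>. \<not> (x \<in> A \<and> (\<forall>t. 0 < \<bar>t\<bar> \<and> \<bar>t\<bar> < 1 / real (Suc j) \<longrightarrow> x + t *\<^sub>R v \<notin> A))"
proof -
  define J where "J = {x \<in> A. \<forall>t. 0 < \<bar>t\<bar> \<and> \<bar>t\<bar> < 1 / real (Suc j) \<longrightarrow> x + t *\<^sub>R v \<notin> A}"
  \<comment> \<open>Compact sets exhausting the parameters with \<open>0 < \<bar>t\<bar>\<close> and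
    \<open>\<bar>t\<bar> < 1 / Suc j\<close>; the sum of a closed and a compact set is
    closed.\<close>
  define C where "C i = {t::real. 1 / Suc i \<le> \<bar>t\<bar> \<and> \<bar>t\<bar> \<le> 1 / Suc j - 1 / Suc i}" for i :: nat
  have "compact (C i)" for i
  proof -
    have "closed (C i)" unfolding C_def by (intro closed_Collect_conj closed_Collect_le continuous_intros)
    moreover have "C i \<subseteq> cball 0 1"
    proof
      fix t assume "t \<in> C i"
      then have "\<bar>t\<bar> \<le> 1 / Suc j - 1 / Suc i" by (simp add: C_def)
      also have "\<dots> \<le> 1 / real (Suc j)" by simp
      also have "\<dots> \<le> 1" by simp
      finally show "t \<in> cball 0 1" by simp
    qed
    ultimately show ?thesis by (meson bounded_cball bounded_subset compact_eq_bounded_closed)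
  qed
  then have "compact ((\<lambda>t. - (t *\<^sub>R v)) ` C i)" for i
    by (intro compact_continuous_image continuous_intros)
  then have cl: "closed (\<Union>a\<in>A. \<Union>y\<in>(\<lambda>t. - (t *\<^sub>R v)) ` C i. {a + y})" for i
    by (rule closed_compact_sums[OF A])
  have "J = A - (\<Union>i. \<Union>a\<in>A. \<Union>y\<in>(\<lambda>t. - (t *\<^sub>R v)) ` C i. {a + y})" (is "_ = A - ?U")
  proof -
    have "(\<exists>t. 0 < \<bar>t\<bar> \<and> \<bar>t\<bar> < 1 / real (Suc j) \<and> x + t *\<^sub>R v \<in> A) \<longleftrightarrow> x \<in> ?U" for x
    proof
      assume "\<exists>t. 0 < \<bar>t\<bar> \<and> \<bar>t\<bar> < 1 / real (Suc j) \<and> x + t *\<^sub>R v \<in> A"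
      then obtain t where t: "0 < \<bar>t\<bar>" "\<bar>t\<bar> < 1 / real (Suc j)" "x + t *\<^sub>R v \<in> A" by blast
      define e where "e = min \<bar>t\<bar> (1 / real (Suc j) - \<bar>t\<bar>)"
      have "e > 0" using t by (simp add: e_def)
      then obtain i :: nat where "1 / Suc i < e" using nat_approx_posE by blast
      then have "t \<in> C i" by (simp add: C_def e_def)
      moreover have "x = (x + t *\<^sub>R v) + (- (t *\<^sub>R v))" by simp
      ultimately show "x \<in> ?U" using t(3) by blast
    next
      assume "x \<in> ?U"
      then obtain i a t where t: "a \<in> A" "t \<in> C i" "x = a + - (t *\<^sub>R v)" by blast
      have "0 < 1 / real (Suc i)" by simp
      then have "0 < \<bar>t\<bar>" "\<bar>t\<bar> < 1 / real (Suc j)"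
        using t(2) unfolding C_def mem_Collect_eq by linarith+
      moreover have "x + t *\<^sub>R v = a" using t(3) by simp
      ultimately show "\<exists>t. 0 < \<bar>t\<bar> \<and> \<bar>t\<bar> < 1 / real (Suc j) \<and> x + t *\<^sub>R v \<in> A" using t(1) by blast
    qed
    then show ?thesis unfolding J_def by blast
  qed
  then have J: "J \<in> sets borel" using A cl by auto
  have "J \<in> null_sets \<mu>"
  proof (rule null_set_if_null_on_lines[OF J, of v])
    fix x
    let ?S = "{t. x + t *\<^sub>R v \<in> J}"
    have gap: "s = t" if "s \<in> ?S" "t \<in> ?S" "\<bar>s - t\<bar> < 1 / real (Suc j)" for s t
    proof (rule ccontr)
      assume st: "s \<noteq> t"
      have eq: "x + s *\<^sub>R v + (t - s) *\<^sub>R v = x + t *\<^sub>R v" by (simp add: scaleR_left_diff_distrib)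
      have t: "x + t *\<^sub>R v \<in> A" using that(2) by (simp add: J_def)
      have "0 < \<bar>t - s\<bar> \<and> \<bar>t - s\<bar> < 1 / real (Suc j)" using that(3) st by linarith
      then have "x + s *\<^sub>R v + (t - s) *\<^sub>R v \<notin> A" using that(1) unfolding J_def by blast
      then show False using t unfolding eq by blast
    qed
    \<comment> \<open>Distinct parameters are at least \<open>1 / Suc j\<close> apart, so after
      scaling no two have the same integer part.\<close>
    have "inj_on (\<lambda>t. \<lfloor>t * real (Suc j)\<rfloor>) ?S"
    proof (rule inj_onI)
      fix s t assume st: "s \<in> ?S" "t \<in> ?S" "\<lfloor>s * real (Suc j)\<rfloor> = \<lfloor>t * real (Suc j)\<rfloor>"
      then have "\<bar>s * real (Suc j) - t * real (Suc j)\<bar> < 1" by linarith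
      then have "\<bar>s - t\<bar> * real (Suc j) < 1" by (simp only: left_diff_distrib[symmetric] abs_mult)
      then have "\<bar>s - t\<bar> < 1 / real (Suc j)" by (simp add: pos_less_divide_eq)
      then show "s = t" using gap st by blast
    qed
    then have "countable ?S" by (rule countableI')
    then show "?S \<in> null_sets lborel" by (rule countable_imp_null_set_lborel)
  qed
  then have "AE x in \<mu>. x \<notin> J" by (rule AE_not_in)
  then show ?thesis by eventually_elim (simp add: J_def)
qed

end

context lipschitz_RNP_map
begin

text \<open>
  The quotient of \<open>F\<close> at \<open>x + t v\<close> in direction \<open>w\<close> is compared with the one at \<open>x\<close> itself along
  a sequence \<open>t \<rightarrow> 0\<close> for which both points lie in the same closed set \<open>near_dir w y k m\<close>.
\<close>

lemma AE_dir_deriv_add: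
  "AE x in \<mu>. \<forall>d1 d2 d3. has_dir_deriv v x d1 \<longrightarrow> has_dir_deriv w x d2 \<longrightarrow> has_dir_deriv (v + w) x d3
     \<longrightarrow> d3 = d1 + d2"
proof -
  obtain D :: "'y set" where D: "countable D" "\<And>X. open X \<Longrightarrow> X \<noteq> {} \<Longrightarrow> \<exists>d\<in>D. d \<in> X"
    using countable_dense_setE by blast
  have "AE x in \<mu>. \<forall>y\<in>D. \<forall>k m j. \<not> (x \<in> near_dir w y k m \<and>
      (\<forall>t. 0 < \<bar>t\<bar> \<and> \<bar>t\<bar> < 1 / real (Suc j) \<longrightarrow> x + t *\<^sub>R v \<notin> near_dir w y k m))"
    unfolding AE_ball_countable[OF D(1)] AE_all_countable
    by (intro ballI allI AE_not_isolated_on_line closed_near_dir)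
  then show ?thesis
  proof eventually_elim
    case (elim x)
    show ?case
    proof (intro allI impI)
      fix d1 d2 d3 assume d: "has_dir_deriv v x d1" "has_dir_deriv w x d2" "has_dir_deriv (v + w) x d3"
      have "norm (d3 - (d1 + d2)) \<le> 4 / Suc k" for k
      proof -
        define e where "e = 1 / real (Suc k)"
        have e: "e > 0" by (simp add: e_def)
        obtain y where y: "y \<in> D" "dist d2 y < e / 2"
          using D(2)[of "ball d2 (e / 2)"] e by auto
        obtain m :: nat where m: "\<And>t. 0 < \<bar>t\<bar> \<Longrightarrow> \<bar>t\<bar> < 1 / Suc m \<Longrightarrow> norm (quot w x t - d2) < e / 2"
          using has_dir_deriv_small[OF d(2), of "e / 2"] e by auto
        have "norm (quot w x t - y) \<le> 1 / real (Suc k)" if "0 < \<bar>t\<bar>" "\<bar>t\<bar> < 1 / Suc m" for t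
          using m[OF that] y(2) norm_triangle_ineq[of "quot w x t - d2" "d2 - y"]
          unfolding e_def[symmetric] by (simp add: dist_norm)
        then have xA: "x \<in> near_dir w y k m" unfolding near_dir_def by blast
        obtain r1 where r1: "r1 > 0" "\<And>t. 0 < \<bar>t\<bar> \<and> \<bar>t\<bar> < r1 \<Longrightarrow> norm (quot v x t - d1) < e"
          using d(1) e unfolding has_dir_deriv_iff by meson
        obtain r3 where r3: "r3 > 0" "\<And>t. 0 < \<bar>t\<bar> \<and> \<bar>t\<bar> < r3 \<Longrightarrow> norm (quot (v + w) x t - d3) < e"
          using d(3) e unfolding has_dir_deriv_iff by meson
        define r where "r = min (min r1 r3) (1 / real (Suc m))"
        have "r > 0" using r1 r3 by (simp add: r_def)
        \<comment> \<open>This scale is chosen after \<open>m\<close>, so that the neighbour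
          \<open>t\<close> found next meets all three smallness conditions; hence the quantifier
          over all \<open>j\<close> in the almost everywhere statement.\<close>
        then obtain j :: nat where j: "1 / Suc j < r" using nat_approx_posE by blast
        obtain t where t: "0 < \<bar>t\<bar>" "\<bar>t\<bar> < 1 / real (Suc j)" "x + t *\<^sub>R v \<in> near_dir w y k m"
          using elim y(1) xA by blast
        have tr: "\<bar>t\<bar> < r1" "\<bar>t\<bar> < r3" "\<bar>t\<bar> < 1 / real (Suc m)" using t(2) j by (auto simp: r_def)
        have n2: "norm (quot w (x + t *\<^sub>R v) t - y) \<le> e"
          using t(1,3) tr(3) unfolding near_dir_def e_def by blast
        have split: "quot (v + w) x t = quot w (x + t *\<^sub>R v) t + quot v x t"
          unfolding quot_def scaleR_right_distrib[symmetric] by (simp add: scaleR_right_distrib add.assoc)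
        have n1: "norm (quot v x t - d1) < e" using r1(2) t(1) tr by blast
        have n3: "norm (quot (v + w) x t - d3) < e" using r3(2) t(1) tr by blast
        have "d3 - (d1 + d2) = (quot w (x + t *\<^sub>R v) t - y) + (quot v x t - d1) + (y - d2) - (quot (v + w) x t - d3)"
          unfolding split by simp
        also have "norm \<dots> \<le> norm ((quot w (x + t *\<^sub>R v) t - y) + (quot v x t - d1) + (y - d2)) + norm (quot (v + w) x t - d3)"
          by (rule norm_triangle_ineq4)
        also have "norm ((quot w (x + t *\<^sub>R v) t - y) + (quot v x t - d1) + (y - d2))
          \<le> norm (quot w (x + t *\<^sub>R v) t - y) + norm (quot v x t - d1) + norm (y - d2)"
          by (meson add_right_mono norm_triangle_ineq order_trans)
        finally have "norm (d3 - (d1 + d2)) \<le> 4 * e"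
          using n1 n2 n3 y(2) e by (simp add: dist_norm norm_minus_commute)
        then show ?thesis by (simp add: e_def)
      qed
      then have "norm (d3 - (d1 + d2)) \<le> 0"
        using LIMSEQ_le_const[of "\<lambda>k. 4 / real (Suc k)" 0 "norm (d3 - (d1 + d2))"] lim_const_over_n[of 4]
          LIMSEQ_Suc[of "\<lambda>k. 4 / real k" 0] by auto
      then show "d3 = d1 + d2" by simp
    qed
  qed
qed

section \<open>From directional derivatives to the derivative\<close>

lemma has_dir_deriv_zero: "has_dir_deriv 0 x 0"
  unfolding has_dir_deriv_iff quot_def by (auto intro: exI[of _ 1])

lemma has_dir_deriv_scaleR:
  assumes "has_dir_deriv v x d"
  shows "has_dir_deriv (c *\<^sub>R v) x (c *\<^sub>R d)"
proof (cases "c = 0")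
  case True
  then show ?thesis using has_dir_deriv_zero by simp
next
  case False
  show ?thesis
    unfolding has_dir_deriv_iff
  proof (intro allI impI)
    fix e :: real assume e: "e > 0"
    then have "e / \<bar>c\<bar> > 0" using False by simp
    then obtain r where r: "r > 0" "\<And>t. 0 < \<bar>t\<bar> \<and> \<bar>t\<bar> < r \<Longrightarrow> norm (quot v x t - d) < e / \<bar>c\<bar>"
      using assms unfolding has_dir_deriv_iff by meson
    have "norm (quot (c *\<^sub>R v) x t - c *\<^sub>R d) < e" if t: "0 < \<bar>t\<bar> \<and> \<bar>t\<bar> < r / \<bar>c\<bar>" for t
    proof -
      have "c * inverse (c * t) = inverse t" using False by simp
      then have "c *\<^sub>R quot v x (c * t) = quot (c *\<^sub>R v) x t"
        unfolding quot_def scaleR_scaleR by (simp only: mult.commute[of t c])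
      then have "quot (c *\<^sub>R v) x t - c *\<^sub>R d = c *\<^sub>R (quot v x (c * t) - d)"
        by (simp add: scaleR_right_diff_distrib)
      moreover have "norm (quot v x (c * t) - d) < e / \<bar>c\<bar>"
        using t False by (intro r(2)) (auto simp: abs_mult pos_less_divide_eq mult.commute)
      ultimately show ?thesis using False by (simp add: pos_less_divide_eq mult.commute)
    qed
    then show "\<exists>r>0. \<forall>t. 0 < \<bar>t\<bar> \<and> \<bar>t\<bar> < r \<longrightarrow> norm (quot (c *\<^sub>R v) x t - c *\<^sub>R d) < e"
      using r(1) False by (intro exI[of _ "r / \<bar>c\<bar>"]) auto
  qed
qed

text \<open>Finitely many rational directions form a net of the unit ball and share a radius of
  approximation. The Lipschitz bound of \<open>F\<close> and the norm of \<open>T\<close> transfer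
  the estimate to every direction.\<close>

lemma has_derivative_if_dir_deriv:
  fixes T :: "'x \<Rightarrow>\<^sub>L 'y"
  assumes T: "\<And>v. v \<in> ratspan \<Longrightarrow> has_dir_deriv v x (blinfun_apply T v)"
  shows "(F has_derivative blinfun_apply T) (at x)"
  unfolding has_derivative_at_alt
proof (intro conjI allI impI blinfun.bounded_linear_right)
  fix e :: real assume e: "e > 0"
  \<comment> \<open>Replacing a direction by its neighbour in the net costs at most
    \<open>L * (t * e')\<close> in \<open>F\<close> and \<open>norm T * (t * e')\<close> in
    \<open>T\<close>; together this stays below \<open>t * (e / 2)\<close>.\<close>
  define M where "M = L + norm T + 1"
  have M: "M > 0" using L0 by (simp add: M_def add_nonneg_pos)
  define e' where "e' = e / (2 * M)"
  have e': "e' > 0" using e M by (simp add: e'_def)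
  obtain Z :: "'x set" where Z: "finite Z" "cball 0 1 \<subseteq> (\<Union>z\<in>Z. ball z e')" "Z \<subseteq> ratspan"
    using finite_net[OF e'] by blast
  have "\<forall>z\<in>Z. \<exists>r>0. \<forall>t. 0 < \<bar>t\<bar> \<and> \<bar>t\<bar> < r \<longrightarrow> norm (quot z x t - blinfun_apply T z) < e / 2"
  proof
    fix z assume "z \<in> Z"
    then have "has_dir_deriv z x (blinfun_apply T z)" using Z(3) by (intro T) blast
    moreover have "e / 2 > 0" using e by simp
    ultimately show "\<exists>r>0. \<forall>t. 0 < \<bar>t\<bar> \<and> \<bar>t\<bar> < r \<longrightarrow> norm (quot z x t - blinfun_apply T z) < e / 2"
      unfolding has_dir_deriv_iff by blast
  qed
  then obtain r where r: "\<And>z. z \<in> Z \<Longrightarrow> r z > 0"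
    "\<And>z t. z \<in> Z \<Longrightarrow> 0 < \<bar>t\<bar> \<and> \<bar>t\<bar> < r z \<Longrightarrow> norm (quot z x t - blinfun_apply T z) < e / 2"
    by metis
  define d where "d = Min (insert 1 (r ` Z))"
  have d: "d > 0" "\<And>z. z \<in> Z \<Longrightarrow> d \<le> r z"
    using Z(1) r(1) by (auto simp: d_def)
  have "norm (F y - F x - blinfun_apply T (y - x)) \<le> e * norm (y - x)" if y: "norm (y - x) < d" for y
  proof (cases "y = x")
    case False
    define t where "t = norm (y - x)"
    define h where "h = inverse t *\<^sub>R (y - x)"
    have t: "t > 0" using False by (simp add: t_def)
    have yx: "y = x + t *\<^sub>R h" using t by (simp add: h_def)
    have "norm h = 1" using t by (simp add: h_def t_def)
    then obtain z where z: "z \<in> Z" "norm (z - h) < e'" using Z(2) by (force simp: dist_norm)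
    have q: "norm (quot z x t - blinfun_apply T z) < e / 2"
      using r(2)[OF z(1), of t] d(2)[OF z(1)] y t by (simp add: t_def)
    have q': "norm (F (x + t *\<^sub>R z) - F x - t *\<^sub>R blinfun_apply T z) \<le> t * (e / 2)"
    proof -
      have "F (x + t *\<^sub>R z) - F x - t *\<^sub>R blinfun_apply T z = t *\<^sub>R (quot z x t - blinfun_apply T z)"
        using t by (simp add: quot_def scaleR_right_diff_distrib)
      then show ?thesis using q t by (simp add: mult_left_mono)
    qed
    have l: "norm (F y - F (x + t *\<^sub>R z)) \<le> L * (t * e')"
    proof -
      have "norm (F y - F (x + t *\<^sub>R z)) \<le> L * norm (t *\<^sub>R (h - z))"
        using lip[of y "x + t *\<^sub>R z"] yx by (simp add: scaleR_right_diff_distrib)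
      also have "norm (t *\<^sub>R (h - z)) \<le> t * e'"
        using z(2) t by (simp add: norm_minus_commute mult_left_mono)
      finally show ?thesis using L0 by (simp add: mult_left_mono)
    qed
    have p: "norm (t *\<^sub>R blinfun_apply T (z - h)) \<le> norm T * (t * e')"
    proof -
      have "norm (blinfun_apply T (z - h)) \<le> norm T * norm (z - h)" by (rule norm_blinfun)
      also have "\<dots> \<le> norm T * e'" using z(2) by (intro mult_left_mono) auto
      finally show ?thesis using t by (simp add: mult_left_mono mult.left_commute)
    qed
    have "blinfun_apply T (y - x) = t *\<^sub>R blinfun_apply T h" using yx by (simp add: blinfun.scaleR_right)
    then have "F y - F x - blinfun_apply T (y - x)
      = (F y - F (x + t *\<^sub>R z)) + (F (x + t *\<^sub>R z) - F x - t *\<^sub>R blinfun_apply T z) + t *\<^sub>R blinfun_apply T (z - h)"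
      by (simp add: blinfun.diff_right scaleR_right_diff_distrib)
    also have "norm \<dots> \<le> norm (F y - F (x + t *\<^sub>R z)) + norm (F (x + t *\<^sub>R z) - F x - t *\<^sub>R blinfun_apply T z)
        + norm (t *\<^sub>R blinfun_apply T (z - h))"
      by (meson add_right_mono norm_triangle_ineq order_trans)
    also have "\<dots> \<le> L * (t * e') + t * (e / 2) + norm T * (t * e')" using l q' p by linarith
    also have "\<dots> \<le> M * (t * e') + t * (e / 2)" using t e' by (simp add: M_def algebra_simps)
    also have "\<dots> = e * t" using M by (simp add: e'_def field_simps)
    finally show ?thesis by (simp add: t_def)
  qed simp
  then show "\<exists>d>0. \<forall>y. norm (y - x) < d \<longrightarrow> norm (F y - F x - blinfun_apply T (y - x)) \<le> e * norm (y - x)"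
    using d(1) by blast
qed

text \<open>Existence and additivity hold off a null set for rational directions only. Induction
  over the basis then identifies the derivative along each rational combination with the value of
  one linear map, \<open>lin_of d\<close>.\<close>

theorem rademacher: "AE x in \<mu>. \<exists>T::'x \<Rightarrow>\<^sub>L 'y. (F has_derivative blinfun_apply T) (at x)"
proof -
  have "AE x in \<mu>. (\<forall>v\<in>ratspan. \<exists>d. has_dir_deriv v x d) \<and> (\<forall>v\<in>ratspan. \<forall>w\<in>ratspan.
      \<forall>d1 d2 d3. has_dir_deriv v x d1 \<longrightarrow> has_dir_deriv w x d2 \<longrightarrow> has_dir_deriv (v + w) x d3 \<longrightarrow> d3 = d1 + d2)"
    unfolding AE_conj_iff AE_ball_countable[OF countable_ratspan]
    by (intro conjI ballI AE_has_dir_deriv AE_dir_deriv_add)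
  then show ?thesis
  proof eventually_elim
    case (elim x)
    \<comment> \<open>Partial sums must stay in \<open>ratspan\<close>, as existence and additivity
      are available only there.\<close>
    have part: "(\<Sum>i<m. of_rat (q i) *\<^sub>R b i) \<in> ratspan" if "m \<le> n" for m q
    proof -
      have "(\<Sum>i<m. of_rat (q i) *\<^sub>R b i) = (\<Sum>i<n. of_rat (if i < m then q i else 0) *\<^sub>R b i)"
        using that by (intro sum.mono_neutral_cong_left) auto
      then show ?thesis using ratspanI[of "\<lambda>i. if i < m then q i else 0"] by (simp only:)
    qed
    have single: "of_rat c *\<^sub>R b i \<in> ratspan" if "i < n" for c i
    proof -
      have "(\<Sum>j<n. of_rat (if j = i then c else 0) *\<^sub>R b j) = (\<Sum>j<n. if j = i then of_rat c *\<^sub>R b j else 0)"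
        by (intro sum.cong) auto
      then have "(\<Sum>j<n. of_rat (if j = i then c else 0) *\<^sub>R b j) = of_rat c *\<^sub>R b i" using that by simp
      then show ?thesis using ratspanI[of "\<lambda>j. if j = i then c else 0"] by (simp only:)
    qed
    have "\<exists>d. has_dir_deriv (b i) x d" if "i < n" for i
      using single[OF that, of 1] elim by auto
    then obtain d where d: "\<And>i. i < n \<Longrightarrow> has_dir_deriv (b i) x (d i)" by metis
    have step: "has_dir_deriv (\<Sum>i<m. of_rat (q i) *\<^sub>R b i) x (\<Sum>i<m. of_rat (q i) *\<^sub>R d i)" if "m \<le> n" for m q
      using that
    proof (induction m)
      case 0
      then show ?case by (simp add: has_dir_deriv_zero)
    next
      case (Suc m)
      let ?v = "\<Sum>i<m. of_rat (q i) *\<^sub>R b i" and ?w = "of_rat (q m) *\<^sub>R b m"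
      have "?v + ?w \<in> ratspan" using part[OF Suc.prems, of q] by simp
      then obtain d3 where d3: "has_dir_deriv (?v + ?w) x d3" using elim by blast
      have "has_dir_deriv ?w x (of_rat (q m) *\<^sub>R d m)"
        using d Suc.prems by (intro has_dir_deriv_scaleR) auto
      then have "d3 = (\<Sum>i<m. of_rat (q i) *\<^sub>R d i) + of_rat (q m) *\<^sub>R d m"
        using elim part[of m q] single[of m "q m"] Suc d3 by (meson Suc_leD Suc_le_lessD)
      then show ?case using d3 by simp
    qed
    have "has_dir_deriv v x (blinfun_apply (lin_of d) v)" if v: "v \<in> ratspan" for v
    proof -
      obtain q where q: "v = (\<Sum>i<n. of_rat (q i) *\<^sub>R b i)" using v by (rule ratspanE)
      have "blinfun_apply (lin_of d) v = (\<Sum>i<n. of_rat (q i) *\<^sub>R d i)"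
        unfolding q by (simp add: blinfun.sum_right blinfun.scaleR_right lin_of_basis)
      then show ?thesis using step[of n q] q by simp
    qed
    then have "(F has_derivative blinfun_apply (lin_of d)) (at x)"
      by (rule has_derivative_if_dir_deriv)
    then show ?case by blast
  qed
qed

end

section \<open>Unordered tuples and affine maps\<close>

text \<open>Enumerated tuples are functions on the naturals whose values from \<open>Q\<close> on
  are ignored; reindexing is then composition with a permutation.\<close>

definition tup :: "nat \<Rightarrow> (nat \<Rightarrow> 'z) \<Rightarrow> 'z multiset" where
  "tup Q u = mset (map u [0..<Q])"

lemma size_tup [simp]: "size (tup Q u) = Q"
  by (simp add: tup_def)

lemma tup_in_qtuples [simp]: "tup Q u \<in> qtuples Q"
  by (simp add: qtuples_def)

lemma set_mset_tup [simp]: "set_mset (tup Q u) = u ` {..<Q}"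
  by (simp add: tup_def atLeast0LessThan)

lemma image_mset_tup: "image_mset g (tup Q u) = tup Q (\<lambda>i. g (u i))"
  by (simp add: tup_def o_def flip: mset_map)

lemma tup_cong: "(\<And>i. i < Q \<Longrightarrow> u i = w i) \<Longrightarrow> tup Q u = tup Q w"
  unfolding tup_def by (intro arg_cong[where f = mset] map_cong) auto

lemma tup_nth: "length xs = Q \<Longrightarrow> tup Q ((!) xs) = mset xs"
  by (metis map_nth tup_def)

lemma ex_tup:
  assumes "size M = Q"
  obtains u where "M = tup Q u"
proof -
  obtain xs where "mset xs = M" using ex_mset by blast
  then show thesis using that[of "(!) xs"] assms tup_nth[of xs Q] by auto
qed

lemma sum_mset_tup: "(\<Sum>x\<in>#tup Q u. g x) = (\<Sum>i<Q. g (u i))"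
  by (simp add: tup_def sum_mset_sum_list flip: mset_map)
    (simp add: interv_sum_list_conv_sum_set_nat atLeast0LessThan o_def)

lemma tup_eq_iff:
  "tup Q u = tup Q w \<longleftrightarrow> (\<exists>\<sigma>. \<sigma> permutes {..<Q} \<and> (\<forall>i<Q. u i = w (\<sigma> i)))"
proof
  assume "tup Q u = tup Q w"
  then have "mset (map u [0..<Q]) = mset (map w [0..<Q])" by (simp only: tup_def)
  then obtain p where p: "p permutes {..<length (map w [0..<Q])}" "permute_list p (map w [0..<Q]) = map u [0..<Q]"
    by (rule mset_eq_permutation)
  have "u i = w (p i)" if i: "i < Q" for i
  proof -
    have pi: "p i < Q" using p(1) i permutes_in_image[of p "{..<Q}" i] by simp
    have "map u [0..<Q] ! i = map w [0..<Q] ! p i"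
      using permute_list_nth[OF p(1), of i] p(2) i by simp
    then show ?thesis using i pi by simp
  qed
  then show "\<exists>\<sigma>. \<sigma> permutes {..<Q} \<and> (\<forall>i<Q. u i = w (\<sigma> i))" using p(1) by auto
next
  assume "\<exists>\<sigma>. \<sigma> permutes {..<Q} \<and> (\<forall>i<Q. u i = w (\<sigma> i))"
  then obtain \<sigma> where \<sigma>: "\<sigma> permutes {..<Q}" "\<And>i. i < Q \<Longrightarrow> u i = w (\<sigma> i)" by blast
  have "map u [0..<Q] = permute_list \<sigma> (map w [0..<Q])"
    unfolding permute_list_def
  proof (rule nth_equalityI)
    fix i assume "i < length (map u [0..<Q])"
    then have i: "i < Q" by simp
    then have "\<sigma> i < Q" using permutes_in_image[OF \<sigma>(1), of i] by simp
    then show "map u [0..<Q] ! i = map (\<lambda>i. map w [0..<Q] ! \<sigma> i) [0..<length (map w [0..<Q])] ! i"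
      using i \<sigma>(2) by simp
  qed simp
  then show "tup Q u = tup Q w" unfolding tup_def using \<sigma>(1) by simp
qed

lemma tup_permute: "\<sigma> permutes {..<Q} \<Longrightarrow> tup Q (\<lambda>i. u (\<sigma> i)) = tup Q u"
  unfolding tup_eq_iff by blast

lemma qdist_tup_le: "qdist d (tup Q u) (tup Q w) \<le> L2_set (\<lambda>i. d (u i) (w i)) {..<Q}"
proof -
  have "qdist d (tup Q u) (tup Q w)
     \<le> L2_set (\<lambda>i. d (map u [0..<Q] ! i) (map w [0..<Q] ! i)) {..<length (map u [0..<Q])}"
    unfolding tup_def by (rule qdist_le_aligned) simp
  also have "\<dots> = L2_set (\<lambda>i. d (u i) (w i)) {..<Q}"
    by (rule L2_set_cong) auto
  finally show ?thesis .
qed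

text \<open>The optimal permutation is absorbed into the enumeration of \<open>M\<close> while
  \<open>u\<close> stays as given; \<open>qdist_tup_perm\<close> keeps both enumerations and
  exhibits the permutation.\<close>

lemma qdist_tup_aligned:
  assumes "size M = Q"
  obtains w where "M = tup Q w" "qdist d (tup Q u) M = L2_set (\<lambda>i. d (u i) (w i)) {..<Q}"
proof -
  obtain ys where ys: "mset ys = M" "length ys = length (map u [0..<Q])"
    "qdist d (tup Q u) M = L2_set (\<lambda>i. d (map u [0..<Q] ! i) (ys ! i)) {..<length (map u [0..<Q])}"
    by (rule qdist_attained_aligned[of "tup Q u" M "map u [0..<Q]" d]) (use assms in \<open>auto simp: tup_def\<close>)
  have "qdist d (tup Q u) M = L2_set (\<lambda>i. d (u i) (ys ! i)) {..<Q}"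
    unfolding ys(3) by (rule L2_set_cong) auto
  then show thesis using that[of "(!) ys"] tup_nth[of ys Q] ys by simp
qed

lemma qdist_tup_perm:
  obtains \<sigma> where "\<sigma> permutes {..<Q}" "qdist d (tup Q u) (tup Q w) = L2_set (\<lambda>i. d (u i) (w (\<sigma> i))) {..<Q}"
proof -
  obtain w' where w': "tup Q w = tup Q w'" "qdist d (tup Q u) (tup Q w) = L2_set (\<lambda>i. d (u i) (w' i)) {..<Q}"
    by (rule qdist_tup_aligned[of "tup Q w" Q d u]) simp
  then obtain \<sigma> where \<sigma>: "\<sigma> permutes {..<Q}" "\<forall>i<Q. w' i = w (\<sigma> i)" using tup_eq_iff[of Q w' w] by auto
  then have "L2_set (\<lambda>i. d (u i) (w' i)) {..<Q} = L2_set (\<lambda>i. d (u i) (w (\<sigma> i))) {..<Q}"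
    by (intro L2_set_cong) auto
  then show thesis using that \<sigma>(1) w'(2) by simp
qed

lemma L2_set_le_card_times:
  assumes "\<And>i. i < Q \<Longrightarrow> 0 \<le> f i \<and> f i \<le> c"
  shows "L2_set f {..<Q} \<le> real Q * c"
proof -
  have "L2_set f {..<Q} \<le> (\<Sum>i<Q. f i)" using assms by (intro L2_set_le_sum) auto
  also have "\<dots> \<le> (\<Sum>i<Q. c)" using assms by (intro sum_mono) auto
  finally show ?thesis by simp
qed

lemma Metric_space_dist: "Metric_space UNIV (dist :: 'a::metric_space \<Rightarrow> 'a \<Rightarrow> real)"
  by unfold_locales (auto simp: dist_commute dist_triangle)

lemma qdist_dist_commute: "qdist (dist :: 'a::metric_space \<Rightarrow> 'a \<Rightarrow> real) M N = qdist dist N M"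
  using Metric_space.commute[OF Metric_space_qdist[OF Metric_space_dist]] .

lemma qdist_dist_nonneg [simp]: "0 \<le> qdist (dist :: 'a::metric_space \<Rightarrow> 'a \<Rightarrow> real) M N"
  using Metric_space.nonneg[OF Metric_space_qdist[OF Metric_space_dist]] .

lemma qdist_dist_triangle:
  assumes "M \<in> qtuples Q" "N \<in> qtuples Q" "K \<in> qtuples Q"
  shows "qdist (dist :: 'a::metric_space \<Rightarrow> 'a \<Rightarrow> real) M K \<le> qdist dist M N + qdist dist N K"
  using Metric_space.triangle[OF Metric_space_qdist[OF Metric_space_dist] assms] .

lemma qdist_dist_zero_iff:
  assumes "M \<in> qtuples Q" "N \<in> qtuples Q"
  shows "qdist (dist :: 'a::metric_space \<Rightarrow> 'a \<Rightarrow> real) M N = 0 \<longleftrightarrow> M = N"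
  using Metric_space.zero[OF Metric_space_qdist[OF Metric_space_dist] assms] .

section \<open>Affine branches and differentiability of tuple-valued maps\<close>

definition aff :: "'x::real_normed_vector \<Rightarrow> 'y::real_normed_vector \<Rightarrow> ('x \<Rightarrow>\<^sub>L 'y) \<Rightarrow> 'x \<Rightarrow> 'y" where
  "aff a y L = (\<lambda>x. y + blinfun_apply L (x - a))"

lemma affine_map_aff: "affine_map (aff a y L)"
proof -
  have "(\<lambda>x. aff a y L x - aff a y L 0) = blinfun_apply L"
    by (auto simp: aff_def blinfun.diff_right)
  then show ?thesis by (simp add: affine_map_def blinfun.bounded_linear_right)
qed

lemma linear_part_aff: "linear_part (aff a y L) = L"
proof -
  have "(\<lambda>x. aff a y L x - aff a y L 0) = blinfun_apply L"
    by (auto simp: aff_def blinfun.diff_right)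
  then show ?thesis by (simp add: linear_part_def blinfun_apply_inverse)
qed

lemma aff_center [simp]: "aff a y L a = y"
  by (simp add: aff_def)

lemma affine_map_eq_aff:
  assumes "affine_map A"
  shows "A = aff a (A a) (linear_part A)"
proof
  fix x
  have bl: "bounded_linear (\<lambda>x. A x - A 0)" using assms by (simp add: affine_map_def)
  then have "blinfun_apply (linear_part A) z = A z - A 0" for z
    by (simp add: linear_part_def bounded_linear_Blinfun_apply)
  then show "A x = aff a (A a) (linear_part A) x" by (simp add: aff_def blinfun.diff_right)
qed

lemma ex_aff_tup:
  assumes "size As = Q" "\<forall>A\<in>#As. affine_map A"
  obtains ys Ls where "As = tup Q (\<lambda>i. aff a (ys i) (Ls i))"
proof -
  obtain A where A: "As = tup Q A" using assms(1) by (rule ex_tup)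
  have "A i = aff a (A i a) (linear_part (A i))" if "i < Q" for i
    using assms(2) that A by (intro affine_map_eq_aff) auto
  then have "As = tup Q (\<lambda>i. aff a (A i a) (linear_part (A i)))"
    unfolding A by (intro tup_cong) auto
  then show thesis by (rule that)
qed

lemma qeval_tup: "qeval (tup Q A) x = tup Q (\<lambda>i. A i x)"
  by (simp add: qeval_def image_mset_tup)

lemma qeval_aff: "qeval (tup Q (\<lambda>i. aff a (ys i) (Ls i))) x = tup Q (\<lambda>i. ys i + blinfun_apply (Ls i) (x - a))"
  by (simp add: qeval_tup aff_def)

lemma size_qeval [simp]: "size (qeval As x) = size As"
  by (simp add: qeval_def)

text \<open>Classical differentiability. The point \<open>x = a\<close> is included, where the
  inequality forces distance 0, so the value at \<open>a\<close> needs no separate clause.\<close>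

definition qdiff :: "nat \<Rightarrow> ('x::real_normed_vector \<Rightarrow> 'y::real_normed_vector multiset) \<Rightarrow> 'x \<Rightarrow> ('x \<Rightarrow> 'y) multiset \<Rightarrow> bool" where
  "qdiff Q f a As \<longleftrightarrow> size As = Q \<and> (\<forall>A\<in>#As. affine_map A) \<and>
     (\<forall>\<epsilon>>0. \<exists>\<delta>>0. \<forall>x. norm (x - a) < \<delta> \<longrightarrow> qdist dist (f x) (qeval As x) \<le> \<epsilon> * norm (x - a))"

lemma qdiff_aff_tup:
  assumes "qdiff Q f a As"
  obtains ys Ls where "As = tup Q (\<lambda>i. aff a (ys i) (Ls i))"
proof -
  have "size As = Q" "\<forall>A\<in>#As. affine_map A" using assms by (auto simp: qdiff_def)
  then show thesis using that by (rule ex_aff_tup)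
qed

section \<open>One permutation for all scales and all directions\<close>

text \<open>If every \<open>s\<close> failed at some \<open>e s\<close>, the smallest of these
  finitely many thresholds would contradict the assumption.\<close>

lemma finite_uniform_choice:
  assumes "finite S" "\<And>e. e > (0::real) \<Longrightarrow> \<exists>s\<in>S. P s e"
    and mono: "\<And>s e e'. P s e \<Longrightarrow> e \<le> e' \<Longrightarrow> P s e'"
  shows "\<exists>s\<in>S. \<forall>e>0. P s e"
proof (rule ccontr)
  assume "\<not> ?thesis"
  then obtain e where e: "\<And>s. s \<in> S \<Longrightarrow> e s > 0 \<and> \<not> P s (e s)" by metis
  define m where "m = Min (insert 1 (e ` S))"
  have "m > 0" "\<And>s. s \<in> S \<Longrightarrow> m \<le> e s" using assms(1) e by (auto simp: m_def)
  then show False using assms(2)[of m] mono e by blast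
qed

context fd_basis
begin

text \<open>
  By pigeonhole, among the vectors \<open>u + t b\<^sub>k\<close> with \<open>t = 0, \<dots>, M\<close> two share their index \<open>\<sigma>\<close>; this
  transfers smallness from \<open>u + t b\<^sub>k\<close> to \<open>u\<close> and \<open>b\<^sub>k\<close> for this \<open>\<sigma>\<close>.
\<close>

primrec pigeonhole_const :: "nat \<Rightarrow> nat \<Rightarrow> real \<Rightarrow> real" where
  "pigeonhole_const M 0 R = R"
| "pigeonhole_const M (Suc k) R = (2 * real M + 3) * pigeonhole_const M k (R + real M * norm (b k))"

lemma pigeonhole_const_nonneg: "0 \<le> R \<Longrightarrow> 0 \<le> pigeonhole_const M k R"
  by (induction k arbitrary: R) auto

lemma pigeonhole_step:
  fixes \<Lambda> :: "'s \<Rightarrow> nat \<Rightarrow> 'x \<Rightarrow>\<^sub>L 'y::real_normed_vector" and M N :: nat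
  assumes S: "finite S" "card S \<le> M" and e: "0 \<le> \<epsilon>"
    and H: "\<And>h. \<exists>\<sigma>\<in>S. \<forall>i<N. norm (blinfun_apply (\<Lambda> \<sigma> i) h) \<le> \<epsilon> * norm h"
  shows "norm u \<le> R \<Longrightarrow> \<exists>\<sigma>\<in>S. \<forall>i<N. norm (blinfun_apply (\<Lambda> \<sigma> i) u) \<le> pigeonhole_const M k R * \<epsilon> \<and>
     (\<forall>j<k. norm (blinfun_apply (\<Lambda> \<sigma> i) (b j)) \<le> pigeonhole_const M k R * \<epsilon>)"
proof (induction k arbitrary: u R)
  case 0
  obtain \<sigma> where \<sigma>: "\<sigma> \<in> S" "\<forall>i<N. norm (blinfun_apply (\<Lambda> \<sigma> i) u) \<le> \<epsilon> * norm u" using H by blast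
  have "\<epsilon> * norm u \<le> R * \<epsilon>" using e 0 by (metis mult.commute mult_left_mono)
  then show ?case using \<sigma> by (intro bexI[of _ \<sigma>]) (auto intro: order_trans)
next
  case (Suc k)
  define C where "C = pigeonhole_const M k (R + real M * norm (b k))"
  have "0 \<le> R" using norm_ge_zero Suc.prems by (rule order_trans)
  then have C: "C \<ge> 0" unfolding C_def by (intro pigeonhole_const_nonneg) simp
  have C_Suc: "pigeonhole_const M (Suc k) R = (2 * real M + 3) * C" by (simp add: C_def)
  have "\<exists>\<sigma>\<in>S. \<forall>i<N. norm (blinfun_apply (\<Lambda> \<sigma> i) (u + real t *\<^sub>R b k)) \<le> C * \<epsilon> \<and>
      (\<forall>j<k. norm (blinfun_apply (\<Lambda> \<sigma> i) (b j)) \<le> C * \<epsilon>)" if "t \<le> M" for t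
    unfolding C_def
  proof (rule Suc.IH)
    have "norm (u + real t *\<^sub>R b k) \<le> norm u + real t * norm (b k)" by (metis abs_of_nat norm_scaleR norm_triangle_ineq)
    also have "\<dots> \<le> R + real M * norm (b k)" using Suc.prems that by (intro add_mono mult_right_mono) auto
    finally show "norm (u + real t *\<^sub>R b k) \<le> R + real M * norm (b k)" .
  qed
  then obtain \<sigma> where \<sigma>: "\<And>t. t \<le> M \<Longrightarrow> \<sigma> t \<in> S"
    "\<And>t i. t \<le> M \<Longrightarrow> i < N \<Longrightarrow> norm (blinfun_apply (\<Lambda> (\<sigma> t) i) (u + real t *\<^sub>R b k)) \<le> C * \<epsilon>"
    "\<And>t i j. t \<le> M \<Longrightarrow> i < N \<Longrightarrow> j < k \<Longrightarrow> norm (blinfun_apply (\<Lambda> (\<sigma> t) i) (b j)) \<le> C * \<epsilon>"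
    by metis
  \<comment> \<open>There are \<open>M + 1\<close> parameters but at most \<open>M\<close>
    indices.\<close>
  have "\<not> inj_on \<sigma> {..M}"
  proof
    assume "inj_on \<sigma> {..M}"
    then have "card {..M} \<le> card S" using \<sigma>(1) S(1) by (intro card_inj_on_le) auto
    then show False using S(2) by simp
  qed
  then obtain s t where "s \<le> M" "t \<le> M" "s \<noteq> t" "\<sigma> s = \<sigma> t" by (auto simp: inj_on_def)
  then obtain s t where st: "s \<le> M" "t \<le> M" "s < t" "\<sigma> s = \<sigma> t" by (metis nat_neq_iff)
  have "norm (blinfun_apply (\<Lambda> (\<sigma> t) i) u) \<le> (2 * real M + 3) * C * \<epsilon> \<and>
      (\<forall>j<Suc k. norm (blinfun_apply (\<Lambda> (\<sigma> t) i) (b j)) \<le> (2 * real M + 3) * C * \<epsilon>)" if i: "i < N" for i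
  proof -
    let ?A = "blinfun_apply (\<Lambda> (\<sigma> t) i)"
    define c where "c = C * \<epsilon>"
    have c: "c \<ge> 0" using C e by (simp add: c_def)
    have 1: "norm (?A (u + real s *\<^sub>R b k)) \<le> c" "norm (?A (u + real t *\<^sub>R b k)) \<le> c"
      using \<sigma>(2)[OF st(1) i] \<sigma>(2)[OF st(2) i] st(4) by (auto simp: c_def)
    \<comment> \<open>Subtracting the two vectors isolates \<open>b k\<close>, with a factor of at
      least 1 because \<open>s < t\<close> are integers. This gives \<open>2 * c\<close> for
      \<open>b k\<close> and \<open>(2 * M + 1) * c\<close> for \<open>u\<close>; the factor
      \<open>2 * M + 3\<close> covers both.\<close>
    have "(real t - real s) *\<^sub>R ?A (b k) = ?A (u + real t *\<^sub>R b k) - ?A (u + real s *\<^sub>R b k)"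
      by (simp add: blinfun.add_right blinfun.scaleR_right scaleR_left_diff_distrib)
    then have "norm ((real t - real s) *\<^sub>R ?A (b k)) \<le> 2 * c"
      using norm_triangle_ineq4[of "?A (u + real t *\<^sub>R b k)" "?A (u + real s *\<^sub>R b k)"] 1 by simp
    then have "(real t - real s) * norm (?A (b k)) \<le> 2 * c" using st(3) by simp
    moreover have "1 * norm (?A (b k)) \<le> (real t - real s) * norm (?A (b k))"
      using st(3) by (intro mult_right_mono) auto
    ultimately have bk: "norm (?A (b k)) \<le> 2 * c" by linarith
    have "norm (?A u) = norm (?A (u + real s *\<^sub>R b k) - real s *\<^sub>R ?A (b k))"
      by (simp add: blinfun.add_right blinfun.scaleR_right)
    also have "\<dots> \<le> c + real s * norm (?A (b k))"
      using norm_triangle_ineq4[of "?A (u + real s *\<^sub>R b k)" "real s *\<^sub>R ?A (b k)"] 1(1) by simp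
    also have "\<dots> \<le> c + real M * (2 * c)"
      using st(1) bk by (intro add_left_mono mult_mono) auto
    also have "\<dots> \<le> (2 * real M + 3) * c" using c by (simp add: algebra_simps)
    finally have u': "norm (?A u) \<le> (2 * real M + 3) * c" .
    have "0 \<le> real M * c" using c by simp
    then have "2 * c \<le> (2 * real M + 3) * c" "c \<le> (2 * real M + 3) * c" using c by (auto simp: distrib_right)
    then have "norm (?A (b j)) \<le> (2 * real M + 3) * c" if "j < Suc k" for j
      using bk \<sigma>(3)[OF st(2) i, of j] that unfolding c_def[symmetric] by (cases "j = k") auto
    then show ?thesis using u' by (auto simp: c_def mult.assoc)
  qed
  then show ?case unfolding C_Suc using \<sigma>(1)[OF st(2)] by blast
qed

definition matching_const :: "nat \<Rightarrow> real" where
  "matching_const M = K * (real n * pigeonhole_const M n 0)"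

lemma matching_const_nonneg: "0 \<le> matching_const M"
  using K_pos by (simp add: matching_const_def pigeonhole_const_nonneg)

text \<open>The induction is run from \<open>u = 0\<close> through all basis vectors, whose values
  control the operator norm. The constant depends on the number of indices, not on
  \<open>\<epsilon>\<close> or the maps.\<close>

lemma matching_index:
  fixes \<Lambda> :: "'s \<Rightarrow> nat \<Rightarrow> 'x \<Rightarrow>\<^sub>L 'y::real_normed_vector" and M N :: nat
  assumes "finite S" "card S \<le> M" "0 \<le> \<epsilon>"
    and "\<And>h. \<exists>\<sigma>\<in>S. \<forall>i<N. norm (blinfun_apply (\<Lambda> \<sigma> i) h) \<le> \<epsilon> * norm h"
  shows "\<exists>\<sigma>\<in>S. \<forall>i<N. norm (\<Lambda> \<sigma> i) \<le> matching_const M * \<epsilon>"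
proof -
  obtain \<sigma> where \<sigma>: "\<sigma> \<in> S"
    "\<And>i j. i < N \<Longrightarrow> j < n \<Longrightarrow> norm (blinfun_apply (\<Lambda> \<sigma> i) (b j)) \<le> pigeonhole_const M n 0 * \<epsilon>"
    using pigeonhole_step[where \<Lambda> = \<Lambda> and N = N, OF assms, of 0 0 n] by auto
  have "norm (\<Lambda> \<sigma> i) \<le> matching_const M * \<epsilon>" if "i < N" for i
  proof -
    have "norm (\<Lambda> \<sigma> i) \<le> K * (\<Sum>j<n. norm (blinfun_apply (\<Lambda> \<sigma> i) (b j)))" by (rule norm_blinfun_le_basis)
    also have "\<dots> \<le> K * (\<Sum>j<n. pigeonhole_const M n 0 * \<epsilon>)"
      using \<sigma>(2)[OF that] K_pos by (intro mult_left_mono sum_mono) auto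
    finally show ?thesis by (simp add: matching_const_def mult.assoc)
  qed
  then show ?thesis using \<sigma>(1) by blast
qed

end

section \<open>Approximate differentiability of Lipschitz maps\<close>

text \<open>A single small \<open>t\<close> decides. Distinct base points are at least
  \<open>\<eta>\<close> apart, so an optimal matching at that \<open>t\<close> must pair equal base
  points; these cancel, and division by \<open>t\<close> compares the directions.\<close>

lemma tuple_directions_close:
  fixes ys us ys' us' :: "nat \<Rightarrow> 'y::real_normed_vector"
  assumes d: "\<delta> > 0" and c: "0 \<le> c"
    and close: "\<And>t. 0 < t \<Longrightarrow> t < \<delta> \<Longrightarrow>
      qdist dist (tup Q (\<lambda>i. ys i + t *\<^sub>R us i)) (tup Q (\<lambda>i. ys' i + t *\<^sub>R us' i)) \<le> c * t"
  shows "\<exists>\<sigma>. \<sigma> permutes {..<Q} \<and> (\<forall>i<Q. ys i = ys' (\<sigma> i) \<and> norm (us i - us' (\<sigma> i)) \<le> c)"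
proof -
  \<comment> \<open>The base points of a matched pair are at distance at most \<open>t * W\<close>,
    so \<open>t * W < \<eta>\<close> excludes distinct ones.\<close>
  define W where "W = (\<Sum>i<Q. norm (us i)) + (\<Sum>i<Q. norm (us' i)) + c + 1"
  have W: "W > 0" unfolding W_def using c by (intro add_nonneg_pos add_nonneg_nonneg sum_nonneg) auto
  define P where "P = {(i, j) \<in> {..<Q} \<times> {..<Q}. ys i \<noteq> ys' j}"
  define \<eta> where "\<eta> = Min (insert 1 ((\<lambda>(i, j). dist (ys i) (ys' j)) ` P))"
  have fP: "finite P" unfolding P_def by (rule finite_subset[of _ "{..<Q} \<times> {..<Q}"]) auto
  have \<eta>: "\<eta> > 0" unfolding \<eta>_def using fP by (subst Min_gr_iff) (auto simp: P_def)
  have \<eta>_le: "\<eta> \<le> dist (ys i) (ys' j)" if "i < Q" "j < Q" "ys i \<noteq> ys' j" for i j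
    unfolding \<eta>_def using fP that by (intro Min_le) (auto simp: P_def intro!: image_eqI[of _ _ "(i, j)"])
  define t where "t = min (\<delta> / 2) (\<eta> / (2 * W))"
  have t: "t > 0" "t < \<delta>" using d \<eta> W by (auto simp: t_def)
  have "t * W \<le> \<eta> / (2 * W) * W" using W by (intro mult_right_mono) (auto simp: t_def)
  also have "\<dots> < \<eta>" using W \<eta> by simp
  finally have tW: "t * W < \<eta>" .
  obtain \<sigma> where \<sigma>: "\<sigma> permutes {..<Q}"
    "qdist dist (tup Q (\<lambda>i. ys i + t *\<^sub>R us i)) (tup Q (\<lambda>i. ys' i + t *\<^sub>R us' i))
     = L2_set (\<lambda>i. dist (ys i + t *\<^sub>R us i) (ys' (\<sigma> i) + t *\<^sub>R us' (\<sigma> i))) {..<Q}"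
    by (rule qdist_tup_perm)
  have "ys i = ys' (\<sigma> i) \<and> norm (us i - us' (\<sigma> i)) \<le> c" if i: "i < Q" for i
  proof -
    let ?j = "\<sigma> i"
    have j: "?j < Q" using permutes_in_image[OF \<sigma>(1), of i] i by simp
    have "dist (ys i + t *\<^sub>R us i) (ys' ?j + t *\<^sub>R us' ?j)
       \<le> L2_set (\<lambda>i. dist (ys i + t *\<^sub>R us i) (ys' (\<sigma> i) + t *\<^sub>R us' (\<sigma> i))) {..<Q}"
      using i by (intro member_le_L2_set) auto
    then have 1: "dist (ys i + t *\<^sub>R us i) (ys' ?j + t *\<^sub>R us' ?j) \<le> c * t"
      using close[OF t] \<sigma>(2) by simp
    have "ys i = ys' ?j"
    proof (rule ccontr)
      assume "ys i \<noteq> ys' ?j"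
      then have far: "\<eta> \<le> dist (ys i) (ys' ?j)" using i j by (intro \<eta>_le)
      have eq: "ys i - ys' ?j = ((ys i + t *\<^sub>R us i) - (ys' ?j + t *\<^sub>R us' ?j)) - t *\<^sub>R us i + t *\<^sub>R us' ?j" by simp
      note far
      also have "dist (ys i) (ys' ?j) \<le> norm ((ys i + t *\<^sub>R us i) - (ys' ?j + t *\<^sub>R us' ?j)) + norm (t *\<^sub>R us i) + norm (t *\<^sub>R us' ?j)"
        unfolding dist_norm eq
        using norm_triangle_ineq[of "((ys i + t *\<^sub>R us i) - (ys' ?j + t *\<^sub>R us' ?j)) - t *\<^sub>R us i" "t *\<^sub>R us' ?j"]
          norm_triangle_ineq4[of "(ys i + t *\<^sub>R us i) - (ys' ?j + t *\<^sub>R us' ?j)" "t *\<^sub>R us i"] by linarith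
      also have "\<dots> \<le> c * t + t * (\<Sum>i<Q. norm (us i)) + t * (\<Sum>i<Q. norm (us' i))"
      proof (intro add_mono)
        show "norm ((ys i + t *\<^sub>R us i) - (ys' ?j + t *\<^sub>R us' ?j)) \<le> c * t" using 1 by (simp add: dist_norm)
        have "norm (us i) \<le> (\<Sum>i<Q. norm (us i))" using i by (intro member_le_sum) auto
        then show "norm (t *\<^sub>R us i) \<le> t * (\<Sum>i<Q. norm (us i))" using t by (simp add: mult_left_mono)
        have "norm (us' ?j) \<le> (\<Sum>i<Q. norm (us' i))" using j by (intro member_le_sum) auto
        then show "norm (t *\<^sub>R us' ?j) \<le> t * (\<Sum>i<Q. norm (us' i))" using t by (simp add: mult_left_mono)
      qed
      also have "\<dots> \<le> t * W" using t by (simp add: W_def algebra_simps)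
      finally show False using tW by simp
    qed
    then have "dist (ys i + t *\<^sub>R us i) (ys' ?j + t *\<^sub>R us' ?j) = t * norm (us i - us' ?j)"
      using t by (simp add: dist_norm flip: scaleR_right_diff_distrib)
    then have "norm (us i - us' ?j) \<le> c" using 1 t by (simp add: mult.commute)
    then show ?thesis using \<open>ys i = ys' ?j\<close> by simp
  qed
  then show ?thesis using \<sigma>(1) by blast
qed

lemma qdist_affine_le:
  "qdist dist (qeval (tup Q (\<lambda>i. aff a (ys i) (Ls i))) x) (qeval (tup Q (\<lambda>i. aff a (ys i) (Ls i))) x')
    \<le> (\<Sum>i<Q. norm (Ls i)) * norm (x - x')"
proof -
  have "qdist dist (qeval (tup Q (\<lambda>i. aff a (ys i) (Ls i))) x) (qeval (tup Q (\<lambda>i. aff a (ys i) (Ls i))) x')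
     \<le> L2_set (\<lambda>i. dist (ys i + blinfun_apply (Ls i) (x - a)) (ys i + blinfun_apply (Ls i) (x' - a))) {..<Q}"
    unfolding qeval_aff by (rule qdist_tup_le)
  also have "\<dots> \<le> (\<Sum>i<Q. dist (ys i + blinfun_apply (Ls i) (x - a)) (ys i + blinfun_apply (Ls i) (x' - a)))"
    by (rule L2_set_le_sum) auto
  also have "\<dots> \<le> (\<Sum>i<Q. norm (Ls i) * norm (x - x'))"
  proof (rule sum_mono)
    fix i
    have "dist (ys i + blinfun_apply (Ls i) (x - a)) (ys i + blinfun_apply (Ls i) (x' - a)) = norm (blinfun_apply (Ls i) (x - x'))"
      by (simp add: dist_norm blinfun.diff_right)
    then show "dist (ys i + blinfun_apply (Ls i) (x - a)) (ys i + blinfun_apply (Ls i) (x' - a)) \<le> norm (Ls i) * norm (x - x')"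
      by (simp add: norm_blinfun)
  qed
  finally show ?thesis by (simp add: sum_distrib_right)
qed

context fd_basis
begin

text \<open>Depends on \<open>Q\<close> and the basis only; the measurability of the derivative
  relies on this uniformity.\<close>

definition close_const :: "nat \<Rightarrow> real" where
  "close_const Q = matching_const (card {\<sigma>. \<sigma> permutes {..<Q}})"

lemma close_const_nonneg: "0 \<le> close_const Q"
  by (simp add: close_const_def matching_const_nonneg)

text \<open>\<open>tuple_directions_close\<close> gives a permutation for each direction;
  \<open>matching_index\<close> finds one for all directions at the price of the factor
  \<open>close_const Q\<close>.\<close>

lemma affine_tuples_close:
  fixes Ls Ls' :: "nat \<Rightarrow> 'x \<Rightarrow>\<^sub>L 'y::real_normed_vector"
  assumes e: "0 \<le> \<epsilon>" and d: "0 < \<delta>"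
    and close: "\<And>h. norm h < \<delta> \<Longrightarrow> qdist dist (tup Q (\<lambda>i. ys i + blinfun_apply (Ls i) h))
        (tup Q (\<lambda>i. ys' i + blinfun_apply (Ls' i) h)) \<le> \<epsilon> * norm h"
  shows "\<exists>\<sigma>. \<sigma> permutes {..<Q} \<and> (\<forall>i<Q. ys i = ys' (\<sigma> i) \<and> norm (Ls i - Ls' (\<sigma> i)) \<le> close_const Q * \<epsilon>)"
proof -
  \<comment> \<open>Only permutations that respect the base points compete, so the one selected
    respects them too.\<close>
  define S where "S = {\<sigma>. \<sigma> permutes {..<Q} \<and> (\<forall>i<Q. ys i = ys' (\<sigma> i))}"
  have fp: "finite {\<sigma>. \<sigma> permutes {..<Q}}" by (rule finite_permutations) simp
  have sub: "S \<subseteq> {\<sigma>. \<sigma> permutes {..<Q}}" by (auto simp: S_def)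
  have "\<exists>\<sigma>\<in>S. \<forall>i<Q. norm (Ls i - Ls' (\<sigma> i)) \<le> close_const Q * \<epsilon>"
    unfolding close_const_def
  proof (rule matching_index)
    show "finite S" using sub fp by (rule finite_subset)
    show "card S \<le> card {\<sigma>. \<sigma> permutes {..<Q}}" using fp sub by (rule card_mono)
    show "0 \<le> \<epsilon>" by (rule e)
    fix h
    have "\<exists>\<sigma>. \<sigma> permutes {..<Q} \<and> (\<forall>i<Q. ys i = ys' (\<sigma> i) \<and> norm (blinfun_apply (Ls i) h - blinfun_apply (Ls' (\<sigma> i)) h) \<le> \<epsilon> * norm h)"
    proof (rule tuple_directions_close[of "\<delta> / (norm h + 1)"])
      show "0 < \<delta> / (norm h + 1)" using d by (simp add: add_nonneg_pos)
      show "0 \<le> \<epsilon> * norm h" using e by simp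
      fix t :: real assume t: "0 < t" "t < \<delta> / (norm h + 1)"
      have "t * norm h \<le> t * (norm h + 1)" using t by simp
      also have "\<dots> < \<delta>" using t(2) by (simp add: pos_less_divide_eq add_nonneg_pos)
      finally have "norm (t *\<^sub>R h) < \<delta>" using t by simp
      from close[OF this] show "qdist dist (tup Q (\<lambda>i. ys i + t *\<^sub>R blinfun_apply (Ls i) h))
         (tup Q (\<lambda>i. ys' i + t *\<^sub>R blinfun_apply (Ls' i) h)) \<le> \<epsilon> * norm h * t"
        using t by (simp add: blinfun.scaleR_right mult_ac)
    qed
    then show "\<exists>\<sigma>\<in>S. \<forall>i<Q. norm (blinfun_apply (Ls i - Ls' (\<sigma> i)) h) \<le> \<epsilon> * norm h"
      unfolding S_def by (auto simp: blinfun.diff_left)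
  qed
  then show ?thesis unfolding S_def by blast
qed

text \<open>Two expansions of \<open>f\<close> differ by at most
  \<open>2 * \<epsilon> * norm h\<close>, so some permutation matches them up to \<open>e\<close>;
  since there are finitely many permutations, one of them works for every \<open>e\<close>.\<close>

lemma qdiff_unique:
  fixes f :: "'x \<Rightarrow> 'y::real_normed_vector multiset"
  assumes A: "qdiff Q f a As" and B: "qdiff Q f a Bs" and f: "\<And>x. f x \<in> qtuples Q"
  shows "As = Bs"
proof -
  obtain ys Ls where As: "As = tup Q (\<lambda>i. aff a (ys i) (Ls i))" using A by (rule qdiff_aff_tup)
  obtain zs Ms where Bs: "Bs = tup Q (\<lambda>i. aff a (zs i) (Ms i))" using B by (rule qdiff_aff_tup)
  define C where "C = close_const Q"
  have C: "C \<ge> 0" by (simp add: C_def close_const_nonneg)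
  have "\<exists>\<sigma>\<in>{\<sigma>. \<sigma> permutes {..<Q}}. \<forall>e>0. \<forall>i<Q. ys i = zs (\<sigma> i) \<and> norm (Ls i - Ms (\<sigma> i)) \<le> e"
  proof (rule finite_uniform_choice)
    show "finite {\<sigma>. \<sigma> permutes {..<Q}}" by (rule finite_permutations) simp
    fix e :: real assume e: "e > 0"
    define \<epsilon> where "\<epsilon> = e / (2 * (C + 1))"
    have \<epsilon>: "\<epsilon> > 0" using e C by (simp add: \<epsilon>_def)
    obtain d1 where d1: "d1 > 0" "\<And>x. norm (x - a) < d1 \<Longrightarrow> qdist dist (f x) (qeval As x) \<le> \<epsilon> * norm (x - a)"
      using A[unfolded qdiff_def, THEN conjunct2, THEN conjunct2, THEN spec, THEN mp, OF \<epsilon>] by blast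
    obtain d2 where d2: "d2 > 0" "\<And>x. norm (x - a) < d2 \<Longrightarrow> qdist dist (f x) (qeval Bs x) \<le> \<epsilon> * norm (x - a)"
      using B[unfolded qdiff_def, THEN conjunct2, THEN conjunct2, THEN spec, THEN mp, OF \<epsilon>] by blast
    have "\<exists>\<sigma>. \<sigma> permutes {..<Q} \<and> (\<forall>i<Q. ys i = zs (\<sigma> i) \<and> norm (Ls i - Ms (\<sigma> i)) \<le> C * (2 * \<epsilon>))"
      unfolding C_def
    proof (rule affine_tuples_close[of _ "min d1 d2"])
      show "0 \<le> 2 * \<epsilon>" "0 < min d1 d2" using \<epsilon> d1 d2 by auto
      fix h :: 'x assume h: "norm h < min d1 d2"
      have "qdist dist (qeval As (a + h)) (qeval Bs (a + h)) \<le> qdist dist (qeval As (a + h)) (f (a + h)) + qdist dist (f (a + h)) (qeval Bs (a + h))"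
        by (rule qdist_dist_triangle[of _ Q]) (auto simp: As Bs f qeval_aff)
      also have "\<dots> \<le> \<epsilon> * norm h + \<epsilon> * norm h"
        using d1(2)[of "a + h"] d2(2)[of "a + h"] h by (simp add: qdist_dist_commute)
      finally show "qdist dist (tup Q (\<lambda>i. ys i + blinfun_apply (Ls i) h)) (tup Q (\<lambda>i. zs i + blinfun_apply (Ms i) h)) \<le> 2 * \<epsilon> * norm h"
        unfolding As Bs qeval_aff by simp
    qed
    then obtain \<sigma> where \<sigma>: "\<sigma> permutes {..<Q}"
      "\<And>i. i < Q \<Longrightarrow> ys i = zs (\<sigma> i) \<and> norm (Ls i - Ms (\<sigma> i)) \<le> C * (2 * \<epsilon>)" by blast
    have "C * (2 * \<epsilon>) \<le> e" using C e by (simp add: \<epsilon>_def field_simps)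
    then have "\<forall>i<Q. ys i = zs (\<sigma> i) \<and> norm (Ls i - Ms (\<sigma> i)) \<le> e"
      using \<sigma>(2) order_trans by blast
    then show "\<exists>\<sigma>\<in>{\<sigma>. \<sigma> permutes {..<Q}}. \<forall>i<Q. ys i = zs (\<sigma> i) \<and> norm (Ls i - Ms (\<sigma> i)) \<le> e"
      using \<sigma>(1) by blast
  next
    fix \<sigma> and e e' :: real
    assume "\<forall>i<Q. ys i = zs (\<sigma> i) \<and> norm (Ls i - Ms (\<sigma> i)) \<le> e" "e \<le> e'"
    then show "\<forall>i<Q. ys i = zs (\<sigma> i) \<and> norm (Ls i - Ms (\<sigma> i)) \<le> e'" by fastforce
  qed
  then obtain \<sigma> where "\<sigma> \<in> {\<sigma>. \<sigma> permutes {..<Q}}"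
    and s: "\<forall>e>0. \<forall>i<Q. ys i = zs (\<sigma> i) \<and> norm (Ls i - Ms (\<sigma> i)) \<le> e" by (rule bexE)
  then have \<sigma>: "\<sigma> permutes {..<Q}" by simp
  note s = s[THEN spec, THEN mp, THEN spec, THEN mp]
  have "ys i = zs (\<sigma> i) \<and> Ls i = Ms (\<sigma> i)" if "i < Q" for i
  proof -
    have "norm (Ls i - Ms (\<sigma> i)) \<le> 0"
    proof (rule field_le_epsilon)
      fix e :: real assume "e > 0"
      then show "norm (Ls i - Ms (\<sigma> i)) \<le> 0 + e" using s[of e i] that by simp
    qed
    then show ?thesis using s[of 1 i] that by simp
  qed
  then show ?thesis unfolding As Bs tup_eq_iff using \<sigma> by auto
qed

end

section \<open>Approximate and classical differentiability of Lipschitz tuple-valued maps\<close>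

locale lipschitz_Q_map = fd_haar b n K \<mu>
  for b :: "nat \<Rightarrow> 'x::real_normed_vector" and n K \<mu> +
  fixes f :: "'x \<Rightarrow> 'y::real_normed_vector multiset" and Q :: nat and C0 :: real
  assumes fQ [simp]: "f x \<in> qtuples Q" and C0: "0 \<le> C0"
    and lipf: "qdist dist (f x) (f x') \<le> C0 * norm (x - x')"
begin

lemma density_zero_if_qdiff:
  assumes "qdiff Q f a As" "\<epsilon> > 0"
  shows "density_zero \<mu> {x. qdist dist (f x) (qeval As x) > \<epsilon> * norm (x - a)} a"
proof -
  let ?E = "{x. qdist dist (f x) (qeval As x) > \<epsilon> * norm (x - a)}"
  obtain d where d: "d > 0" "\<And>x. norm (x - a) < d \<Longrightarrow> qdist dist (f x) (qeval As x) \<le> \<epsilon> * norm (x - a)"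
    using assms unfolding qdiff_def by meson
  have "\<forall>\<^sub>F r in at_right 0. measure \<mu> (?E \<inter> cball a r) / measure \<mu> (cball a r) = 0"
    unfolding eventually_at_right_field
  proof (intro exI[of _ d] conjI allI impI d(1))
    fix r assume "0 < r" "r < d"
    have "x \<notin> ?E" if "x \<in> cball a r" for x
      using d(2)[of x] that \<open>r < d\<close> by (simp add: dist_norm norm_minus_commute not_less)
    then have "?E \<inter> cball a r = {}" by blast
    then show "measure \<mu> (?E \<inter> cball a r) / measure \<mu> (cball a r) = 0" by simp
  qed
  then show ?thesis unfolding density_zero_def by (rule tendsto_eventually)
qed

lemma measure_cball_pos: "r > 0 \<Longrightarrow> measure \<mu> (cball a r) > 0"
  using emeasure_cball_pos[of r a] emeasure_cball_finite[of a r]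
  by (simp add: measure_def enn2real_positive_iff less_top)

lemma measure_cball_scale:
  assumes "e > 0"
  obtains N :: nat where "N > 0" "\<And>r a c. r > 0 \<Longrightarrow> measure \<mu> (cball a r) \<le> real N * measure \<mu> (cball c (e * r))"
proof -
  obtain N :: nat where N: "N > 0" "\<And>r a c. r > 0 \<Longrightarrow> emeasure \<mu> (cball a r) \<le> of_nat N * emeasure \<mu> (cball c (e * r))"
    using emeasure_cball_scale[OF assms] by blast
  have "measure \<mu> (cball a r) \<le> real N * measure \<mu> (cball c (e * r))" if "r > 0" for r a c
  proof -
    have "ennreal (measure \<mu> (cball a r)) \<le> of_nat N * ennreal (measure \<mu> (cball c (e * r)))"
      using N(2)[OF that, of a c] emeasure_cball_finite[of a r] emeasure_cball_finite[of c "e * r"]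
      by (simp add: emeasure_eq_ennreal_measure)
    also have "\<dots> = ennreal (real N * measure \<mu> (cball c (e * r)))"
      by (simp add: ennreal_mult ennreal_of_nat_eq_real_of_nat)
    finally show ?thesis by (subst (asm) ennreal_le_iff) auto
  qed
  then show thesis using that N(1) by blast
qed

text \<open>The gap \<open>?g\<close> between \<open>f\<close> and the affine tuple is Lipschitz. By
  doubling, a ball of radius \<open>e * r\<close> around a point near \<open>a\<close> is too large
  to lie in the exceptional set; it contains a point of small gap, and the Lipschitz bound carries
  this to its centre.\<close>

lemma qdiff_if_approx:
  assumes A: "is_approx_affine Q \<mu> f a As"
  shows "qdiff Q f a As"
proof -
  have As: "size As = Q" "\<forall>A\<in>#As. affine_map A"
    and dens: "\<And>\<epsilon>. \<epsilon> > 0 \<Longrightarrow> density_zero \<mu> {x. qdist dist (f x) (qeval As x) > \<epsilon> * norm (x - a)} a"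
    using A by (auto simp: is_approx_affine_def)
  obtain ys Ls where AL: "As = tup Q (\<lambda>i. aff a (ys i) (Ls i))" using ex_aff_tup[OF As] by blast
  define D where "D = C0 + (\<Sum>i<Q. norm (Ls i))"
  have D: "D \<ge> 0" using C0 by (simp add: D_def sum_nonneg)
  let ?g = "\<lambda>x. qdist dist (f x) (qeval As x)"
  have qA: "qeval As x \<in> qtuples Q" for x by (simp add: AL qeval_aff)
  have g1: "?g x \<le> ?g x' + D * norm (x - x')" for x x'
  proof -
    have "?g x \<le> qdist dist (f x) (f x') + qdist dist (f x') (qeval As x)"
      by (rule qdist_dist_triangle[of _ Q]) (auto simp: qA)
    also have "qdist dist (f x') (qeval As x) \<le> ?g x' + qdist dist (qeval As x') (qeval As x)"
      by (rule qdist_dist_triangle[of _ Q]) (auto simp: qA)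
    also have "qdist dist (qeval As x') (qeval As x) \<le> (\<Sum>i<Q. norm (Ls i)) * norm (x - x')"
      using qdist_affine_le[of Q a ys Ls x' x] unfolding AL by (simp only: norm_minus_commute[of x x'])
    finally show ?thesis using lipf[of x x'] by (simp add: D_def algebra_simps)
  qed
  have "dist (?g x) (?g x') \<le> D * dist x x'" for x x'
    using g1[of x x'] g1[of x' x] by (simp add: dist_norm norm_minus_commute abs_le_iff)
  then have contg: "continuous_on UNIV ?g" by (rule lipschitz_imp_continuous_UNIV)
  \<comment> \<open>In \<open>D + 2\<close>, the term \<open>D\<close> stems from moving by
    \<open>e * r\<close> and the 2 from the gap at a point whose distance from \<open>a\<close> is
    at most \<open>2 * r\<close>.\<close>
  have main: "\<exists>\<rho>>0. \<forall>r. 0 < r \<and> r < \<rho> \<longrightarrow> (\<forall>x\<in>cball a r. ?g x \<le> (D + 2) * e * r)" if e: "0 < e" "e \<le> 1" for e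
  proof -
    let ?E = "{x. ?g x > e * norm (x - a)}"
    have "open ?E" by (intro open_Collect_less continuous_intros contg)
    then have E: "?E \<in> sets \<mu>" by simp
    \<comment> \<open>The ratio is \<open>e / 2\<close> because radius \<open>e * r\<close> is
      compared with the ball of radius \<open>2 * r\<close> about \<open>a\<close>, which contains
      \<open>cball x (e * r)\<close>.\<close>
    obtain N :: nat where N: "N > 0" "\<And>r a c. r > 0 \<Longrightarrow> measure \<mu> (cball a r) \<le> real N * measure \<mu> (cball c (e / 2 * r))"
      using measure_cball_scale[of "e / 2"] e by auto
    have "\<forall>\<^sub>F s in at_right 0. measure \<mu> (?E \<inter> cball a s) / measure \<mu> (cball a s) < 1 / real N"
      using dens[OF e(1)] N(1) unfolding density_zero_def by (intro order_tendstoD(2)) auto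
    then obtain \<rho> where \<rho>: "\<rho> > 0" "\<And>s. 0 < s \<Longrightarrow> s < \<rho> \<Longrightarrow> measure \<mu> (?E \<inter> cball a s) / measure \<mu> (cball a s) < 1 / real N"
      unfolding eventually_at_right_field by blast
    have "?g x \<le> (D + 2) * e * r" if r: "0 < r" "r < \<rho> / 2" and x: "x \<in> cball a r" for r x
    proof -
      have "\<not> cball x (e * r) \<subseteq> ?E"
      proof
        assume sub: "cball x (e * r) \<subseteq> ?E"
        have er: "e * r \<le> r" using e r by simp
        have "cball x (e * r) \<subseteq> cball a (2 * r)"
        proof
          fix z assume "z \<in> cball x (e * r)"
          then have "dist a z \<le> r + e * r" using x dist_triangle[of a z x] by simp
          then show "z \<in> cball a (2 * r)" using er by simp
        qed
        then have "measure \<mu> (cball x (e * r)) \<le> measure \<mu> (?E \<inter> cball a (2 * r))"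
          using sub E emeasure_mono[of "?E \<inter> cball a (2 * r)" "cball a (2 * r)" \<mu>] emeasure_cball_finite[of a "2 * r"]
          by (intro measure_mono_fmeasurable) (auto simp: fmeasurable_def le_less_trans)
        also have "\<dots> < measure \<mu> (cball a (2 * r)) / real N"
          using \<rho>(2)[of "2 * r"] r measure_cball_pos[of "2 * r" a] N(1) by (simp add: field_simps)
        also have "\<dots> \<le> measure \<mu> (cball x (e * r))"
          using N(2)[of "2 * r" a x] r N(1) by (simp add: field_simps)
        finally show False by simp
      qed
      then obtain x' where x': "dist x x' \<le> e * r" "?g x' \<le> e * norm (x' - a)"
        by (auto simp: subset_iff not_less)
      have "norm (x' - a) \<le> norm (x - a) + norm (x' - x)"
        using norm_triangle_ineq[of "x - a" "x' - x"] by simp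
      also have "\<dots> \<le> r + e * r" using x x'(1) by (simp add: dist_norm norm_minus_commute)
      also have "\<dots> \<le> 2 * r" using e r by simp
      finally have 1: "e * norm (x' - a) \<le> e * (2 * r)" using e by simp
      have 2: "D * norm (x - x') \<le> D * (e * r)" using x'(1) D by (simp add: dist_norm mult_left_mono)
      show ?thesis using g1[of x x'] x'(2) 1 2 by (simp add: algebra_simps)
    qed
    then show ?thesis using \<rho>(1) by (intro exI[of _ "\<rho> / 2"]) auto
  qed
  \<comment> \<open>At \<open>x = a\<close> the claim demands gap 0, which follows from the estimate
    on balls of shrinking radius.\<close>
  have ga: "?g a \<le> 0"
  proof (rule field_le_epsilon)
    fix e :: real assume e: "e > 0"
    obtain \<rho> where \<rho>: "\<rho> > 0" "\<And>r x. 0 < r \<Longrightarrow> r < \<rho> \<Longrightarrow> x \<in> cball a r \<Longrightarrow> ?g x \<le> (D + 2) * 1 * r"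
      using main[of 1] by auto
    define r where "r = min (\<rho> / 2) (e / (D + 2))"
    have r: "0 < r" "r < \<rho>" using \<rho>(1) e D by (auto simp: r_def)
    have "(D + 2) * r \<le> (D + 2) * (e / (D + 2))" using D by (intro mult_left_mono) (auto simp: r_def)
    then show "?g a \<le> 0 + e" using \<rho>(2)[OF r, of a] r D by simp
  qed
  show ?thesis
    unfolding qdiff_def
  proof (intro conjI As allI impI)
    fix \<epsilon> :: real assume \<epsilon>: "\<epsilon> > 0"
    define e where "e = min 1 (\<epsilon> / (D + 2))"
    have e: "0 < e" "e \<le> 1" using \<epsilon> D by (auto simp: e_def)
    have De: "(D + 2) * e \<le> \<epsilon>"
    proof -
      have "(D + 2) * e \<le> (D + 2) * (\<epsilon> / (D + 2))" using D by (intro mult_left_mono) (auto simp: e_def)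
      then show ?thesis using D by simp
    qed
    obtain \<rho> where \<rho>: "\<rho> > 0" "\<And>r x. 0 < r \<Longrightarrow> r < \<rho> \<Longrightarrow> x \<in> cball a r \<Longrightarrow> ?g x \<le> (D + 2) * e * r"
      using main[OF e] by blast
    have "?g x \<le> \<epsilon> * norm (x - a)" if x: "norm (x - a) < \<rho>" for x
    proof (cases "x = a")
      case True
      then show ?thesis using ga by simp
    next
      case False
      then have "?g x \<le> (D + 2) * e * norm (x - a)"
        using x by (intro \<rho>(2)) (auto simp: dist_norm norm_minus_commute)
      also have "\<dots> \<le> \<epsilon> * norm (x - a)" using De by (intro mult_right_mono) auto
      finally show ?thesis .
    qed
    then show "\<exists>\<delta>>0. \<forall>x. norm (x - a) < \<delta> \<longrightarrow> ?g x \<le> \<epsilon> * norm (x - a)" using \<rho>(1) by blast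
  qed
qed

lemma is_approx_affine_iff_qdiff: "is_approx_affine Q \<mu> f a As \<longleftrightarrow> qdiff Q f a As"
  using qdiff_if_approx[of a As] density_zero_if_qdiff[of a As]
  by (auto simp: is_approx_affine_def qdiff_def)

lemma approx_differentiable_iff: "approx_differentiable Q \<mu> f a \<longleftrightarrow> (\<exists>As. qdiff Q f a As)"
  by (simp add: approx_differentiable_def is_approx_affine_iff_qdiff)

lemma approx_affine_eq: "qdiff Q f a As \<Longrightarrow> approx_affine Q \<mu> f a = As"
  unfolding approx_affine_def is_approx_affine_iff_qdiff
  by (rule the_equality) (auto intro: qdiff_unique)

lemma qdiff_value:
  assumes "qdiff Q f a As"
  shows "qeval As a = f a"
proof -
  obtain d where d: "d > 0" "\<And>x. norm (x - a) < d \<Longrightarrow> qdist dist (f x) (qeval As x) \<le> 1 * norm (x - a)"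
    using assms unfolding qdiff_def by (meson zero_less_one)
  have "qdist dist (f a) (qeval As a) \<le> 0" using d(2)[of a] d(1) by simp
  then have "qdist dist (f a) (qeval As a) = 0" by (simp add: order_antisym)
  moreover have "qeval As a \<in> qtuples Q" using assms by (simp add: qtuples_def qdiff_def)
  ultimately show ?thesis using qdist_dist_zero_iff[of "f a" Q "qeval As a"] by simp
qed

lemma approx_deriv_eq:
  assumes "qdiff Q f a (tup Q (\<lambda>i. aff a (ys i) (Ls i)))"
  shows "approx_deriv Q \<mu> f a = tup Q Ls"
  unfolding approx_deriv_def approx_affine_eq[OF assms] by (simp add: image_mset_tup linear_part_aff)

text \<open>Along a ray the affine tuple is compared with the constant tuple \<open>f a\<close>. A
  permutation may mix branches of equal value, but the direction they are compared with is 0 for all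
  of them.\<close>

lemma qdiff_norm_le:
  assumes A: "qdiff Q f a (tup Q (\<lambda>i. aff a (ys i) (Ls i)))" and i: "i < Q"
  shows "norm (Ls i) \<le> C0"
proof (rule norm_blinfun_bound[OF C0])
  fix h
  show "norm (blinfun_apply (Ls i) h) \<le> C0 * norm h"
  proof (rule field_le_epsilon)
    fix e :: real assume e: "e > 0"
    let ?As = "tup Q (\<lambda>i. aff a (ys i) (Ls i))"
    have fa: "f a = tup Q ys" using qdiff_value[OF A] by (simp add: qeval_tup)
    define \<epsilon> where "\<epsilon> = e / (norm h + 1)"
    have h1: "norm h + 1 > 0" by (simp add: add_nonneg_pos)
    have \<epsilon>: "\<epsilon> > 0" using e h1 by (simp add: \<epsilon>_def)
    obtain d where d: "d > 0" "\<And>x. norm (x - a) < d \<Longrightarrow> qdist dist (f x) (qeval ?As x) \<le> \<epsilon> * norm (x - a)"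
      using A \<epsilon> unfolding qdiff_def by meson
    have "\<exists>\<sigma>. \<sigma> permutes {..<Q} \<and> (\<forall>i<Q. ys i = ys (\<sigma> i) \<and> norm (blinfun_apply (Ls i) h - 0) \<le> (C0 + \<epsilon>) * norm h)"
    proof (rule tuple_directions_close[of "d / (norm h + 1)"])
      show "0 < d / (norm h + 1)" using d h1 by simp
      show "0 \<le> (C0 + \<epsilon>) * norm h" using C0 \<epsilon> by simp
      fix t :: real assume t: "0 < t" "t < d / (norm h + 1)"
      have "t * norm h \<le> t * (norm h + 1)" using t by simp
      also have "\<dots> < d" using t(2) h1 by (simp add: pos_less_divide_eq)
      finally have n: "norm ((a + t *\<^sub>R h) - a) < d" using t by simp
      have q: "qeval ?As (a + t *\<^sub>R h) = tup Q (\<lambda>i. ys i + t *\<^sub>R blinfun_apply (Ls i) h)"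
        by (simp add: qeval_aff blinfun.scaleR_right)
      have "qdist dist (qeval ?As (a + t *\<^sub>R h)) (f a)
        \<le> qdist dist (qeval ?As (a + t *\<^sub>R h)) (f (a + t *\<^sub>R h)) + qdist dist (f (a + t *\<^sub>R h)) (f a)"
        by (rule qdist_dist_triangle[of _ Q]) (auto simp: q)
      also have "\<dots> \<le> \<epsilon> * (t * norm h) + C0 * (t * norm h)"
        using d(2)[OF n] lipf[of "a + t *\<^sub>R h" a] t by (simp add: qdist_dist_commute)
      finally show "qdist dist (tup Q (\<lambda>i. ys i + t *\<^sub>R blinfun_apply (Ls i) h)) (tup Q (\<lambda>i. ys i + t *\<^sub>R 0)) \<le> (C0 + \<epsilon>) * norm h * t"
        unfolding q fa by (simp add: algebra_simps)
    qed
    then have "norm (blinfun_apply (Ls i) h) \<le> (C0 + \<epsilon>) * norm h" using i by auto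
    also have "\<dots> = C0 * norm h + \<epsilon> * norm h" by (simp add: algebra_simps)
    also have "\<epsilon> * norm h \<le> e" using e h1 by (simp add: \<epsilon>_def field_simps)
    finally show "norm (blinfun_apply (Ls i) h) \<le> C0 * norm h + e" by simp
  qed
qed

lemma qdiff_tendsto:
  assumes "qdiff Q f a As"
  shows "((\<lambda>x. qdist dist (f x) (qeval As x) / norm (x - a)) \<longlongrightarrow> 0) (at a)"
  unfolding Lim_at
proof (intro allI impI)
  fix e :: real assume e: "e > 0"
  then have "e / 2 > 0" by simp
  then obtain d where d: "d > 0" "\<And>x. norm (x - a) < d \<Longrightarrow> qdist dist (f x) (qeval As x) \<le> e / 2 * norm (x - a)"
    using assms unfolding qdiff_def by meson
  have "dist (qdist dist (f x) (qeval As x) / norm (x - a)) 0 < e" if "0 < dist x a" "dist x a < d" for x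
  proof -
    have "qdist dist (f x) (qeval As x) / norm (x - a) \<le> e / 2"
      using d(2)[of x] that by (simp add: dist_norm pos_divide_le_eq)
    then have "qdist dist (f x) (qeval As x) / norm (x - a) < e" using e by linarith
    then show ?thesis by (simp add: dist_real_def)
  qed
  then show "\<exists>d>0. \<forall>x. 0 < dist x a \<and> dist x a < d \<longrightarrow> dist (qdist dist (f x) (qeval As x) / norm (x - a)) 0 < e"
    using d(1) by blast
qed

end

lemma qLip_bound:
  assumes "qlipschitz f"
  shows "0 \<le> qLip f" "qdist dist (f x) (f x') \<le> qLip f * dist x x'"
proof -
  let ?S = "{C. 0 \<le> C \<and> (\<forall>x x'. qdist dist (f x) (f x') \<le> C * dist x x')}"
  have ne: "?S \<noteq> {}" using assms by (auto simp: qlipschitz_def)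
  show 0: "0 \<le> qLip f" unfolding qLip_def using ne by (intro cInf_greatest) auto
  show "qdist dist (f x) (f x') \<le> qLip f * dist x x'"
  proof (cases "x = x'")
    case True
    obtain C where "C \<in> ?S" using ne by blast
    then have "qdist dist (f x) (f x') \<le> C * dist x x'" by blast
    then show ?thesis using True by simp
  next
    case False
    then have pos: "dist x x' > 0" by simp
    have "qdist dist (f x) (f x') / dist x x' \<le> qLip f"
      unfolding qLip_def using ne pos by (intro cInf_greatest) (auto simp: pos_divide_le_eq)
    then show ?thesis using pos by (simp add: pos_divide_le_eq)
  qed
qed

section \<open>Almost everywhere differentiability\<close>

definition bump :: "'y::real_normed_vector \<Rightarrow> real \<Rightarrow> 'y \<Rightarrow> 'y" where
  "bump q r y = max 0 (min 1 (2 - norm (y - q) / r)) *\<^sub>R (y - q)"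

lemma bump_near: "r > 0 \<Longrightarrow> norm (y - q) \<le> r \<Longrightarrow> bump q r y = y - q"
  by (simp add: bump_def min_def max_def pos_le_divide_eq pos_divide_le_eq le_diff_eq)

lemma bump_far: "r > 0 \<Longrightarrow> norm (y - q) \<ge> 2 * r \<Longrightarrow> bump q r y = 0"
proof -
  assume r: "r > 0" and "norm (y - q) \<ge> 2 * r"
  then have "2 \<le> norm (y - q) / r" by (simp add: pos_le_divide_eq)
  then show ?thesis by (simp add: bump_def max_def min_def)
qed

lemma clamp_lipschitz: "\<bar>max 0 (min 1 u) - max 0 (min 1 v)\<bar> \<le> \<bar>u - v\<bar>" for u v :: real
  by (auto simp: max_def min_def)

text \<open>The constant is \<open>1 + 2\<close>: the cut-off factor is at most 1, and its slope
  \<open>1 / r\<close> meets a vector of length at most \<open>2 * r\<close>. If both points lie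
  farther out, both values are 0.\<close>

lemma bump_lipschitz:
  assumes r: "r > 0"
  shows "norm (bump q r y - bump q r z) \<le> 3 * norm (y - z)"
proof -
  have half: "norm (bump q r y - bump q r z) \<le> 3 * norm (y - z)" if z: "norm (z - q) \<le> 2 * r" for y z
  proof -
    let ?c = "\<lambda>y. max 0 (min 1 (2 - norm (y - q) / r))"
    have "bump q r y - bump q r z = ?c y *\<^sub>R (y - z) + (?c y - ?c z) *\<^sub>R (z - q)"
      by (simp add: bump_def algebra_simps)
    then have "norm (bump q r y - bump q r z) \<le> norm (?c y *\<^sub>R (y - z)) + norm ((?c y - ?c z) *\<^sub>R (z - q))"
      by (metis norm_triangle_ineq)
    moreover have "norm (?c y *\<^sub>R (y - z)) \<le> 1 * norm (y - z)"
      unfolding norm_scaleR by (intro mult_right_mono) auto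
    moreover have "norm ((?c y - ?c z) *\<^sub>R (z - q)) \<le> norm (y - z) / r * (2 * r)"
    proof -
      have "\<bar>?c y - ?c z\<bar> \<le> \<bar>(2 - norm (y - q) / r) - (2 - norm (z - q) / r)\<bar>" by (rule clamp_lipschitz)
      also have "\<dots> = \<bar>norm (z - q) - norm (y - q)\<bar> / r"
      proof -
        have "(2 - norm (y - q) / r) - (2 - norm (z - q) / r) = (norm (z - q) - norm (y - q)) / r"
          by (simp add: diff_divide_distrib)
        then show ?thesis using r by (simp only: abs_divide)
      qed
      also have "\<dots> \<le> norm (y - z) / r"
        using r norm_triangle_ineq3[of "z - q" "y - q"] by (intro divide_right_mono) (auto simp: norm_minus_commute)
      finally show ?thesis unfolding norm_scaleR using z r by (intro mult_mono) auto
    qed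
    moreover have "norm (y - z) / r * (2 * r) = 2 * norm (y - z)" using r by simp
    ultimately show ?thesis by linarith
  qed
  show ?thesis
  proof (cases "norm (z - q) \<le> 2 * r")
    case False
    show ?thesis
    proof (cases "norm (y - q) \<le> 2 * r")
      case True
      then show ?thesis using half[of y z] by (simp add: norm_minus_commute)
    next
      case False
      then show ?thesis using \<open>\<not> norm (z - q) \<le> 2 * r\<close> r by (simp add: bump_far)
    qed
  qed (rule half)
qed

locale lipschitz_Q_banach = lipschitz_Q_map b n K \<mu> f Q C0
  for b :: "nat \<Rightarrow> 'x::real_normed_vector" and n K \<mu>
    and f :: "'x \<Rightarrow> 'y::{banach, second_countable_topology} multiset" and Q C0
begin

lemma size_f [simp]: "size (f x) = Q"
  using fQ[of x] by (simp add: qtuples_def)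

text \<open>Real Lipschitz functions are later multiplied by a nonzero vector of \<open>'y\<close>;
  this disposes of the case that there is none.\<close>

lemma constant_if_trivial:
  assumes "\<And>y::'y. y = 0"
  shows "f x = f x'"
proof -
  obtain u where u: "f x = tup Q u" by (rule ex_tup[of "f x" Q]) simp
  obtain w where w: "f x' = tup Q w" by (rule ex_tup[of "f x'" Q]) simp
  have "u = w" using assms by (metis ext)
  then show ?thesis using u w by simp
qed

definition Fsum :: "'y \<Rightarrow> real \<Rightarrow> 'x \<Rightarrow> 'y" where
  "Fsum q r x = (\<Sum>y\<in>#f x. bump q r y)"

text \<open>The enumerations are matched optimally, so that the sums can be compared entry by
  entry.\<close>

lemma Fsum_lipschitz:
  assumes r: "r > 0"
  shows "norm (Fsum q r x - Fsum q r x') \<le> (3 * real Q * C0) * norm (x - x')"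
proof -
  obtain u where u: "f x = tup Q u" by (rule ex_tup[of "f x" Q]) simp
  obtain w where w: "f x' = tup Q w" "qdist dist (tup Q u) (f x') = L2_set (\<lambda>i. dist (u i) (w i)) {..<Q}"
    by (rule qdist_tup_aligned[of "f x'" Q]) simp
  have d: "dist (u i) (w i) \<le> C0 * norm (x - x')" if "i < Q" for i
  proof -
    have "dist (u i) (w i) \<le> L2_set (\<lambda>i. dist (u i) (w i)) {..<Q}"
      using that by (intro member_le_L2_set) auto
    then show ?thesis using lipf[of x x'] w(2) u by simp
  qed
  have "norm (Fsum q r x - Fsum q r x') = norm (\<Sum>i<Q. bump q r (u i) - bump q r (w i))"
    by (simp add: Fsum_def u w(1) sum_mset_tup sum_subtractf)
  also have "\<dots> \<le> (\<Sum>i<Q. norm (bump q r (u i) - bump q r (w i)))" by (rule norm_sum)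
  also have "\<dots> \<le> (\<Sum>i<Q. 3 * (C0 * norm (x - x')))"
  proof (rule sum_mono)
    fix i assume "i \<in> {..<Q}"
    then show "norm (bump q r (u i) - bump q r (w i)) \<le> 3 * (C0 * norm (x - x'))"
      using bump_lipschitz[OF r, of q "u i" "w i"] d[of i] by (simp add: dist_norm)
  qed
  finally show ?thesis by (simp add: algebra_simps)
qed

end

locale lipschitz_Q_RNP = lipschitz_Q_banach b n K \<mu> f Q C0
  for b :: "nat \<Rightarrow> 'x::real_normed_vector" and n K \<mu>
    and f :: "'x \<Rightarrow> 'y::{banach, second_countable_topology} multiset" and Q C0 +
  assumes rnp: "radon_nikodym_property TYPE('y)"
begin

lemma AE_Fsum_differentiable:
  assumes r: "r > 0"
  shows "AE a in \<mu>. \<exists>T::'x \<Rightarrow>\<^sub>L 'y. (Fsum q r has_derivative blinfun_apply T) (at a)"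
proof -
  interpret F: lipschitz_RNP_map b n K \<mu> "Fsum q r" "3 * real Q * C0"
    by unfold_locales (use C0 Fsum_lipschitz[OF r] rnp in auto)
  show ?thesis by (rule F.rademacher)
qed

section \<open>Differentiability via sets with a fixed number of distinct values\<close>

definition level :: "nat \<Rightarrow> 'x set" where
  "level m = {x. card (set_mset (f x)) = m}"

text \<open>
  Differentiability of the distance function, scaled by a fixed vector, replaces density points:
  the distance to a set vanishes to first order at almost every point of the set.
\<close>

lemma AE_infdist_small:
  "AE a in \<mu>. a \<in> S \<longrightarrow> (\<forall>\<epsilon>>0. \<exists>\<delta>>0. \<forall>x. norm (x - a) < \<delta> \<longrightarrow> infdist x S \<le> \<epsilon> * norm (x - a))"
  if y0: "y0 \<noteq> (0::'y)" for S
proof -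
  interpret F: lipschitz_RNP_map b n K \<mu> "\<lambda>x. infdist x S *\<^sub>R y0" "norm y0"
  proof (unfold_locales)
    fix x x'
    have "norm (infdist x S *\<^sub>R y0 - infdist x' S *\<^sub>R y0) = \<bar>infdist x S - infdist x' S\<bar> * norm y0"
      by (simp flip: scaleR_left_diff_distrib)
    also have "\<dots> \<le> norm (x - x') * norm y0"
      using infdist_triangle_abs[of x S x'] by (intro mult_right_mono) (auto simp: dist_norm)
    finally show "norm (infdist x S *\<^sub>R y0 - infdist x' S *\<^sub>R y0) \<le> norm y0 * norm (x - x')"
      by (simp add: mult.commute)
  qed (auto simp: rnp)
  from F.rademacher show ?thesis
  proof eventually_elim
    case (elim a)
    show ?case
    proof (intro impI allI)
      fix \<epsilon> :: real assume a: "a \<in> S" and \<epsilon>: "\<epsilon> > 0"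
      from elim obtain T :: "'x \<Rightarrow>\<^sub>L 'y" where T: "((\<lambda>x. infdist x S *\<^sub>R y0) has_derivative blinfun_apply T) (at a)" by blast
      define e where "e = \<epsilon> * norm y0 / 2"
      have e: "e > 0" using \<epsilon> y0 by (simp add: e_def)
      obtain d where d: "d > 0" "\<And>x. norm (x - a) < d \<Longrightarrow>
        norm (infdist x S *\<^sub>R y0 - infdist a S *\<^sub>R y0 - blinfun_apply T (x - a)) \<le> e * norm (x - a)"
        using T[unfolded has_derivative_at_alt, THEN conjunct2, THEN spec, THEN mp, OF e] by blast
      have "infdist x S \<le> \<epsilon> * norm (x - a)" if x: "norm (x - a) < d" for x
      proof -
        \<comment> \<open>The reflected point: adding the two expansions cancels \<open>T\<close>,
          and as both distances are nonnegative, each of them is small.\<close>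
        let ?x' = "a - (x - a)"
        have 1: "norm (infdist x S *\<^sub>R y0 - blinfun_apply T (x - a)) \<le> e * norm (x - a)"
          using d(2)[OF x] a by simp
        have 2: "norm (infdist ?x' S *\<^sub>R y0 + blinfun_apply T (x - a)) \<le> e * norm (x - a)"
          using d(2)[of ?x'] x a by (simp add: norm_minus_commute blinfun.diff_right algebra_simps)
        have "(infdist x S + infdist ?x' S) *\<^sub>R y0 = (infdist x S *\<^sub>R y0 - blinfun_apply T (x - a)) + (infdist ?x' S *\<^sub>R y0 + blinfun_apply T (x - a))"
          by (simp add: scaleR_left_distrib)
        then have "norm ((infdist x S + infdist ?x' S) *\<^sub>R y0) \<le> e * norm (x - a) + e * norm (x - a)"
          using norm_triangle_mono[OF 1 2] by (simp only:)
        then have "(infdist x S + infdist ?x' S) * norm y0 \<le> (\<epsilon> * norm (x - a)) * norm y0"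
          using infdist_nonneg[of x S] infdist_nonneg[of ?x' S] by (simp add: e_def mult_ac)
        then have "infdist x S + infdist ?x' S \<le> \<epsilon> * norm (x - a)" using y0 by simp
        then show ?thesis using infdist_nonneg[of ?x' S] by linarith
      qed
      then show "\<exists>\<delta>>0. \<forall>x. norm (x - a) < \<delta> \<longrightarrow> infdist x S \<le> \<epsilon> * norm (x - a)"
        using d(1) by blast
    qed
  qed
qed

lemma AE_infdist_level:
  "AE a in \<mu>. a \<in> level m \<longrightarrow> (\<forall>\<epsilon>>0. \<exists>\<delta>>0. \<forall>x. norm (x - a) < \<delta> \<longrightarrow> infdist x (level m) \<le> \<epsilon> * norm (x - a))"
proof (cases "\<exists>y::'y. y \<noteq> 0")
  case True
  then show ?thesis using AE_infdist_small by blast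
next
  case False
  have "infdist x (level m) = 0" if "a \<in> level m" for a x
  proof -
    have "x \<in> level m" using that constant_if_trivial[of x a] False unfolding level_def by simp
    then show ?thesis by simp
  qed
  then show ?thesis by (intro AE_I2) (auto intro!: exI[of _ 1])
qed

text \<open>Entries grouped at \<open>ys i\<close> stay within \<open>r\<close> of \<open>q\<close>,
  where the cut-off factor is 1; all others are at least \<open>7 * r\<close> away, where it is 0.
  So the sum sees one group only.\<close>

lemma Fsum_near_center:
  assumes r: "r > 0" and i: "i < Q" and fx: "f x = tup Q xs"
    and sep: "\<And>j l. j < Q \<Longrightarrow> l < Q \<Longrightarrow> ys j \<noteq> ys l \<Longrightarrow> 8 * r \<le> dist (ys j) (ys l)"
    and near: "\<And>j. j < Q \<Longrightarrow> dist (ys j) (xs j) < r / 2"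
    and q: "dist (ys i) q < r / 2"
  shows "Fsum q r x = (\<Sum>j\<in>{j. j < Q \<and> ys j = ys i}. xs j - q)"
proof -
  have "Fsum q r x = (\<Sum>j<Q. bump q r (xs j))" by (simp add: Fsum_def fx sum_mset_tup)
  also have "\<dots> = (\<Sum>j<Q. if ys j = ys i then xs j - q else 0)"
  proof (rule sum.cong)
    fix j assume "j \<in> {..<Q}"
    then have j: "j < Q" by simp
    show "bump q r (xs j) = (if ys j = ys i then xs j - q else 0)"
    proof (cases "ys j = ys i")
      case True
      have "dist (xs j) q \<le> dist (xs j) (ys i) + dist (ys i) q" by (rule dist_triangle)
      then have "norm (xs j - q) \<le> r"
        using near[OF j] q True by (simp add: dist_commute flip: dist_norm)
      then show ?thesis using True r by (simp add: bump_near)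
    next
      case False
      have "dist (ys j) (ys i) \<le> dist (ys j) (xs j) + dist (xs j) q + dist (ys i) q"
        using dist_triangle[of "ys j" "ys i" "xs j"] dist_triangle[of "xs j" "ys i" q]
        by (simp add: dist_commute)
      then have "norm (xs j - q) \<ge> 2 * r"
        using near[OF j] q sep[OF j i False] r unfolding dist_norm[symmetric] by linarith
      then show ?thesis using False r by (simp add: bump_far)
    qed
  qed simp
  also have "\<dots> = (\<Sum>j\<in>{j \<in> {..<Q}. ys j = ys i}. xs j - q)"
    by (rule sum.inter_filter[symmetric]) simp
  finally show ?thesis by simp
qed

text \<open>Sending each value among \<open>xs\<close> to the nearby value among \<open>ys\<close>
  is well defined and onto. Equal cardinalities make it injective, so entries that coincide in
  \<open>ys\<close> coincide in \<open>xs\<close>.\<close>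

lemma level_groups_constant:
  assumes fx: "f x = tup Q xs" and card: "card (xs ` {..<Q}) = card (ys ` {..<Q})"
    and sep: "\<And>j l. j < Q \<Longrightarrow> l < Q \<Longrightarrow> ys j \<noteq> ys l \<Longrightarrow> 8 * r \<le> dist (ys j) (ys l)" and r: "r > 0"
    and near: "\<And>j. j < Q \<Longrightarrow> dist (ys j) (xs j) < r / 2"
    and ij: "i < Q" "j < Q" "ys i = ys j"
  shows "xs i = xs j"
proof -
  have wd: "ys j = ys l" if "j < Q" "l < Q" "xs j = xs l" for j l
  proof (rule ccontr)
    assume "ys j \<noteq> ys l"
    then have "8 * r \<le> dist (ys j) (ys l)" using sep that by blast
    also have "\<dots> \<le> dist (ys j) (xs j) + dist (xs l) (ys l)"
      using dist_triangle[of "ys j" "ys l" "xs j"] that(3) by simp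
    also have "\<dots> < r" using near[OF that(1)] near[OF that(2)] by (simp add: dist_commute)
    finally show False using r by simp
  qed
  define g where "g z = ys (SOME j. j < Q \<and> xs j = z)" for z
  have g: "g (xs j) = ys j" if "j < Q" for j
  proof -
    have "(SOME l. l < Q \<and> xs l = xs j) < Q \<and> xs (SOME l. l < Q \<and> xs l = xs j) = xs j"
      using that by (intro someI[of "\<lambda>l. l < Q \<and> xs l = xs j" j]) auto
    then show ?thesis unfolding g_def using wd that by blast
  qed
  then have "g ` (xs ` {..<Q}) = ys ` {..<Q}" by (force simp: image_iff)
  then have "inj_on g (xs ` {..<Q})" using card by (intro eq_card_imp_inj_on) auto
  then show ?thesis using g ij by (auto dest!: inj_onD[of g _ "xs i" "xs j"])
qed

text \<open>A radius of the form \<open>1 / Suc k\<close> is wanted because the almost everywhere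
  statement ranges over countably many radii.\<close>

lemma separation_radius:
  fixes ys :: "nat \<Rightarrow> 'y"
  obtains k :: nat where "\<And>j l. j < Q \<Longrightarrow> l < Q \<Longrightarrow> ys j \<noteq> ys l \<Longrightarrow> 8 * (1 / real (Suc k)) \<le> dist (ys j) (ys l)"
proof -
  define P where "P = {(i, j) \<in> {..<Q} \<times> {..<Q}. ys i \<noteq> ys j}"
  define s where "s = Min (insert 1 ((\<lambda>(i, j). dist (ys i) (ys j)) ` P))"
  have fP: "finite P" unfolding P_def by (rule finite_subset[of _ "{..<Q} \<times> {..<Q}"]) auto
  have "s > 0" unfolding s_def using fP by (subst Min_gr_iff) (auto simp: P_def)
  then obtain k :: nat where k: "1 / real (Suc k) < s / 8" using nat_approx_posE[of "s / 8"] by auto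
  have "8 * (1 / real (Suc k)) \<le> dist (ys i) (ys j)" if "i < Q" "j < Q" "ys i \<noteq> ys j" for i j
  proof -
    have "s \<le> dist (ys i) (ys j)"
      unfolding s_def using fP that by (intro Min_le) (auto simp: P_def intro!: image_eqI[of _ _ "(i, j)"])
    then show ?thesis using k by linarith
  qed
  then show thesis by (rule that)
qed

text \<open>On the level set of \<open>a\<close> a cut-off sum is an affine function of one moving
  value with the multiplicity as factor, so that value inherits a first-order expansion. Other
  points are replaced by points of the level set at distance of order
  \<open>o(norm (x - a))\<close>.\<close>

lemma qdiff_at_good_point:
  assumes D: "\<And>X. open X \<Longrightarrow> X \<noteq> {} \<Longrightarrow> \<exists>d\<in>D. d \<in> X"
    and diff: "\<forall>q\<in>D. \<forall>k. \<exists>T::'x \<Rightarrow>\<^sub>L 'y. (Fsum q (1 / real (Suc k)) has_derivative blinfun_apply T) (at a)"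
    and lev: "\<forall>\<epsilon>>0. \<exists>\<delta>>0. \<forall>x. norm (x - a) < \<delta> \<longrightarrow> infdist x (level (card (set_mset (f a)))) \<le> \<epsilon> * norm (x - a)"
  shows "\<exists>As. qdiff Q f a As \<and> (\<forall>A\<in>#As. \<forall>B\<in>#As. A a = B a \<longrightarrow> linear_part A = linear_part B)"
proof -
  obtain ys where fa: "f a = tup Q ys" by (rule ex_tup[of "f a" Q]) simp
  obtain k where sep0: "\<And>j l. j < Q \<Longrightarrow> l < Q \<Longrightarrow> ys j \<noteq> ys l \<Longrightarrow> 8 * (1 / real (Suc k)) \<le> dist (ys j) (ys l)"
    using separation_radius[of ys] by blast
  define r where "r = 1 / real (Suc k)"
  have r: "r > 0" by (simp add: r_def)
  note sep = sep0[folded r_def]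
  have "\<exists>q\<in>D. dist y q < r / 2" for y
    using D[of "ball y (r / 2)"] r by auto
  then obtain q where q: "\<And>y. q y \<in> D" "\<And>y. dist y (q y) < r / 2" by metis
  have "\<exists>T::'x \<Rightarrow>\<^sub>L 'y. (Fsum (q y) r has_derivative blinfun_apply T) (at a)" for y
    using diff q(1)[of y] unfolding r_def by blast
  then obtain T :: "'y \<Rightarrow> 'x \<Rightarrow>\<^sub>L 'y" where T: "\<And>y. (Fsum (q y) r has_derivative blinfun_apply (T y)) (at a)"
    by metis
  define J where "J i = {j. j < Q \<and> ys j = ys i}" for i
  define c where "c i = real (card (J i))" for i
  have fJ: "finite (J i)" for i by (simp add: J_def)
  have c: "c i \<ge> 1" if "i < Q" for i
  proof -
    have "i \<in> J i" using that by (simp add: J_def)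
    then have "card (J i) \<noteq> 0" using fJ by (metis card_0_eq empty_iff)
    then show ?thesis by (simp add: c_def)
  qed
  \<comment> \<open>Depends on \<open>i\<close> only through \<open>ys i\<close>; this is the
    unambiguity.\<close>
  define Ls where "Ls i = (1 / c i) *\<^sub>R T (ys i)" for i
  define As where "As = tup Q (\<lambda>i. aff a (ys i) (Ls i))"
  have Ls_eq: "ys i = ys j \<Longrightarrow> Ls i = Ls j" for i j
    by (simp add: Ls_def c_def J_def)
  define lv where "lv = level (card (set_mset (f a)))"
  have a_lv: "a \<in> lv" by (simp add: lv_def level_def)
  have loc: "\<exists>xs. f x = tup Q xs \<and> (\<forall>j<Q. dist (ys j) (xs j) < r / 2)" if "C0 * norm (x - a) < r / 2" for x
  proof -
    obtain xs where xs: "f x = tup Q xs" "qdist dist (tup Q ys) (f x) = L2_set (\<lambda>i. dist (ys i) (xs i)) {..<Q}"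
      by (rule qdist_tup_aligned[of "f x" Q]) simp
    have "dist (ys j) (xs j) < r / 2" if j: "j < Q" for j
    proof -
      have "dist (ys j) (xs j) \<le> L2_set (\<lambda>i. dist (ys i) (xs i)) {..<Q}"
        using j by (intro member_le_L2_set) auto
      also have "\<dots> \<le> C0 * norm (x - a)" using lipf[of a x] xs(2) fa by (simp add: norm_minus_commute)
      finally show ?thesis using \<open>C0 * norm (x - a) < r / 2\<close> by simp
    qed
    then show ?thesis using xs(1) by blast
  qed
  have Fa: "Fsum (q (ys i)) r a = c i *\<^sub>R (ys i - q (ys i))" if "i < Q" for i
  proof -
    have "Fsum (q (ys i)) r a = (\<Sum>j\<in>J i. ys j - q (ys i))"
      unfolding J_def using r q(2) that fa sep by (intro Fsum_near_center) auto
    also have "\<dots> = (\<Sum>j\<in>J i. ys i - q (ys i))" by (rule sum.cong) (auto simp: J_def)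
    finally show ?thesis by (simp add: c_def sum_constant_scaleR)
  qed
  have on_level: "\<exists>\<delta>>0. \<forall>x\<in>lv. norm (x - a) < \<delta> \<longrightarrow> qdist dist (f x) (qeval As x) \<le> real Q * (e * norm (x - a))"
    if e: "e > 0" for e
  proof -
    have "\<forall>i. \<exists>d>0. \<forall>x. norm (x - a) < d \<longrightarrow>
        norm (Fsum (q (ys i)) r x - Fsum (q (ys i)) r a - blinfun_apply (T (ys i)) (x - a)) \<le> e * norm (x - a)"
      using T e unfolding has_derivative_at_alt by blast
    then obtain d where d: "\<And>i. d i > 0" "\<And>i x. norm (x - a) < d i \<Longrightarrow>
        norm (Fsum (q (ys i)) r x - Fsum (q (ys i)) r a - blinfun_apply (T (ys i)) (x - a)) \<le> e * norm (x - a)"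
      by metis
    define \<delta> where "\<delta> = Min (insert (r / (2 * (C0 + 1))) (d ` {..<Q}))"
    have \<delta>: "\<delta> > 0" using r C0 d(1) by (simp add: \<delta>_def)
    have \<delta>_le: "\<delta> \<le> r / (2 * (C0 + 1))" "\<And>i. i < Q \<Longrightarrow> \<delta> \<le> d i" by (auto simp: \<delta>_def)
    have "qdist dist (f x) (qeval As x) \<le> real Q * (e * norm (x - a))" if x: "x \<in> lv" "norm (x - a) < \<delta>" for x
    proof -
      have "C0 * norm (x - a) \<le> (C0 + 1) * norm (x - a)" by (intro mult_right_mono) auto
      also have "\<dots> < (C0 + 1) * (r / (2 * (C0 + 1)))" using x(2) \<delta>_le(1) C0 by (intro mult_strict_left_mono) auto
      also have "\<dots> = r / 2" using C0 by (simp add: field_simps)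
      finally obtain xs where xs: "f x = tup Q xs" "\<And>j. j < Q \<Longrightarrow> dist (ys j) (xs j) < r / 2" using loc by blast
      have card: "card (xs ` {..<Q}) = card (ys ` {..<Q})" using x(1) by (simp add: lv_def level_def xs(1) fa)
      have "norm (xs i - (ys i + blinfun_apply (Ls i) (x - a))) \<le> e * norm (x - a)" if i: "i < Q" for i
      proof -
        have "Fsum (q (ys i)) r x = (\<Sum>j\<in>J i. xs j - q (ys i))"
          unfolding J_def using r q(2) i xs sep by (intro Fsum_near_center) auto
        also have "\<dots> = (\<Sum>j\<in>J i. xs i - q (ys i))"
        proof (rule sum.cong)
          fix j assume "j \<in> J i"
          then have "j < Q" "ys i = ys j" by (auto simp: J_def)
          then have "xs i = xs j" using level_groups_constant[OF xs(1) card sep r xs(2)] i by blast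
          then show "xs j - q (ys i) = xs i - q (ys i)" by simp
        qed simp
        finally have Fx: "Fsum (q (ys i)) r x = c i *\<^sub>R (xs i - q (ys i))" by (simp add: c_def sum_constant_scaleR)
        have ci: "c i > 0" using c[OF i] by simp
        have "c i *\<^sub>R (xs i - (ys i + blinfun_apply (Ls i) (x - a)))
           = Fsum (q (ys i)) r x - Fsum (q (ys i)) r a - blinfun_apply (T (ys i)) (x - a)"
          unfolding Fx Fa[OF i] using ci
          by (simp add: Ls_def blinfun.scaleR_left scaleR_right_diff_distrib scaleR_right_distrib)
        then have "norm (c i *\<^sub>R (xs i - (ys i + blinfun_apply (Ls i) (x - a)))) \<le> e * norm (x - a)"
          using d(2)[of x i] x(2) \<delta>_le(2)[OF i] by simp
        then have "c i * norm (xs i - (ys i + blinfun_apply (Ls i) (x - a))) \<le> e * norm (x - a)" using ci by simp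
        moreover have "1 * norm (xs i - (ys i + blinfun_apply (Ls i) (x - a))) \<le> c i * norm (xs i - (ys i + blinfun_apply (Ls i) (x - a)))"
          using c[OF i] by (intro mult_right_mono) auto
        ultimately show ?thesis by linarith
      qed
      then have "L2_set (\<lambda>i. dist (xs i) (ys i + blinfun_apply (Ls i) (x - a))) {..<Q} \<le> real Q * (e * norm (x - a))"
        by (intro L2_set_le_card_times) (auto simp: dist_norm)
      then show ?thesis
        unfolding As_def qeval_aff xs(1) by (rule order_trans[OF qdist_tup_le])
    qed
    then show ?thesis using \<delta> by blast
  qed
  define S where "S = (\<Sum>i<Q. norm (Ls i))"
  have S: "S \<ge> 0" by (simp add: S_def sum_nonneg)
  have "qdiff Q f a As"
    unfolding qdiff_def
  proof (intro conjI allI impI)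
    show "size As = Q" by (simp add: As_def)
    show "\<forall>A\<in>#As. affine_map A" by (auto simp: As_def affine_map_aff)
    fix \<epsilon> :: real assume \<epsilon>: "\<epsilon> > 0"
    \<comment> \<open>\<open>C0\<close> and \<open>S\<close> pay for moving \<open>f\<close> and the
      affine tuple from \<open>x\<close> to \<open>x'\<close>, and \<open>2 * real Q\<close> for the
      error at \<open>x'\<close>, whose distance from \<open>a\<close> is at most twice that of
      \<open>x\<close>.\<close>
    define M where "M = C0 + S + 2 * real Q + 1"
    have M: "M > 0" using C0 S by (simp add: M_def)
    define e where "e = min 1 (\<epsilon> / M)"
    have e: "e > 0" "e \<le> 1" using \<epsilon> M by (auto simp: e_def)
    have Me: "M * e \<le> \<epsilon>"
    proof -
      have "M * e \<le> M * (\<epsilon> / M)" using M by (intro mult_left_mono) (auto simp: e_def)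
      then show ?thesis using M by simp
    qed
    obtain d1 where d1: "d1 > 0" "\<And>x. x \<in> lv \<Longrightarrow> norm (x - a) < d1 \<Longrightarrow> qdist dist (f x) (qeval As x) \<le> real Q * (e * norm (x - a))"
      using on_level[OF e(1)] by blast
    \<comment> \<open>\<open>infdist\<close> is an infimum; the half leaves room for an actual point
      of the level set at distance below \<open>e * norm (x - a)\<close>.\<close>
    have "e / 2 > 0" using e by simp
    then obtain d2 where d2: "d2 > 0" "\<And>x. norm (x - a) < d2 \<Longrightarrow> infdist x lv \<le> e / 2 * norm (x - a)"
      using lev unfolding lv_def by blast
    have "qdist dist (f x) (qeval As x) \<le> \<epsilon> * norm (x - a)" if x: "norm (x - a) < min (d1 / 2) d2" for x
    proof (cases "x = a")
      case True
      have "qdist dist (f a) (qeval As a) \<le> real Q * (e * norm (a - a))" using d1 a_lv by (intro d1(2)) auto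
      then show ?thesis using True by simp
    next
      case False
      then have pos: "norm (x - a) > 0" by simp
      have ne: "lv \<noteq> {}" using a_lv by blast
      have "infdist x lv < e * norm (x - a)"
        using d2(2)[of x] x mult_pos_pos[OF e(1) pos] by simp
      then have "Inf (dist x ` lv) < e * norm (x - a)" unfolding infdist_notempty[OF ne] .
      then have "\<exists>t\<in>dist x ` lv. t < e * norm (x - a)" using a_lv by (intro cInf_lessD) auto
      then obtain x' where x': "x' \<in> lv" "dist x' x < e * norm (x - a)"
        by (auto simp: dist_commute)
      have n: "norm (x' - x) \<le> e * norm (x - a)" using x'(2) by (simp add: dist_norm)
      have "e * norm (x - a) \<le> 1 * norm (x - a)" using e by (intro mult_right_mono) auto
      then have n2: "norm (x' - a) \<le> 2 * norm (x - a)"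
        using norm_triangle_ineq[of "x' - x" "x - a"] n by simp
      have A: "qeval As z \<in> qtuples Q" for z by (simp add: As_def qeval_aff)
      have "qdist dist (f x) (qeval As x) \<le> qdist dist (f x) (f x') + qdist dist (f x') (qeval As x)"
        by (rule qdist_dist_triangle[of _ Q]) (auto simp: A)
      also have "qdist dist (f x') (qeval As x) \<le> qdist dist (f x') (qeval As x') + qdist dist (qeval As x') (qeval As x)"
        by (rule qdist_dist_triangle[of _ Q]) (auto simp: A)
      also have "qdist dist (f x) (f x') \<le> C0 * (e * norm (x - a))"
        using lipf[of x x'] mult_left_mono[OF n C0] by (simp add: norm_minus_commute)
      also have "qdist dist (qeval As x') (qeval As x) \<le> S * (e * norm (x - a))"
        unfolding As_def using qdist_affine_le[of Q a ys Ls x' x] mult_left_mono[OF n S] by (simp add: S_def)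
      also have "qdist dist (f x') (qeval As x') \<le> real Q * (e * (2 * norm (x - a)))"
      proof -
        have "qdist dist (f x') (qeval As x') \<le> real Q * (e * norm (x' - a))"
          using n2 x by (intro d1(2) x') auto
        also have "\<dots> \<le> real Q * (e * (2 * norm (x - a)))" using n2 e by (intro mult_left_mono) auto
        finally show ?thesis .
      qed
      finally have "qdist dist (f x) (qeval As x) \<le> (C0 + S + 2 * real Q) * e * norm (x - a)"
        by (simp add: algebra_simps)
      also have "\<dots> \<le> M * e * norm (x - a)" using e by (intro mult_right_mono) (auto simp: M_def)
      also have "\<dots> \<le> \<epsilon> * norm (x - a)" using Me by (intro mult_right_mono) auto
      finally show ?thesis .
    qed
    then show "\<exists>\<delta>>0. \<forall>x. norm (x - a) < \<delta> \<longrightarrow> qdist dist (f x) (qeval As x) \<le> \<epsilon> * norm (x - a)"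
      using d1(1) d2(1) by (intro exI[of _ "min (d1 / 2) d2"]) auto
  qed
  moreover have "\<forall>A\<in>#As. \<forall>B\<in>#As. A a = B a \<longrightarrow> linear_part A = linear_part B"
    by (auto simp: As_def linear_part_aff intro: Ls_eq)
  ultimately show ?thesis by blast
qed

theorem AE_unambiguous:
  "AE a in \<mu>. unambiguously_approx_differentiable Q \<mu> f a \<and> qeval (approx_affine Q \<mu> f a) a = f a"
proof -
  obtain D :: "'y set" where D: "countable D" "\<And>X. open X \<Longrightarrow> X \<noteq> {} \<Longrightarrow> \<exists>d\<in>D. d \<in> X"
    using countable_dense_setE by blast
  have "AE a in \<mu>. \<forall>q\<in>D. \<forall>k. \<exists>T::'x \<Rightarrow>\<^sub>L 'y. (Fsum q (1 / real (Suc k)) has_derivative blinfun_apply T) (at a)"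
    unfolding AE_ball_countable[OF D(1)] AE_all_countable
    by (intro ballI allI AE_Fsum_differentiable) simp
  moreover have "AE a in \<mu>. \<forall>m. a \<in> level m \<longrightarrow> (\<forall>\<epsilon>>0. \<exists>\<delta>>0. \<forall>x. norm (x - a) < \<delta> \<longrightarrow> infdist x (level m) \<le> \<epsilon> * norm (x - a))"
    unfolding AE_all_countable using AE_infdist_level by blast
  ultimately show ?thesis
  proof eventually_elim
    case (elim a)
    have "a \<in> level (card (set_mset (f a)))" by (simp add: level_def)
    then have "\<forall>\<epsilon>>0. \<exists>\<delta>>0. \<forall>x. norm (x - a) < \<delta> \<longrightarrow> infdist x (level (card (set_mset (f a)))) \<le> \<epsilon> * norm (x - a)"
      using elim(2) by blast
    then obtain As where As: "qdiff Q f a As" "\<forall>A\<in>#As. \<forall>B\<in>#As. A a = B a \<longrightarrow> linear_part A = linear_part B"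
      using qdiff_at_good_point[OF D(2) elim(1)] by blast
    show ?case
      unfolding unambiguously_approx_differentiable_def approx_affine_eq[OF As(1)]
      using As qdiff_value approx_differentiable_iff by blast
  qed
qed

end

section \<open>Measurability of the derivative\<close>

lemma is_norm_bounded:
  fixes \<nu> :: "'v::real_normed_vector \<Rightarrow> real"
  assumes \<nu>: "is_norm \<nu>" "continuous_on UNIV \<nu>"
  obtains B where "B \<ge> 0" "\<And>v. \<nu> v \<le> B * norm v"
proof -
  have 0: "\<nu> 0 = 0" and sc: "\<And>c v. \<nu> (c *\<^sub>R v) = \<bar>c\<bar> * \<nu> v" using \<nu>(1) by (auto simp: is_norm_def)
  obtain d where d: "d > 0" "\<And>v. dist v 0 < d \<Longrightarrow> dist (\<nu> v) (\<nu> 0) < 1"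
    using \<nu>(2) unfolding continuous_on_iff by (metis UNIV_I zero_less_one)
  have "\<nu> v \<le> 2 / d * norm v" for v
  proof (cases "v = 0")
    case False
    then have nv: "norm v > 0" by simp
    define t where "t = d / (2 * norm v)"
    have t: "t > 0" using d(1) nv by (simp add: t_def)
    have "norm (t *\<^sub>R v) = d / 2" using d(1) nv by (simp add: t_def)
    then have "\<bar>\<nu> (t *\<^sub>R v)\<bar> < 1" using d(2)[of "t *\<^sub>R v"] d(1) by (simp add: 0 dist_norm)
    then have "t * \<nu> v < 1" using t by (simp add: sc)
    then have "\<nu> v < 1 / t" using t by (simp add: pos_less_divide_eq mult.commute)
    also have "1 / t = 2 / d * norm v" by (simp add: t_def)
    finally show ?thesis by simp
  qed (simp add: 0)
  then show thesis using that[of "2 / d"] d(1) by auto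
qed

lemma Metric_space_is_norm:
  assumes "is_norm \<nu>"
  shows "Metric_space UNIV (\<lambda>v w. \<nu> (v - w))"
proof
  have m: "\<nu> (- v) = \<nu> v" for v
    using assms unfolding is_norm_def by (metis abs_1 abs_minus_cancel mult_1 scaleR_minus1_left)
  fix v w u
  show "0 \<le> \<nu> (v - w)" using assms by (simp add: is_norm_def)
  show "\<nu> (v - w) = \<nu> (w - v)" using m[of "v - w"] by simp
  show "\<nu> (v - w) = 0 \<longleftrightarrow> v = w" using assms by (simp add: is_norm_def)
  have "\<nu> ((v - w) + (w - u)) \<le> \<nu> (v - w) + \<nu> (w - u)" using assms unfolding is_norm_def by blast
  then show "\<nu> (v - u) \<le> \<nu> (v - w) + \<nu> (w - u)" by simp
qed

context fd_basis
begin

text \<open>Operators are approximated by prescribing values from a countable dense set of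
  \<open>'y\<close> on the basis.\<close>

lemma countable_dense_blinfun:
  "\<exists>H :: ('x \<Rightarrow>\<^sub>L 'y::{real_normed_vector, second_countable_topology}) set.
     countable H \<and> (\<forall>L e. e > 0 \<longrightarrow> (\<exists>L'\<in>H. norm (L - L') \<le> e))"
proof -
  obtain D :: "'y set" where D: "countable D" "\<And>X. open X \<Longrightarrow> X \<noteq> {} \<Longrightarrow> \<exists>d\<in>D. d \<in> X"
    using countable_dense_setE by blast
  define H where "H = (\<lambda>qs. lin_of ((!) qs)) ` lists D"
  show ?thesis
  proof (intro exI[of _ H] conjI allI impI)
    show "countable H" unfolding H_def using D(1) by simp
    fix L :: "'x \<Rightarrow>\<^sub>L 'y" and e :: real assume e: "e > 0"
    define e' where "e' = e / K / (real n + 1)"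
    have e': "e' > 0" using e K_pos by (simp add: e'_def)
    have "\<exists>q\<in>D. dist y q < e'" for y using D(2)[of "ball y e'"] e' by auto
    then obtain q where q: "\<And>y. q y \<in> D" "\<And>y. dist y (q y) < e'" by metis
    define qs where "qs = map (\<lambda>i. q (blinfun_apply L (b i))) [0..<n]"
    have "qs \<in> lists D" using q(1) by (auto simp: qs_def)
    moreover have "norm (L - lin_of ((!) qs)) \<le> e"
    proof -
      have "norm (L - lin_of ((!) qs)) \<le> K * (\<Sum>i<n. norm (blinfun_apply (L - lin_of ((!) qs)) (b i)))"
        by (rule norm_blinfun_le_basis)
      also have "\<dots> \<le> K * (\<Sum>i<n. e')"
      proof (intro mult_left_mono sum_mono)
        fix i assume "i \<in> {..<n}"
        then have "blinfun_apply (L - lin_of ((!) qs)) (b i) = blinfun_apply L (b i) - q (blinfun_apply L (b i))"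
          by (simp add: blinfun.diff_left lin_of_basis qs_def)
        then show "norm (blinfun_apply (L - lin_of ((!) qs)) (b i)) \<le> e'"
          using q(2)[of "blinfun_apply L (b i)"] by (simp add: dist_norm)
      qed (use K_pos in auto)
      also have "\<dots> \<le> K * ((real n + 1) * e')" using K_pos e' by (intro mult_left_mono) (auto simp: algebra_simps)
      also have "(real n + 1) * e' = e / K" by (simp add: e'_def)
      also have "K * (e / K) = e" using K_pos by simp
      finally show ?thesis .
    qed
    ultimately show "\<exists>L'\<in>H. norm (L - L') \<le> e" unfolding H_def by blast
  qed
qed

end

context lipschitz_Q_map
begin

text \<open>The base points are quantified inside, since the enumeration of \<open>f x\<close> has
  to fit the enumeration \<open>Ls\<close> of the slopes and may change from point to point.\<close>

definition near_aff :: "(nat \<Rightarrow> 'x \<Rightarrow>\<^sub>L 'y) \<Rightarrow> nat \<Rightarrow> nat \<Rightarrow> 'x set" where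
  "near_aff Ls k m = {x. \<exists>ys. f x = tup Q ys \<and> (\<forall>h. norm h < 1 / real (Suc m) \<longrightarrow>
     qdist dist (f (x + h)) (tup Q (\<lambda>i. ys i + blinfun_apply (Ls i) h)) \<le> 1 / real (Suc k) * norm h)}"

lemma qdist_add_le:
  "qdist dist (tup Q (\<lambda>i. ys i + z i)) (tup Q (\<lambda>i. ws i + z i)) \<le> L2_set (\<lambda>i. dist (ys i) (ws i :: 'y)) {..<Q}"
proof -
  have "qdist dist (tup Q (\<lambda>i. ys i + z i)) (tup Q (\<lambda>i. ws i + z i)) \<le> L2_set (\<lambda>i. dist (ys i + z i) (ws i + z i)) {..<Q}"
    by (rule qdist_tup_le)
  also have "\<dots> = L2_set (\<lambda>i. dist (ys i) (ws i)) {..<Q}"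
    by (intro L2_set_cong) (auto simp: dist_norm)
  finally show ?thesis .
qed

text \<open>Along a convergent sequence the enumerations of \<open>f (X j)\<close> are matched by
  permutations with a fixed one of the limit. One permutation occurs infinitely often, and the
  estimate passes to the limit along those \<open>j\<close>.\<close>

lemma closed_near_aff: "closed (near_aff Ls k m)"
  unfolding closed_sequential_limits
proof (intro allI impI)
  fix X x assume X: "(\<forall>j. X j \<in> near_aff Ls k m) \<and> X \<longlonglongrightarrow> x"
  then have "\<forall>j. \<exists>ys. f (X j) = tup Q ys \<and> (\<forall>h. norm h < 1 / real (Suc m) \<longrightarrow>
     qdist dist (f (X j + h)) (tup Q (\<lambda>i. ys i + blinfun_apply (Ls i) h)) \<le> 1 / real (Suc k) * norm h)"
    unfolding near_aff_def by blast
  then obtain ys where ys: "\<And>j. f (X j) = tup Q (ys j)"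
    "\<And>j h. norm h < 1 / real (Suc m) \<Longrightarrow>
     qdist dist (f (X j + h)) (tup Q (\<lambda>i. ys j i + blinfun_apply (Ls i) h)) \<le> 1 / real (Suc k) * norm h"
    by metis
  have sz: "size (f x) = Q" using fQ[of x] by (simp add: qtuples_def)
  obtain zs where zs: "f x = tup Q zs" using ex_tup[OF sz] by blast
  have "\<exists>\<sigma>. \<sigma> permutes {..<Q} \<and> L2_set (\<lambda>i. dist (ys j i) (zs (\<sigma> i))) {..<Q} \<le> C0 * norm (X j - x)" for j
  proof -
    obtain \<sigma> where "\<sigma> permutes {..<Q}" "qdist dist (tup Q (ys j)) (tup Q zs) = L2_set (\<lambda>i. dist (ys j i) (zs (\<sigma> i))) {..<Q}"
      by (rule qdist_tup_perm)
    then show ?thesis using lipf[of "X j" x] ys(1)[of j] zs by auto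
  qed
  then obtain \<sigma> where \<sigma>: "\<And>j. \<sigma> j permutes {..<Q}"
    "\<And>j. L2_set (\<lambda>i. dist (ys j i) (zs (\<sigma> j i))) {..<Q} \<le> C0 * norm (X j - x)" by metis
  have "finite (range \<sigma>)"
    by (rule finite_subset[of _ "{\<sigma>. \<sigma> permutes {..<Q}}"]) (use \<sigma>(1) finite_permutations[of "{..<Q}"] in auto)
  then obtain j0 where inf: "infinite {j \<in> UNIV. \<sigma> j = \<sigma> j0}"
    using pigeonhole_infinite[of "UNIV :: nat set" \<sigma>] by auto
  define ws where "ws i = zs (\<sigma> j0 i)" for i
  have "f x = tup Q ws" unfolding zs ws_def using tup_permute[OF \<sigma>(1)] by metis
  moreover have "qdist dist (f (x + h)) (tup Q (\<lambda>i. ws i + blinfun_apply (Ls i) h)) \<le> 1 / real (Suc k) * norm h"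
    if h: "norm h < 1 / real (Suc m)" for h
  proof (rule field_le_epsilon)
    fix e :: real assume e: "e > 0"
    define e' where "e' = e / (2 * (C0 + 1))"
    have "e' > 0" using e C0 by (simp add: e'_def)
    then obtain J where J: "\<And>j. j \<ge> J \<Longrightarrow> norm (X j - x) < e'"
      using X LIMSEQ_D by blast
    obtain j where j: "j \<ge> J" "\<sigma> j = \<sigma> j0"
      using inf unfolding infinite_nat_iff_unbounded_le by blast
    have n: "C0 * norm (X j - x) \<le> e / 2"
    proof -
      have "C0 * norm (X j - x) \<le> (C0 + 1) * e'" using J[OF j(1)] C0 by (intro mult_mono) auto
      also have "\<dots> = e / 2" using C0 by (simp add: e'_def field_simps)
      finally show ?thesis .
    qed
    have "qdist dist (f (x + h)) (tup Q (\<lambda>i. ws i + blinfun_apply (Ls i) h))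
      \<le> qdist dist (f (x + h)) (f (X j + h)) + qdist dist (f (X j + h)) (tup Q (\<lambda>i. ws i + blinfun_apply (Ls i) h))"
      by (rule qdist_dist_triangle[of _ Q]) auto
    also have "qdist dist (f (X j + h)) (tup Q (\<lambda>i. ws i + blinfun_apply (Ls i) h))
      \<le> qdist dist (f (X j + h)) (tup Q (\<lambda>i. ys j i + blinfun_apply (Ls i) h))
        + qdist dist (tup Q (\<lambda>i. ys j i + blinfun_apply (Ls i) h)) (tup Q (\<lambda>i. ws i + blinfun_apply (Ls i) h))"
      by (rule qdist_dist_triangle[of _ Q]) auto
    also have "qdist dist (tup Q (\<lambda>i. ys j i + blinfun_apply (Ls i) h)) (tup Q (\<lambda>i. ws i + blinfun_apply (Ls i) h))
      \<le> L2_set (\<lambda>i. dist (ys j i) (ws i)) {..<Q}" by (rule qdist_add_le)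
    also have "\<dots> \<le> e / 2" using \<sigma>(2)[of j] n unfolding ws_def j(2) by simp
    also have "qdist dist (f (x + h)) (f (X j + h)) \<le> e / 2"
      using lipf[of "x + h" "X j + h"] n by (simp add: norm_minus_commute)
    finally show "qdist dist (f (x + h)) (tup Q (\<lambda>i. ws i + blinfun_apply (Ls i) h)) \<le> 1 / real (Suc k) * norm h + e"
      using ys(2)[OF h, of j] by simp
  qed
  ultimately show "x \<in> near_aff Ls k m" unfolding near_aff_def by blast
qed

lemma qdist_slope_le:
  assumes "\<And>i. i < Q \<Longrightarrow> norm (Ls i - Ms i) \<le> e"
  shows "qdist dist (tup Q (\<lambda>i. ys i + blinfun_apply (Ls i) h)) (tup Q (\<lambda>i. ys i + blinfun_apply (Ms i) h :: 'y))
    \<le> real Q * (e * norm h)"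
proof -
  have "dist (ys i + blinfun_apply (Ls i) h) (ys i + blinfun_apply (Ms i) h) \<le> e * norm h" if "i < Q" for i
  proof -
    have "dist (ys i + blinfun_apply (Ls i) h) (ys i + blinfun_apply (Ms i) h) = norm (blinfun_apply (Ls i - Ms i) h)"
      by (simp add: dist_norm blinfun.diff_left)
    also have "\<dots> \<le> norm (Ls i - Ms i) * norm h" by (rule norm_blinfun)
    also have "\<dots> \<le> e * norm h" using assms[OF that] by (intro mult_right_mono) auto
    finally show ?thesis .
  qed
  then have "L2_set (\<lambda>i. dist (ys i + blinfun_apply (Ls i) h) (ys i + blinfun_apply (Ms i) h)) {..<Q} \<le> real Q * (e * norm h)"
    by (intro L2_set_le_card_times) auto
  then show ?thesis by (rule order_trans[OF qdist_tup_le])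
qed

lemma near_aff_if_qdiff:
  assumes A: "qdiff Q f x (tup Q (\<lambda>i. aff x (ys i) (Ls i)))"
    and H: "\<forall>L e. e > 0 \<longrightarrow> (\<exists>L'\<in>H. norm (L - L') \<le> e)" and e: "e > 0"
  shows "\<exists>ls\<in>lists H. (\<exists>m. x \<in> near_aff ((!) ls) k m) \<and> (\<forall>i<Q. norm (Ls i - ls ! i) \<le> e)"
proof -
  define c where "c = 1 / real (Suc k)"
  have c: "c > 0" by (simp add: c_def)
  \<comment> \<open>Rounding the slopes in all \<open>Q\<close> branches may use up half of the
    tolerance \<open>c\<close>; the expansion of \<open>f\<close> uses the other half.\<close>
  define e' where "e' = min e (c / (2 * (real Q + 1)))"
  have e': "e' > 0" using e c by (simp add: e'_def)
  have "\<forall>L. \<exists>L'\<in>H. norm (L - L') \<le> e'" using H e' by blast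
  then obtain p where p: "\<And>L. p L \<in> H" "\<And>L. norm (L - p L) \<le> e'" by metis
  define ls where "ls = map (\<lambda>i. p (Ls i)) [0..<Q]"
  have ls: "ls \<in> lists H" using p(1) by (auto simp: ls_def)
  have close: "norm (Ls i - ls ! i) \<le> e'" if "i < Q" for i using p(2) that by (simp add: ls_def)
  have "c / 2 > 0" using c by simp
  from A[unfolded qdiff_def, THEN conjunct2, THEN conjunct2, THEN spec, THEN mp, OF this]
  obtain d where d: "d > 0" "\<And>z. norm (z - x) < d \<Longrightarrow> qdist dist (f z) (qeval (tup Q (\<lambda>i. aff x (ys i) (Ls i))) z) \<le> c / 2 * norm (z - x)"
    by blast
  obtain m :: nat where m: "1 / real (Suc m) < d" using nat_approx_posE[OF d(1)] by blast
  have "qdist dist (f (x + h)) (tup Q (\<lambda>i. ys i + blinfun_apply (ls ! i) h)) \<le> c * norm h"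
    if h: "norm h < 1 / real (Suc m)" for h
  proof -
    have "qdist dist (f (x + h)) (tup Q (\<lambda>i. ys i + blinfun_apply (ls ! i) h))
      \<le> qdist dist (f (x + h)) (tup Q (\<lambda>i. ys i + blinfun_apply (Ls i) h))
       + qdist dist (tup Q (\<lambda>i. ys i + blinfun_apply (Ls i) h)) (tup Q (\<lambda>i. ys i + blinfun_apply (ls ! i) h))"
      by (rule qdist_dist_triangle[of _ Q]) auto
    also have "qdist dist (f (x + h)) (tup Q (\<lambda>i. ys i + blinfun_apply (Ls i) h)) \<le> c / 2 * norm h"
      using d(2)[of "x + h"] h m by (simp add: qeval_aff)
    also have "qdist dist (tup Q (\<lambda>i. ys i + blinfun_apply (Ls i) h)) (tup Q (\<lambda>i. ys i + blinfun_apply (ls ! i) h))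
      \<le> real Q * (e' * norm h)" using close by (rule qdist_slope_le)
    also have "\<dots> \<le> c / 2 * norm h"
    proof -
      have "real Q * e' \<le> (real Q + 1) * (c / (2 * (real Q + 1)))"
        using e' by (intro mult_mono) (auto simp: e'_def)
      also have "\<dots> = c / 2" by (simp add: field_simps)
      finally show ?thesis using mult_right_mono[of "real Q * e'" "c / 2" "norm h"] by (simp add: mult.assoc)
    qed
    finally show ?thesis by simp
  qed
  moreover have "f x = tup Q ys" using qdiff_value[OF A] by (simp add: qeval_tup)
  ultimately have "x \<in> near_aff ((!) ls) k m" unfolding near_aff_def c_def by blast
  moreover have "\<forall>i<Q. norm (Ls i - ls ! i) \<le> e" using close by (force simp: e'_def)
  ultimately show ?thesis using ls by blast
qed

lemma near_aff_close:
  fixes Ls Ls' :: "nat \<Rightarrow> 'x \<Rightarrow>\<^sub>L 'y"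
  assumes "\<And>h. norm h < d \<Longrightarrow> qdist dist (f (x + h)) (tup Q (\<lambda>i. ys i + blinfun_apply (Ls i) h)) \<le> e * norm h"
    and "\<And>h. norm h < d' \<Longrightarrow> qdist dist (f (x + h)) (tup Q (\<lambda>i. ys' i + blinfun_apply (Ls' i) h)) \<le> e' * norm h"
    and "0 < d" "0 < d'" "0 \<le> e" "0 \<le> e'"
  shows "\<exists>\<sigma>. \<sigma> permutes {..<Q} \<and> (\<forall>i<Q. ys i = ys' (\<sigma> i) \<and> norm (Ls i - Ls' (\<sigma> i)) \<le> close_const Q * (e + e'))"
proof (rule affine_tuples_close)
  show "0 \<le> e + e'" "0 < min d d'" using assms by auto
  fix h :: 'x assume h: "norm h < min d d'"
  have "qdist dist (tup Q (\<lambda>i. ys i + blinfun_apply (Ls i) h)) (tup Q (\<lambda>i. ys' i + blinfun_apply (Ls' i) h))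
    \<le> qdist dist (tup Q (\<lambda>i. ys i + blinfun_apply (Ls i) h)) (f (x + h))
      + qdist dist (f (x + h)) (tup Q (\<lambda>i. ys' i + blinfun_apply (Ls' i) h))"
    by (rule qdist_dist_triangle[of _ Q]) auto
  then show "qdist dist (tup Q (\<lambda>i. ys i + blinfun_apply (Ls i) h)) (tup Q (\<lambda>i. ys' i + blinfun_apply (Ls' i) h)) \<le> (e + e') * norm h"
    using assms(1)[of h] assms(2)[of h] h
      qdist_dist_commute[of "tup Q (\<lambda>i. ys i + blinfun_apply (Ls i) h)" "f (x + h)"]
    by (simp add: distrib_right)
qed

end

context lipschitz_Q_banach
begin

text \<open>
  The approximating tuples of slopes are only determined up to permutation. Successive alignment by
  the permutations \<open>p j\<close> turns them into a Cauchy sequence of enumerated tuples.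
\<close>

lemma qdiff_if_near_aff:
  assumes near: "\<And>k. \<exists>Ls m. x \<in> near_aff Ls k m"
  shows "\<exists>As. qdiff Q f x As"
proof -
  \<comment> \<open>Exponentially small tolerances make the distances between consecutive slope
    tuples summable.\<close>
  define s where "s j = (2::nat) ^ j" for j
  define e where "e j = 1 / (2::real) ^ j" for j :: nat
  have se: "1 / real (Suc (s j)) \<le> e j" for j
    unfolding s_def e_def by (intro frac_le) auto
  have e0: "e j > 0" for j by (simp add: e_def)
  have e_Suc: "e (Suc j) = e j / 2" for j by (simp add: e_def)
  have "\<forall>j. \<exists>Ls m ys. f x = tup Q ys \<and> (\<forall>h. norm h < 1 / real (Suc m) \<longrightarrow>
     qdist dist (f (x + h)) (tup Q (\<lambda>i. ys i + blinfun_apply (Ls i) h)) \<le> e j * norm h)"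
  proof
    fix j
    obtain Ls m where "x \<in> near_aff Ls (s j) m" using near by blast
    then obtain ys where ys: "f x = tup Q ys" "\<And>h. norm h < 1 / real (Suc m) \<Longrightarrow>
     qdist dist (f (x + h)) (tup Q (\<lambda>i. ys i + blinfun_apply (Ls i) h)) \<le> 1 / real (Suc (s j)) * norm h"
      unfolding near_aff_def by blast
    have "qdist dist (f (x + h)) (tup Q (\<lambda>i. ys i + blinfun_apply (Ls i) h)) \<le> e j * norm h"
      if "norm h < 1 / real (Suc m)" for h
      using ys(2)[OF that] mult_right_mono[OF se[of j] norm_ge_zero[of h]] by linarith
    then show "\<exists>Ls m ys. f x = tup Q ys \<and> (\<forall>h. norm h < 1 / real (Suc m) \<longrightarrow>
     qdist dist (f (x + h)) (tup Q (\<lambda>i. ys i + blinfun_apply (Ls i) h)) \<le> e j * norm h)"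
      using ys(1) by blast
  qed
  then have "\<exists>Ls m ys. \<forall>j. f x = tup Q (ys j) \<and> (\<forall>h. norm h < 1 / real (Suc (m j)) \<longrightarrow>
     qdist dist (f (x + h)) (tup Q (\<lambda>i. ys j i + blinfun_apply (Ls j i) h)) \<le> e j * norm h)"
    by (simp only: choice_iff)
  then obtain Ls m ys where cc: "\<forall>j. f x = tup Q (ys j) \<and> (\<forall>h. norm h < 1 / real (Suc (m j)) \<longrightarrow>
     qdist dist (f (x + h)) (tup Q (\<lambda>i. ys j i + blinfun_apply (Ls j i) h)) \<le> e j * norm h)"
    by (elim exE)
  note app = cc[THEN spec, THEN conjunct2, THEN spec, THEN mp]
  define C where "C = close_const Q"
  have C: "C \<ge> 0" by (simp add: C_def close_const_nonneg)
  have "\<forall>j. \<exists>\<sigma>. \<sigma> permutes {..<Q} \<and> (\<forall>i<Q. ys j i = ys (Suc j) (\<sigma> i) \<and> norm (Ls j i - Ls (Suc j) (\<sigma> i)) \<le> C * (e j + e (Suc j)))"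
    unfolding C_def
  proof
    fix j
    show "\<exists>\<sigma>. \<sigma> permutes {..<Q} \<and> (\<forall>i<Q. ys j i = ys (Suc j) (\<sigma> i) \<and>
        norm (Ls j i - Ls (Suc j) (\<sigma> i)) \<le> close_const Q * (e j + e (Suc j)))"
    proof (rule near_aff_close)
      show "0 < 1 / real (Suc (m j))" "0 < 1 / real (Suc (m (Suc j)))" by simp_all
      show "0 \<le> e j" "0 \<le> e (Suc j)" by (rule less_imp_le[OF e0])+
    qed (rule app; assumption)+
  qed
  then obtain \<sigma> where \<sigma>: "\<And>j. \<sigma> j permutes {..<Q}" "\<And>j i. i < Q \<Longrightarrow> ys j i = ys (Suc j) (\<sigma> j i)"
    "\<And>j i. i < Q \<Longrightarrow> norm (Ls j i - Ls (Suc j) (\<sigma> j i)) \<le> C * (e j + e (Suc j))" by metis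
  define p where "p = rec_nat id (\<lambda>j q. \<sigma> j \<circ> q)"
  have p0: "p 0 = id" and pS: "\<And>j. p (Suc j) = \<sigma> j \<circ> p j" by (simp_all add: p_def)
  have pp: "p j permutes {..<Q}" for j
  proof (induction j)
    case 0
    show ?case unfolding p0 by (rule permutes_id)
  next
    case (Suc j)
    then show ?case unfolding pS using \<sigma>(1) by (intro permutes_compose)
  qed
  have pQ: "p j i < Q" if "i < Q" for i j using permutes_in_image[OF pp, of j i] that by simp
  define M where "M j i = Ls j (p j i)" for j i
  \<comment> \<open>The alignment preserves base points, so all the tuples share the base
    \<open>ys 0\<close>.\<close>
  have ys0: "ys j (p j i) = ys 0 i" if "i < Q" for i j
  proof (induction j)
    case (Suc j)
    have "ys (Suc j) (p (Suc j) i) = ys j (p j i)" unfolding pS using \<sigma>(2)[OF pQ[OF that, of j], of j] by simp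
    then show ?case using Suc by simp
  qed (simp add: p0)
  have step: "norm (M j i - M (Suc j) i) \<le> 2 * C * e j" if "i < Q" for i j
  proof -
    have "norm (M j i - M (Suc j) i) \<le> C * (e j + e (Suc j))"
      unfolding M_def pS using \<sigma>(3)[OF pQ[OF that, of j], of j] by simp
    also have "\<dots> \<le> C * (2 * e j)" using C e0[of j] by (intro mult_left_mono) (auto simp: e_Suc)
    finally show ?thesis by simp
  qed
  \<comment> \<open>A telescoped geometric sum: a step costs at most \<open>2 * C * e j\<close>,
    which equals \<open>4 * C * e j - 4 * C * e (Suc j)\<close>.\<close>
  have far: "norm (M j i - M (j + l) i) \<le> 4 * C * e j - 4 * C * e (j + l)" if "i < Q" for i j l
  proof (induction l)
    case (Suc l)
    have "norm (M j i - M (j + Suc l) i) \<le> norm (M j i - M (j + l) i) + norm (M (j + l) i - M (Suc (j + l)) i)"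
      using norm_triangle_ineq[of "M j i - M (j + l) i" "M (j + l) i - M (Suc (j + l)) i"] by simp
    also have "\<dots> \<le> (4 * C * e j - 4 * C * e (j + l)) + 2 * C * e (j + l)" by (intro add_mono Suc step that)
    also have "\<dots> = 4 * C * e j - 4 * C * e (j + Suc l)" by (simp add: e_def)
    finally show ?case .
  qed simp
  have far': "norm (M j i - M l i) \<le> 4 * C * e j" if "i < Q" "j \<le> l" for i j l
  proof -
    have "0 \<le> 4 * C * e l" using C e0[of l] by simp
    then show ?thesis using far[OF that(1), of j "l - j"] that(2) by simp
  qed
  have e_lim: "(\<lambda>j. c * e j) \<longlonglongrightarrow> 0" for c
    unfolding e_def using tendsto_mult_right_zero[OF LIMSEQ_inverse_realpow_zero[of 2], of c] by (simp add: divide_inverse)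
  have "\<exists>L. (\<lambda>j. M j i) \<longlonglongrightarrow> L" if i: "i < Q" for i
  proof -
    have "Cauchy (\<lambda>j. M j i)"
    proof (rule metric_CauchyI)
      fix r :: real assume "r > 0"
      then obtain N where N: "4 * C * e N < r / 2" using order_tendstoD(2)[OF e_lim[of "4 * C"], of "r / 2"]
        by (auto simp: eventually_sequentially)
      have "dist (M a i) (M c i) < r" if "a \<ge> N" "c \<ge> N" for a c
        using far'[OF i that(1)] far'[OF i that(2)] N dist_triangle[of "M a i" "M c i" "M N i"]
        by (simp add: dist_norm norm_minus_commute)
      then show "\<exists>N. \<forall>a\<ge>N. \<forall>c\<ge>N. dist (M a i) (M c i) < r" by blast
    qed
    then show ?thesis using Cauchy_convergent convergent_def by blast
  qed
  then obtain L where L: "\<And>i. i < Q \<Longrightarrow> (\<lambda>j. M j i) \<longlonglongrightarrow> L i" by metis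
  have M_lim: "norm (M j i - L i) \<le> 4 * C * e j" if "i < Q" for i j
  proof (rule LIMSEQ_le_const2)
    show "(\<lambda>l. norm (M j i - M l i)) \<longlonglongrightarrow> norm (M j i - L i)" by (intro tendsto_intros L that)
    show "\<exists>N. \<forall>l\<ge>N. norm (M j i - M l i) \<le> 4 * C * e j" using far'[OF that] by blast
  qed
  have "qdiff Q f x (tup Q (\<lambda>i. aff x (ys 0 i) (L i)))"
    unfolding qdiff_def
  proof (intro conjI allI impI)
    show "size (tup Q (\<lambda>i. aff x (ys 0 i) (L i))) = Q" by simp
    show "\<forall>A\<in>#tup Q (\<lambda>i. aff x (ys 0 i) (L i)). affine_map A" by (auto simp: affine_map_aff)
    fix r :: real assume r: "r > 0"
    obtain j where j: "(1 + real Q * (4 * C)) * e j < r"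
      using order_tendstoD(2)[OF e_lim[of "1 + real Q * (4 * C)"] r] by (auto simp: eventually_sequentially)
    have "qdist dist (f z) (qeval (tup Q (\<lambda>i. aff x (ys 0 i) (L i))) z) \<le> r * norm (z - x)"
      if z: "norm (z - x) < 1 / real (Suc (m j))" for z
    proof -
      let ?h = "z - x"
      have perm: "tup Q (\<lambda>i. ys j i + blinfun_apply (Ls j i) ?h) = tup Q (\<lambda>i. ys 0 i + blinfun_apply (M j i) ?h)"
      proof -
        have "tup Q (\<lambda>i. ys 0 i + blinfun_apply (M j i) ?h) = tup Q (\<lambda>i. ys j (p j i) + blinfun_apply (Ls j (p j i)) ?h)"
          by (intro tup_cong) (simp add: ys0 M_def)
        then show ?thesis using tup_permute[OF pp[of j], of "\<lambda>i. ys j i + blinfun_apply (Ls j i) ?h"] by simp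
      qed
      have "qdist dist (f z) (tup Q (\<lambda>i. ys 0 i + blinfun_apply (L i) ?h))
        \<le> qdist dist (f z) (tup Q (\<lambda>i. ys 0 i + blinfun_apply (M j i) ?h))
         + qdist dist (tup Q (\<lambda>i. ys 0 i + blinfun_apply (M j i) ?h)) (tup Q (\<lambda>i. ys 0 i + blinfun_apply (L i) ?h))"
        by (rule qdist_dist_triangle[of _ Q]) auto
      also have "qdist dist (f z) (tup Q (\<lambda>i. ys 0 i + blinfun_apply (M j i) ?h)) \<le> e j * norm ?h"
        using app[OF z] perm by simp
      also have "qdist dist (tup Q (\<lambda>i. ys 0 i + blinfun_apply (M j i) ?h)) (tup Q (\<lambda>i. ys 0 i + blinfun_apply (L i) ?h))
        \<le> real Q * ((4 * C * e j) * norm ?h)" by (rule qdist_slope_le[OF M_lim])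
      also have "e j * norm ?h + real Q * ((4 * C * e j) * norm ?h) = ((1 + real Q * (4 * C)) * e j) * norm ?h"
        by (simp add: algebra_simps)
      also have "\<dots> \<le> r * norm ?h" using j by (intro mult_right_mono) auto
      finally show ?thesis by (simp add: qeval_aff)
    qed
    then show "\<exists>\<delta>>0. \<forall>z. norm (z - x) < \<delta> \<longrightarrow> qdist dist (f z) (qeval (tup Q (\<lambda>i. aff x (ys 0 i) (L i))) z) \<le> r * norm (z - x)"
      by (intro exI[of _ "1 / real (Suc (m j))"]) auto
  qed
  then show ?thesis by blast
qed

text \<open>Slopes from a countable set \<open>H\<close> suffice, which expresses the domain of the
  derivative by countable operations on closed sets.\<close>

lemma approx_differentiable_eq_near_aff:
  assumes H: "\<forall>L e. e > 0 \<longrightarrow> (\<exists>L'\<in>H. norm (L - L') \<le> e)"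
  shows "{x. approx_differentiable Q \<mu> f x} = (\<Inter>k. \<Union>ls\<in>lists H. \<Union>m. near_aff ((!) ls) k m)"
proof (intro equalityI subsetI)
  fix x assume "x \<in> {x. approx_differentiable Q \<mu> f x}"
  then obtain As where As: "qdiff Q f x As" unfolding mem_Collect_eq approx_differentiable_iff by blast
  obtain ys Ls where "As = tup Q (\<lambda>i. aff x (ys i) (Ls i))" using As by (rule qdiff_aff_tup)
  then have q: "qdiff Q f x (tup Q (\<lambda>i. aff x (ys i) (Ls i)))" using As by simp
  show "x \<in> (\<Inter>k. \<Union>ls\<in>lists H. \<Union>m. near_aff ((!) ls) k m)"
  proof (intro INT_I)
    fix k
    show "x \<in> (\<Union>ls\<in>lists H. \<Union>m. near_aff ((!) ls) k m)"
      using near_aff_if_qdiff[OF q H zero_less_one, of k] by blast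
  qed
next
  fix x assume x: "x \<in> (\<Inter>k. \<Union>ls\<in>lists H. \<Union>m. near_aff ((!) ls) k m)"
  show "x \<in> {x. approx_differentiable Q \<mu> f x}"
    unfolding mem_Collect_eq approx_differentiable_iff
  proof (rule qdiff_if_near_aff)
    fix k
    have "x \<in> (\<Union>ls\<in>lists H. \<Union>m. near_aff ((!) ls) k m)" using x by (rule INT_D) simp
    then show "\<exists>Ls m. x \<in> near_aff Ls k m" by blast
  qed
qed

lemma borel_approx_differentiable: "{x. approx_differentiable Q \<mu> f x} \<in> sets borel"
proof -
  obtain H :: "('x \<Rightarrow>\<^sub>L 'y) set" where H: "countable H" "\<forall>L e. e > 0 \<longrightarrow> (\<exists>L'\<in>H. norm (L - L') \<le> e)"
    using countable_dense_blinfun[where ?'y = 'y] by blast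
  have "(\<Union>ls\<in>lists H. \<Union>m. near_aff ((!) ls) k m) \<in> sets borel" for k
    using H(1) closed_near_aff by (intro sets.countable_UN'' sets.countable_UN) auto
  then show ?thesis unfolding approx_differentiable_eq_near_aff[OF H(2)]
    by (intro sets.countable_INT) auto
qed

text \<open>Approximating slopes at \<open>x\<close> match the derivative up to
  \<open>close_const Q\<close> times the tolerance. So, within the domain, the preimage of an open
  set is the union of \<open>near_aff\<close> over those slope tuples from \<open>H\<close> whose
  neighbours at that distance all belong to the open set. The target metric comes from
  \<open>\<nu>\<close> and the approximation from the operator norm; \<open>B\<close> compares
  them.\<close>

theorem measurable_approx_deriv:
  assumes \<nu>: "is_norm \<nu>" "continuous_on UNIV \<nu>"
  shows "approx_deriv Q \<mu> f \<in> restrict_space borel {x. approx_differentiable Q \<mu> f x}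
            \<rightarrow>\<^sub>M qborel Q (\<lambda>L L'. \<nu> (L - L'))"
proof -
  let ?D = "{x. approx_differentiable Q \<mu> f x}"
  let ?d = "\<lambda>L L'. \<nu> (L - L')"
  interpret V: Metric_space "qtuples Q" "qdist ?d"
    by (intro Metric_space_qdist Metric_space_is_norm \<nu>)
  obtain B where B: "B \<ge> 0" "\<And>v. \<nu> v \<le> B * norm v" using is_norm_bounded[OF \<nu>] by blast
  obtain H :: "('x \<Rightarrow>\<^sub>L 'y) set" where H: "countable H" "\<forall>L e. e > 0 \<longrightarrow> (\<exists>L'\<in>H. norm (L - L') \<le> e)"
    using countable_dense_blinfun[where ?'y = 'y] by blast
  define C where "C = close_const Q"
  have C: "C \<ge> 0" by (simp add: C_def close_const_nonneg)
  have rep: "\<exists>ys Ls. qdiff Q f x (tup Q (\<lambda>i. aff x (ys i) (Ls i))) \<and> approx_deriv Q \<mu> f x = tup Q Ls" if "x \<in> ?D" for x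
  proof -
    obtain As where As: "qdiff Q f x As" using \<open>x \<in> ?D\<close> unfolding mem_Collect_eq approx_differentiable_iff by blast
    obtain ys Ls where "As = tup Q (\<lambda>i. aff x (ys i) (Ls i))" using As by (rule qdiff_aff_tup)
    then show ?thesis using As approx_deriv_eq by blast
  qed
  show ?thesis
    unfolding qborel_def
  proof (rule measurable_measure_of)
    show "{U. openin V.mtopology U} \<subseteq> Pow (qtuples Q)"
      using V.openin_mtopology by auto
    show "approx_deriv Q \<mu> f \<in> space (restrict_space borel ?D) \<rightarrow> qtuples Q"
      using rep by (fastforce simp: space_restrict_space)
    fix U assume "U \<in> {U. openin V.mtopology U}"
    then have U: "\<And>M. M \<in> U \<Longrightarrow> \<exists>r>0. V.mball M r \<subseteq> U" using V.openin_mtopology by auto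
    \<comment> \<open>\<open>2 / real (Suc k)\<close> adds the tolerances of the two expansions
      compared by \<open>near_aff_close\<close>. Neighbours are taken for a fixed enumeration and in
      the operator norm.\<close>
    define good where "good ls k \<longleftrightarrow> (\<forall>Ms. (\<forall>i<Q. norm (ls ! i - Ms i) \<le> C * (2 / real (Suc k))) \<longrightarrow> tup Q Ms \<in> U)" for ls k
    let ?S = "\<Union>k. \<Union>ls\<in>{ls \<in> lists H. good ls k}. \<Union>m. near_aff ((!) ls) k m"
    have "approx_deriv Q \<mu> f -` U \<inter> ?D = ?S \<inter> ?D"
    proof (intro set_eqI iffI)
      fix x assume "x \<in> ?S \<inter> ?D"
      then obtain k ls m where x: "good ls k" "x \<in> near_aff ((!) ls) k m" and xD: "x \<in> ?D" by blast
      obtain ys Ls where A: "qdiff Q f x (tup Q (\<lambda>i. aff x (ys i) (Ls i)))" "approx_deriv Q \<mu> f x = tup Q Ls"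
        using rep[OF xD] by blast
      define c where "c = 1 / real (Suc k)"
      have c: "c > 0" by (simp add: c_def)
      obtain zs where zs: "\<And>h. norm h < 1 / real (Suc m) \<Longrightarrow>
         qdist dist (f (x + h)) (tup Q (\<lambda>i. zs i + blinfun_apply (ls ! i) h)) \<le> c * norm h"
        using x(2) unfolding near_aff_def c_def by blast
      from A(1)[unfolded qdiff_def, THEN conjunct2, THEN conjunct2, THEN spec, THEN mp, OF c]
      obtain d where d: "d > 0" "\<And>z. norm (z - x) < d \<Longrightarrow> qdist dist (f z) (qeval (tup Q (\<lambda>i. aff x (ys i) (Ls i))) z) \<le> c * norm (z - x)"
        by blast
      have "qdist dist (f (x + h)) (tup Q (\<lambda>i. ys i + blinfun_apply (Ls i) h)) \<le> c * norm h" if "norm h < d" for h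
        using d(2)[of "x + h"] that by (simp add: qeval_aff)
      then have "\<exists>\<sigma>. \<sigma> permutes {..<Q} \<and> (\<forall>i<Q. zs i = ys (\<sigma> i) \<and> norm (ls ! i - Ls (\<sigma> i)) \<le> close_const Q * (c + c))"
        using zs c d(1) by (intro near_aff_close[of "1 / real (Suc m)" x _ _ _ d]) auto
      then obtain \<sigma> where \<sigma>: "\<sigma> permutes {..<Q}" "\<And>i. i < Q \<Longrightarrow> norm (ls ! i - Ls (\<sigma> i)) \<le> C * (c + c)"
        unfolding C_def by blast
      have "c + c = 2 / real (Suc k)" by (simp add: c_def)
      then have "tup Q (\<lambda>i. Ls (\<sigma> i)) \<in> U" using x(1) \<sigma>(2) unfolding good_def by simp
      then show "x \<in> approx_deriv Q \<mu> f -` U \<inter> ?D" using A(2) xD tup_permute[OF \<sigma>(1), of Ls] by simp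
    next
      fix x assume x: "x \<in> approx_deriv Q \<mu> f -` U \<inter> ?D"
      obtain ys Ls where A: "qdiff Q f x (tup Q (\<lambda>i. aff x (ys i) (Ls i)))" "approx_deriv Q \<mu> f x = tup Q Ls"
        using rep x by blast
      obtain r where r: "r > 0" "V.mball (tup Q Ls) r \<subseteq> U" using U[of "tup Q Ls"] x A(2) by auto
      \<comment> \<open>Rounding costs \<open>c\<close> and the definition of \<open>good\<close>
        costs \<open>C * (2 * c)\<close>, hence \<open>(2 * C + 1) * c\<close> in each
        branch.\<close>
      define M where "M = real Q * (B * (2 * C + 1)) + 1"
      have M: "M > 0" using B(1) C by (simp add: M_def add_nonneg_pos)
      obtain k :: nat where k: "1 / real (Suc k) < r / M" using nat_approx_posE[of "r / M"] r(1) M by auto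
      define c where "c = 1 / real (Suc k)"
      have c: "c > 0" by (simp add: c_def)
      have Mc: "M * c < r" using k M by (simp add: c_def pos_less_divide_eq mult.commute)
      obtain ls m where ls: "ls \<in> lists H" "x \<in> near_aff ((!) ls) k m" "\<And>i. i < Q \<Longrightarrow> norm (Ls i - ls ! i) \<le> c"
        using near_aff_if_qdiff[OF A(1) H(2) c, of k] by blast
      have "good ls k"
        unfolding good_def
      proof (intro allI impI)
        fix Ms assume Ms: "\<forall>i<Q. norm (ls ! i - Ms i) \<le> C * (2 / real (Suc k))"
        have "\<nu> (Ls i - Ms i) \<le> B * ((2 * C + 1) * c)" if i: "i < Q" for i
        proof -
          have "norm (Ls i - Ms i) \<le> norm (Ls i - ls ! i) + norm (ls ! i - Ms i)"
            using norm_triangle_ineq[of "Ls i - ls ! i" "ls ! i - Ms i"] by simp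
          also have "\<dots> \<le> c + C * (2 * c)" using ls(3)[OF i] Ms i by (intro add_mono) (auto simp: c_def)
          also have "\<dots> = (2 * C + 1) * c" by (simp add: algebra_simps)
          finally have "B * norm (Ls i - Ms i) \<le> B * ((2 * C + 1) * c)" using B(1) by (rule mult_left_mono)
          then show ?thesis using B(2)[of "Ls i - Ms i"] by linarith
        qed
        moreover have "0 \<le> \<nu> v" for v using \<nu>(1) by (simp add: is_norm_def)
        ultimately have "L2_set (\<lambda>i. \<nu> (Ls i - Ms i)) {..<Q} \<le> real Q * (B * ((2 * C + 1) * c))"
          by (intro L2_set_le_card_times) auto
        then have "qdist ?d (tup Q Ls) (tup Q Ms) \<le> real Q * (B * ((2 * C + 1) * c))"
          using qdist_tup_le[of ?d Q Ls Ms] by simp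
        also have "\<dots> \<le> M * c" using c by (simp add: M_def algebra_simps)
        also have "\<dots> < r" by (rule Mc)
        finally show "tup Q Ms \<in> U" using r(2) by (auto simp: V.in_mball)
      qed
      then show "x \<in> ?S \<inter> ?D" using ls x by blast
    qed
    moreover have "?S \<in> sets borel"
      using H(1) closed_near_aff
      by (intro sets.countable_UN sets.countable_UN'' image_subsetI) (auto intro: countable_subset[of _ "lists H"])
    ultimately show "approx_deriv Q \<mu> f -` U \<inter> space (restrict_space borel ?D) \<in> sets (restrict_space borel ?D)"
      using borel_approx_differentiable by (simp add: space_restrict_space sets_restrict_space_iff)
  qed
qed

end

section \<open>One-dimensional Hausdorff measure\<close>

text \<open>An outer measure that is additive on sets at positive distance is a measure on the Borel
  sets. Only one inequality is asked for in \<open>separated\<close>, the other being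
  subadditivity.\<close>

locale metric_outer_measure =
  fixes \<phi> :: "'a::metric_space set \<Rightarrow> ennreal"
  assumes empty [simp]: "\<phi> {} = 0"
    and mono: "A \<subseteq> B \<Longrightarrow> \<phi> A \<le> \<phi> B"
    and subadd: "\<phi> (\<Union>i. S i) \<le> (\<Sum>i. \<phi> (S (i::nat)))"
    and separated: "d > 0 \<Longrightarrow> (\<And>x y. x \<in> A \<Longrightarrow> y \<in> B \<Longrightarrow> d \<le> dist x y) \<Longrightarrow> \<phi> A + \<phi> B \<le> \<phi> (A \<union> B)"
begin

lemma subadd2: "\<phi> (A \<union> B) \<le> \<phi> A + \<phi> B"
proof -
  have "\<phi> (\<Union>i. binaryset A B i) \<le> (\<Sum>i. \<phi> (binaryset A B i))" by (rule subadd)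
  then show ?thesis by (simp add: UN_binaryset_eq suminf_binaryset_eq)
qed

text \<open>The part of \<open>T\<close> outside \<open>F\<close> is cut into shells by the distance
  to \<open>F\<close>. Shells of equal parity are at positive distance from each other, so their
  measures sum to at most that of \<open>T\<close>; hence the tail of shells is negligible, and the
  remaining \<open>B N\<close> is at positive distance from \<open>F\<close>.\<close>

lemma closed_split:
  assumes F: "closed F" "F \<noteq> {}" and fin: "\<phi> T < \<infinity>"
  shows "\<phi> (T \<inter> F) + \<phi> (T - F) \<le> \<phi> T"
proof -
  define B where "B n = {x \<in> T - F. 1 / real (Suc n) \<le> infdist x F}" for n
  define R where "R n = {x \<in> T - F. 1 / real (n + 2) \<le> infdist x F \<and> infdist x F < 1 / real (Suc n)}" for n
  have fin': "\<phi> S < \<infinity>" if "S \<subseteq> T" for S using mono[OF that] fin by (rule le_less_trans)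
  have RT: "R n \<subseteq> T" "B n \<subseteq> T" for n by (auto simp: R_def B_def)
  have cover: "T - F \<subseteq> B n \<union> (\<Union>k. R (k + n))" for n
  proof
    fix x assume x: "x \<in> T - F"
    then have pos: "infdist x F > 0"
      using in_closed_iff_infdist_zero[OF F, of x] infdist_nonneg[of x F] by auto
    show "x \<in> B n \<union> (\<Union>k. R (k + n))"
    proof (cases "x \<in> B n")
      case False
      obtain j0 :: nat where "1 / real (Suc j0) < infdist x F" using nat_approx_posE[OF pos] by blast
      then have ex: "\<exists>j. 1 / real (Suc j) \<le> infdist x F" by (intro exI[of _ j0]) simp
      \<comment> \<open>The least such index exceeds \<open>n\<close> because \<open>x\<close> is
        outside \<open>B n\<close>, and minimality places \<open>x\<close> in shell
        \<open>j - 1\<close>.\<close>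
      define j where "j = (LEAST j. 1 / real (Suc j) \<le> infdist x F)"
      have j: "1 / real (Suc j) \<le> infdist x F" unfolding j_def using ex by (rule LeastI_ex)
      have least: "\<not> 1 / real (Suc i) \<le> infdist x F" if "i < j" for i
        using that not_less_Least unfolding j_def by blast
      have "n < j"
      proof (rule ccontr)
        assume "\<not> n < j"
        then have "1 / real (Suc n) \<le> 1 / real (Suc j)" by (intro divide_left_mono) auto
        then have "1 / real (Suc n) \<le> infdist x F" using j by linarith
        then show False using False x by (simp add: B_def)
      qed
      then obtain k where k: "j = Suc (k + n)" using less_imp_Suc_add[of n j] by (auto simp: add.commute)
      have "x \<in> R (k + n)" using x j least[of "k + n"] unfolding R_def k by (simp add: not_le)
      then show ?thesis by blast
    qed simp
  qed
  have parity: "(\<Sum>k<N. \<phi> (R (2 * k + c))) \<le> \<phi> (\<Union>k<N. R (2 * k + c))" for N c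
  proof (induction N)
    case (Suc N)
    let ?A = "\<Union>k<N. R (2 * k + c)"
    have "\<phi> ?A + \<phi> (R (2 * N + c)) \<le> \<phi> (?A \<union> R (2 * N + c))"
    proof (cases "N = 0")
      case False
      define p where "p = real (2 * N + c)"
      have p: "p > 0" using False by (simp add: p_def)
      \<comment> \<open>\<open>1 / p\<close> bounds the distance to \<open>F\<close> from below on
        the earlier shells, \<open>1 / (p + 1)\<close> from above on the new one.\<close>
      have d: "1 / p - 1 / (p + 1) > 0" using divide_strict_left_mono[of p "p + 1" 1] p by simp
      show ?thesis
      proof (rule separated[OF d])
        fix x y assume "x \<in> ?A" and y: "y \<in> R (2 * N + c)"
        then obtain k where k: "k < N" "x \<in> R (2 * k + c)" by blast
        have "1 / p \<le> 1 / real (2 * k + c + 2)" unfolding p_def using k(1) False by (intro divide_left_mono) auto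
        also have "\<dots> \<le> infdist x F" using k(2) by (simp add: R_def)
        finally have "1 / p \<le> infdist x F" .
        moreover have "infdist y F < 1 / (p + 1)" using y by (simp add: R_def p_def add.commute)
        moreover have "infdist x F \<le> infdist y F + dist x y" by (rule infdist_triangle)
        ultimately show "1 / p - 1 / (p + 1) \<le> dist x y" by linarith
      qed
    qed simp
    moreover have "(\<Union>k<Suc N. R (2 * k + c)) = ?A \<union> R (2 * N + c)" by (auto simp: less_Suc_eq)
    ultimately show ?case using order_trans[OF add_right_mono[OF Suc]] by simp
  qed simp
  define t where "t = enn2real (\<phi> T)"
  have t: "ennreal t = \<phi> T" using fin by (simp add: t_def)
  have t0: "t \<ge> 0" by (simp add: t_def)
  define r where "r n = enn2real (\<phi> (R n))" for n
  have r: "ennreal (r n) = \<phi> (R n)" for n using fin'[OF RT(1)] by (simp add: r_def)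
  have r0: "r n \<ge> 0" for n by (simp add: r_def)
  have half: "(\<Sum>k<N. r (2 * k + c)) \<le> t" for N c
  proof -
    have "ennreal (\<Sum>k<N. r (2 * k + c)) = (\<Sum>k<N. \<phi> (R (2 * k + c)))"
      using r0 by (simp add: r flip: sum_ennreal)
    also have "\<dots> \<le> \<phi> (\<Union>k<N. R (2 * k + c))" by (rule parity)
    also have "\<dots> \<le> \<phi> T" using RT by (intro mono) blast
    finally show ?thesis using t0 by (simp flip: t)
  qed
  have "(\<Sum>k<2 * N. r k) = (\<Sum>k<N. r (2 * k + 0)) + (\<Sum>k<N. r (2 * k + 1))" for N
    by (induction N) (simp_all add: algebra_simps)
  then have "(\<Sum>k<2 * N. r k) \<le> 2 * t" for N using half[where N = N and c = 0] half[where N = N and c = 1] by simp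
  moreover have "(\<Sum>k<N. r k) \<le> (\<Sum>k<2 * N. r k)" for N using r0 by (intro sum_mono2) auto
  ultimately have "(\<Sum>k<N. r k) \<le> 2 * t" for N using order_trans by blast
  then have summ: "summable r" using r0 by (intro summableI_nonneg_bounded)
  show ?thesis
  proof (rule ennreal_le_epsilon)
    fix e :: real assume e: "e > 0"
    obtain N where N: "\<And>n. n \<ge> N \<Longrightarrow> norm (\<Sum>i. r (i + n)) < e"
      using suminf_exist_split[OF e summ] by blast
    have sN: "summable (\<lambda>i. r (i + N))" using summ by (rule summable_ignore_initial_segment)
    have "\<phi> (\<Union>k. R (k + N)) \<le> (\<Sum>k. \<phi> (R (k + N)))" by (rule subadd)
    also have "\<dots> = (\<Sum>k. ennreal (r (k + N)))" by (simp add: r)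
    also have "\<dots> = ennreal (\<Sum>k. r (k + N))" using sN r0 by (intro suminf_ennreal2) auto
    also have "\<dots> \<le> ennreal e" using N[of N] by (intro ennreal_leI) auto
    finally have tail: "\<phi> (\<Union>k. R (k + N)) \<le> ennreal e" .
    have "\<phi> (T - F) \<le> \<phi> (B N \<union> (\<Union>k. R (k + N)))" by (rule mono[OF cover])
    also have "\<dots> \<le> \<phi> (B N) + \<phi> (\<Union>k. R (k + N))" by (rule subadd2)
    also have "\<dots> \<le> \<phi> (B N) + ennreal e" using tail by (rule add_left_mono)
    finally have 1: "\<phi> (T - F) \<le> \<phi> (B N) + ennreal e" .
    have "\<phi> (T \<inter> F) + \<phi> (B N) \<le> \<phi> ((T \<inter> F) \<union> B N)"
    proof (rule separated[of "1 / real (Suc N)"])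
      fix x y assume "x \<in> T \<inter> F" "y \<in> B N"
      then show "1 / real (Suc N) \<le> dist x y"
        using infdist_le[of x F y] by (auto simp: B_def dist_commute)
    qed simp
    also have "\<dots> \<le> \<phi> T" by (rule mono) (auto simp: B_def)
    finally have 2: "\<phi> (T \<inter> F) + \<phi> (B N) \<le> \<phi> T" .
    have "\<phi> (T \<inter> F) + \<phi> (T - F) \<le> \<phi> (T \<inter> F) + (\<phi> (B N) + ennreal e)" using 1 by (rule add_left_mono)
    also have "\<dots> \<le> \<phi> T + ennreal e" using 2 by (simp add: add_right_mono flip: add.assoc)
    finally show "\<phi> (T \<inter> F) + \<phi> (T - F) \<le> \<phi> T + ennreal e" .
  qed
qed

lemma closed_in_lambda_system:
  assumes F: "closed F"
  shows "F \<in> lambda_system UNIV (Pow UNIV) \<phi>"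
proof -
  have "\<phi> (F \<inter> T) + \<phi> ((UNIV - F) \<inter> T) = \<phi> T" for T
  proof (rule antisym)
    show "\<phi> (F \<inter> T) + \<phi> ((UNIV - F) \<inter> T) \<le> \<phi> T"
    proof (cases "F = {} \<or> \<phi> T = \<infinity>")
      case False
      moreover have "F \<inter> T = T \<inter> F" "(UNIV - F) \<inter> T = T - F" by auto
      ultimately show ?thesis using closed_split[OF F, of T] by (simp add: less_top)
    qed auto
    have "\<phi> T = \<phi> ((F \<inter> T) \<union> ((UNIV - F) \<inter> T))" by (rule arg_cong[where f = \<phi>]) blast
    also have "\<dots> \<le> \<phi> (F \<inter> T) + \<phi> ((UNIV - F) \<inter> T)" by (rule subadd2)
    finally show "\<phi> T \<le> \<phi> (F \<inter> T) + \<phi> ((UNIV - F) \<inter> T)" .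
  qed
  then show ?thesis by (simp add: lambda_system_def)
qed

text \<open>The sets satisfying Caratheodory's condition form a sigma-algebra that contains the
  closed sets.\<close>

lemma measure_space_borel: "measure_space UNIV (sets borel) \<phi>"
proof -
  have P: "sigma_algebra UNIV (Pow UNIV :: 'a set set)" by (rule sigma_algebra_Pow)
  have "outer_measure_space (Pow UNIV) \<phi>"
    unfolding outer_measure_space_def positive_def increasing_def countably_subadditive_def
    using mono subadd by auto
  then have ms: "measure_space UNIV (lambda_system UNIV (Pow UNIV) \<phi>) \<phi>"
    by (rule sigma_algebra.caratheodory_lemma[OF P])
  then have sa: "sigma_algebra UNIV (lambda_system UNIV (Pow UNIV) \<phi>)" by (simp add: measure_space_def)
  have "sigma_sets UNIV (Collect closed) \<subseteq> lambda_system UNIV (Pow UNIV) \<phi>"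
    using closed_in_lambda_system by (intro sigma_algebra.sigma_sets_subset[OF sa]) auto
  then have "sets borel \<subseteq> lambda_system UNIV (Pow UNIV) \<phi>"
    by (simp add: borel_eq_closed)
  moreover have "sigma_algebra UNIV (sets (borel :: 'a measure))" using sets.sigma_algebra_axioms[of borel] by simp
  ultimately show ?thesis using measure_down[OF ms] by blast
qed

end

section \<open>Hausdorff size at a fixed scale and its supremum over scales\<close>

lemma ediam_empty [simp]: "ediam {} = 0"
  by (simp add: ediam_def bot_ennreal)

lemma dist_le_ediam: "x \<in> S \<Longrightarrow> y \<in> S \<Longrightarrow> ennreal (dist x y) \<le> ediam S"
  unfolding ediam_def by (meson SUP_upper SUP_upper2 order_trans)

lemma hausdorff1_size_le:
  "S \<subseteq> (\<Union>i. C i) \<Longrightarrow> (\<And>i. ediam (C i) \<le> ennreal \<delta>) \<Longrightarrow> hausdorff1_size \<delta> S \<le> (\<Sum>i. ediam (C i))"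
  unfolding hausdorff1_size_def by (intro INF_lower) auto

lemma hausdorff1_size_close:
  assumes "hausdorff1_size \<delta> S < e"
  obtains C where "S \<subseteq> (\<Union>i::nat. C i)" "\<And>i. ediam (C i) \<le> ennreal \<delta>" "(\<Sum>i. ediam (C i)) < e"
  using assms unfolding hausdorff1_size_def INF_less_iff by blast

lemma hausdorff1_size_empty: "hausdorff1_size \<delta> ({} :: 'a::metric_space set) = 0"
proof -
  have "hausdorff1_size \<delta> ({} :: 'a set) \<le> (\<Sum>i::nat. ediam ({} :: 'a set))" by (rule hausdorff1_size_le[of "{}" "\<lambda>_. {}" \<delta>]) auto
  then show ?thesis by simp
qed

lemma hausdorff1_size_mono: "A \<subseteq> B \<Longrightarrow> hausdorff1_size \<delta> A \<le> hausdorff1_size \<delta> B"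
  unfolding hausdorff1_size_def by (intro INF_superset_mono) auto

lemma hausdorff1_size_antimono: "\<delta> \<le> \<delta>' \<Longrightarrow> hausdorff1_size \<delta>' A \<le> hausdorff1_size \<delta> A"
  unfolding hausdorff1_size_def by (intro INF_superset_mono) (auto intro: order_trans ennreal_leI)

lemma hausdorff1_size_subadd: "hausdorff1_size \<delta> (\<Union>i. S i) \<le> (\<Sum>i. hausdorff1_size \<delta> (S (i::nat)))"
proof (rule ennreal_le_epsilon)
  fix e :: real assume e: "0 < e" and fin: "(\<Sum>i. hausdorff1_size \<delta> (S i)) < top"
  then have *: "\<And>n. hausdorff1_size \<delta> (S n) < hausdorff1_size \<delta> (S n) + e * (1/2)^Suc n"
    by (auto simp add: less_top dest!: ennreal_suminf_lessD)
  have "\<exists>C. S n \<subseteq> (\<Union>i::nat. C i) \<and> (\<forall>i. ediam (C i) \<le> ennreal \<delta>) \<and>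
      (\<Sum>i. ediam (C i)) \<le> hausdorff1_size \<delta> (S n) + e * (1/2)^Suc n" for n
    using hausdorff1_size_close[OF *[of n]] by (metis less_imp_le)
  then obtain B where B: "\<And>n. S n \<subseteq> (\<Union>i::nat. B n i)" "\<And>n i. ediam (B n i) \<le> ennreal \<delta>"
    "\<And>n. (\<Sum>i. ediam (B n i)) \<le> hausdorff1_size \<delta> (S n) + e * (1/2)^Suc n"
    by metis
  define C where "C = case_prod B o prod_decode"
  have sub: "(\<Union>i. S i) \<subseteq> (\<Union>i. C i)"
    using B(1) by (auto simp add: C_def subset_eq) (metis prod.case prod_encode_inverse)
  have "hausdorff1_size \<delta> (\<Union>i. S i) \<le> (\<Sum>i. ediam (C i))"
    using B(2) by (intro hausdorff1_size_le[OF sub]) (auto simp: C_def split_def)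
  also have "\<dots> = (\<Sum>n. \<Sum>i. ediam (B n i))"
    unfolding C_def comp_def by (intro suminf_ennreal_2dimen) auto
  also have "\<dots> \<le> (\<Sum>n. hausdorff1_size \<delta> (S n) + e * (1/2) ^ Suc n)"
    by (intro suminf_le allI B(3)) auto
  also have "\<dots> = (\<Sum>n. hausdorff1_size \<delta> (S n)) + (\<Sum>n. ennreal e * ennreal ((1/2) ^ Suc n))"
    using e by (subst suminf_add[symmetric])
      (auto simp del: ennreal_suminf_cmult simp add: ennreal_mult[symmetric])
  also have "\<dots> = (\<Sum>n. hausdorff1_size \<delta> (S n)) + e"
    unfolding ennreal_suminf_cmult
    by (subst suminf_ennreal_eq[OF zero_le_power power_half_series]) auto
  finally show "hausdorff1_size \<delta> (\<Union>i. S i) \<le> (\<Sum>i. hausdorff1_size \<delta> (S i)) + e" .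
qed

text \<open>A set of diameter at most \<open>\<delta> < d\<close> meets at most one of
  \<open>A\<close> and \<open>B\<close>, so a cover of the union splits into two; empty sets fill
  the gaps at no cost.\<close>

lemma hausdorff1_size_separated:
  assumes d: "\<delta> < d" "0 \<le> \<delta>" and sep: "\<And>x y. x \<in> A \<Longrightarrow> y \<in> B \<Longrightarrow> d \<le> dist x y"
  shows "hausdorff1_size \<delta> A + hausdorff1_size \<delta> B \<le> hausdorff1_size \<delta> (A \<union> B)"
  unfolding hausdorff1_size_def[of \<delta> "A \<union> B"]
proof (rule INF_greatest)
  fix C assume "C \<in> {C::nat \<Rightarrow> 'a set. A \<union> B \<subseteq> (\<Union>i. C i) \<and> (\<forall>i. ediam (C i) \<le> ennreal \<delta>)}"
  then have C: "A \<union> B \<subseteq> (\<Union>i. C i)" "\<And>i. ediam (C i) \<le> ennreal \<delta>" by auto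
  define P where "P i = (if C i \<inter> A \<noteq> {} then C i else {})" for i
  define N where "N i = (if C i \<inter> A \<noteq> {} then {} else C i)" for i
  have "hausdorff1_size \<delta> A \<le> (\<Sum>i. ediam (P i))"
  proof (rule hausdorff1_size_le)
    show "A \<subseteq> (\<Union>i. P i)"
    proof
      fix x assume x: "x \<in> A"
      then obtain i where "x \<in> C i" using C(1) by blast
      then have "x \<in> P i" using x by (auto simp: P_def)
      then show "x \<in> (\<Union>i. P i)" by blast
    qed
  qed (use C(2) in \<open>auto simp: P_def\<close>)
  moreover have "hausdorff1_size \<delta> B \<le> (\<Sum>i. ediam (N i))"
  proof (rule hausdorff1_size_le)
    show "B \<subseteq> (\<Union>i. N i)"
    proof
      fix y assume y: "y \<in> B"
      then obtain i where i: "y \<in> C i" using C(1) by blast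
      have "C i \<inter> A = {}"
      proof (rule ccontr)
        assume "C i \<inter> A \<noteq> {}"
        then obtain x where x: "x \<in> C i" "x \<in> A" by blast
        have "ennreal (dist x y) \<le> ennreal \<delta>" using dist_le_ediam[OF x(1) i] C(2)[of i] by (rule order_trans)
        then have "dist x y \<le> \<delta>" using d(2) by simp
        then show False using sep[OF x(2) y] d(1) by simp
      qed
      then have "y \<in> N i" using i by (simp add: N_def)
      then show "y \<in> (\<Union>i. N i)" by blast
    qed
  qed (use C(2) in \<open>auto simp: N_def\<close>)
  ultimately have "hausdorff1_size \<delta> A + hausdorff1_size \<delta> B \<le> (\<Sum>i. ediam (P i)) + (\<Sum>i. ediam (N i))"
    by (rule add_mono)
  also have "\<dots> = (\<Sum>i. ediam (P i) + ediam (N i))" by (rule suminf_add) auto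
  also have "\<dots> = (\<Sum>i. ediam (C i))" by (intro suminf_cong) (auto simp: P_def N_def)
  finally show "hausdorff1_size \<delta> A + hausdorff1_size \<delta> B \<le> (\<Sum>i. ediam (C i))" .
qed

definition hausdorff1_outer :: "'a::metric_space set \<Rightarrow> ennreal" where
  "hausdorff1_outer S = (SUP \<delta>\<in>{0<..}. hausdorff1_size \<delta> S)"

lemma hausdorff1_size_le_outer: "\<delta> > 0 \<Longrightarrow> hausdorff1_size \<delta> S \<le> hausdorff1_outer S"
  unfolding hausdorff1_outer_def by (intro SUP_upper) auto

interpretation hausdorff1_outer: metric_outer_measure hausdorff1_outer
proof
  show "hausdorff1_outer {} = 0" by (simp add: hausdorff1_outer_def hausdorff1_size_empty)
  show "hausdorff1_outer A \<le> hausdorff1_outer B" if "A \<subseteq> B" for A B :: "'a set"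
    unfolding hausdorff1_outer_def using hausdorff1_size_mono[OF that] by (intro SUP_mono) auto
  show "hausdorff1_outer (\<Union>i. S i) \<le> (\<Sum>i. hausdorff1_outer (S i))" for S :: "nat \<Rightarrow> 'a set"
    unfolding hausdorff1_outer_def[of "\<Union>i. S i"]
  proof (rule SUP_least)
    fix \<delta> :: real assume "\<delta> \<in> {0<..}"
    then have "(\<Sum>i. hausdorff1_size \<delta> (S i)) \<le> (\<Sum>i. hausdorff1_outer (S i))"
      by (intro suminf_le allI hausdorff1_size_le_outer) auto
    then show "hausdorff1_size \<delta> (\<Union>i. S i) \<le> (\<Sum>i. hausdorff1_outer (S i))"
      using hausdorff1_size_subadd[of \<delta> S] by (rule order_trans[rotated])
  qed
  fix d :: real and A B :: "'a set"
  assume d: "d > 0" and sep: "\<And>x y. x \<in> A \<Longrightarrow> y \<in> B \<Longrightarrow> d \<le> dist x y"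
  \<comment> \<open>Different scales for the two sets, so that the suprema can be taken one after
    the other.\<close>
  have ex: "hausdorff1_size \<delta> A + hausdorff1_size \<delta>' B \<le> hausdorff1_outer (A \<union> B)" if "\<delta> > 0" "\<delta>' > 0" for \<delta> \<delta>'
  proof -
    define e where "e = min (min \<delta> \<delta>') (d / 2)"
    have e: "e > 0" "e < d" using that d by (auto simp: e_def)
    have "hausdorff1_size \<delta> A + hausdorff1_size \<delta>' B \<le> hausdorff1_size e A + hausdorff1_size e B"
      by (intro add_mono hausdorff1_size_antimono) (auto simp: e_def)
    also have "\<dots> \<le> hausdorff1_size e (A \<union> B)" using e sep by (intro hausdorff1_size_separated[of e d]) auto
    also have "\<dots> \<le> hausdorff1_outer (A \<union> B)" using e by (intro hausdorff1_size_le_outer)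
    finally show ?thesis .
  qed
  have "hausdorff1_outer A + hausdorff1_size \<delta>' B \<le> hausdorff1_outer (A \<union> B)" if "\<delta>' > 0" for \<delta>'
    unfolding hausdorff1_outer_def[of A]
    by (subst ennreal_SUP_add_left[symmetric]) (auto intro!: SUP_least ex that)
  then show "hausdorff1_outer A + hausdorff1_outer B \<le> hausdorff1_outer (A \<union> B)"
  proof -
    assume le: "\<And>\<delta>'. \<delta>' > 0 \<Longrightarrow> hausdorff1_outer A + hausdorff1_size \<delta>' B \<le> hausdorff1_outer (A \<union> B)"
    have "hausdorff1_outer A + hausdorff1_outer B = (SUP \<delta>\<in>{0<..}. hausdorff1_size \<delta> B + hausdorff1_outer A)"
      unfolding hausdorff1_outer_def[of B] by (subst ennreal_SUP_add_left) (auto simp: add.commute)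
    also have "\<dots> \<le> hausdorff1_outer (A \<union> B)" using le by (intro SUP_least) (auto simp: add.commute)
    finally show ?thesis .
  qed
qed

lemma sets_hausdorff1 [simp, measurable_cong]: "sets hausdorff1 = sets borel"
  unfolding hausdorff1_def by (simp add: sets.sigma_sets_eq[of borel, simplified])

text \<open>\<open>measure_of\<close> returns the given set function only if it is countably
  additive on the Borel sets; this is what Caratheodory's criterion supplies.\<close>

lemma emeasure_hausdorff1: "S \<in> sets borel \<Longrightarrow> emeasure hausdorff1 S = hausdorff1_outer S"
  using hausdorff1_outer.measure_space_borel
  unfolding hausdorff1_def hausdorff1_outer_def[abs_def] measure_space_def
  by (intro emeasure_measure_of_sigma) auto

text \<open>A cover of the image pulls back to sets whose diameters are at most the given ones
  divided by \<open>c\<close>, and a set of reals lies in an interval as long as its diameter. The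
  scale 1 serves to make the diameters finite.\<close>

lemma hausdorff1_outer_expanding:
  fixes g :: "real \<Rightarrow> 'a::metric_space"
  assumes T: "T \<in> sets borel" and c: "c > 0"
    and ex: "\<And>s t. s \<in> T \<Longrightarrow> t \<in> T \<Longrightarrow> c * \<bar>s - t\<bar> \<le> dist (g s) (g t)"
  shows "ennreal c * emeasure lborel T \<le> hausdorff1_outer (g ` T)"
proof -
  have "ennreal c * emeasure lborel T \<le> hausdorff1_size 1 (g ` T)"
    unfolding hausdorff1_size_def
  proof (rule INF_greatest)
    fix C assume "C \<in> {C::nat \<Rightarrow> 'a set. g ` T \<subseteq> (\<Union>i. C i) \<and> (\<forall>i. ediam (C i) \<le> ennreal 1)}"
    then have C: "g ` T \<subseteq> (\<Union>i. C i)" "\<And>i. ediam (C i) \<le> 1" by auto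
    define D where "D i = enn2real (ediam (C i))" for i
    have fin: "ediam (C i) < top" for i using C(2)[of i] by (simp add: le_less_trans)
    have D: "ennreal (D i) = ediam (C i)" for i using fin[of i] by (simp add: D_def)
    have D0: "D i \<ge> 0" for i by (simp add: D_def)
    define P where "P i = {s \<in> T. g s \<in> C i}" for i
    define J where "J i = (if P i = {} then {} else {Inf (P i)..Inf (P i) + D i / c})" for i
    have PJ: "P i \<subseteq> J i" for i
    proof
      fix s assume s: "s \<in> P i"
      have close: "\<bar>u - v\<bar> \<le> D i / c" if "u \<in> P i" "v \<in> P i" for u v
      proof -
        have "ennreal (dist (g u) (g v)) \<le> ennreal (D i)" unfolding D using that by (intro dist_le_ediam) (auto simp: P_def)
        then have "dist (g u) (g v) \<le> D i" using D0 by simp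
        then have "c * \<bar>u - v\<bar> \<le> D i" using ex[of u v] that by (auto simp: P_def)
        then show ?thesis using c by (simp add: pos_le_divide_eq mult.commute)
      qed
      have lb: "s - D i / c \<le> u" if "u \<in> P i" for u using close[OF s that] by linarith
      then have "bdd_below (P i)" by (meson bdd_belowI)
      then have "Inf (P i) \<le> s" using s by (intro cInf_lower)
      moreover have "s - D i / c \<le> Inf (P i)" using s lb by (intro cInf_greatest) auto
      ultimately show "s \<in> J i" using s by (auto simp: J_def)
    qed
    have "T \<subseteq> (\<Union>i. P i)" using C(1) unfolding P_def by blast
    then have "T \<subseteq> (\<Union>i. J i)" using PJ by blast
    then have "emeasure lborel T \<le> emeasure lborel (\<Union>i. J i)" by (intro emeasure_mono) (auto simp: J_def)
    also have "\<dots> \<le> (\<Sum>i. emeasure lborel (J i))" by (intro emeasure_subadditive_countably) (auto simp: J_def)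
    also have "\<dots> \<le> (\<Sum>i. ennreal (D i / c))" using D0 c by (intro suminf_le allI) (auto simp: J_def)
    finally have "ennreal c * emeasure lborel T \<le> ennreal c * (\<Sum>i. ennreal (D i / c))" by (rule mult_left_mono) simp
    also have "\<dots> = (\<Sum>i. ennreal c * ennreal (D i / c))" by simp
    also have "\<dots> = (\<Sum>i. ediam (C i))"
      using c D0 by (intro suminf_cong) (simp add: D flip: ennreal_mult)
    finally show "ennreal c * emeasure lborel T \<le> (\<Sum>i. ediam (C i))" .
  qed
  also have "\<dots> \<le> hausdorff1_outer (g ` T)" by (rule hausdorff1_size_le_outer) simp
  finally show ?thesis .
qed

section \<open>Curves\<close>

text \<open>Continuity on the whole line makes preimages of Borel sets Borel; a curve on
  \<open>{0..1}\<close> is extended by constants beforehand.\<close>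

locale unit_speed_curve =
  fixes \<gamma> :: "real \<Rightarrow> 'x::real_normed_vector"
  assumes cont: "continuous_on UNIV \<gamma>" and inj: "inj_on \<gamma> {0..1}"
    and speed: "AE t\<in>{0..1} in lborel. \<exists>v. (\<gamma> has_vector_derivative v) (at t within {0..1}) \<and> norm v = 1"
begin

text \<open>A fixed radius and weak inequalities make these sets closed; for \<open>c < 1\<close>
  they exhaust almost all of the interval.\<close>

definition expanding :: "real \<Rightarrow> nat \<Rightarrow> real set" where
  "expanding c n = {t \<in> {0..1}. \<forall>s\<in>{0..1}. \<bar>s - t\<bar> < 1 / real (Suc n) \<longrightarrow> c * \<bar>s - t\<bar> \<le> norm (\<gamma> s - \<gamma> t)}"

lemma closed_expanding: "closed (expanding c n)"
proof -
  have "expanding c n = {0..1} \<inter> (\<Inter>s\<in>{0..1}. {t. 1 / real (Suc n) \<le> \<bar>s - t\<bar>} \<union> {t. c * \<bar>s - t\<bar> \<le> norm (\<gamma> s - \<gamma> t)})"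
    unfolding expanding_def imp_conv_disj not_less by blast
  also have "closed \<dots>"
    by (intro closed_Int closed_INT ballI closed_Un closed_Collect_le continuous_intros cont closed_atLeastAtMost)
  finally show ?thesis .
qed

lemma expanding_mono: "m \<le> n \<Longrightarrow> expanding c m \<subseteq> expanding c n"
proof
  fix t assume mn: "m \<le> n" and t: "t \<in> expanding c m"
  have "1 / real (Suc n) \<le> 1 / real (Suc m)" using mn by (intro divide_left_mono) auto
  then show "t \<in> expanding c n" using t unfolding expanding_def by fastforce
qed

text \<open>Unit speed leaves an increment of at least \<open>\<bar>s - t\<bar>\<close> minus the
  error \<open>(1 - c) * \<bar>s - t\<bar>\<close>.\<close>

lemma AE_expanding:
  assumes c: "c < 1"
  shows "AE t in lborel. t \<in> {0..1} \<longrightarrow> t \<in> (\<Union>n. expanding c n)"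
  using speed
proof eventually_elim
  case (elim t)
  show ?case
  proof
    assume t: "t \<in> {0..1}"
    then obtain v where v: "(\<gamma> has_vector_derivative v) (at t within {0..1})" "norm v = 1" using elim by blast
    have e: "1 - c > 0" using c by simp
    obtain d where d: "d > 0" "\<And>s. s \<in> {0..1} \<Longrightarrow> norm (s - t) < d \<Longrightarrow>
        norm (\<gamma> s - \<gamma> t - (s - t) *\<^sub>R v) \<le> (1 - c) * norm (s - t)"
      using v(1)[unfolded has_vector_derivative_def has_derivative_within_alt, THEN conjunct2, THEN spec, THEN mp, OF e]
      by blast
    obtain n :: nat where n: "1 / real (Suc n) < d" using nat_approx_posE[OF d(1)] by blast
    have "c * \<bar>s - t\<bar> \<le> norm (\<gamma> s - \<gamma> t)" if s: "s \<in> {0..1}" "\<bar>s - t\<bar> < 1 / real (Suc n)" for s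
    proof -
      have "norm ((s - t) *\<^sub>R v) \<le> norm (\<gamma> s - \<gamma> t) + norm (\<gamma> s - \<gamma> t - (s - t) *\<^sub>R v)"
        using norm_triangle_ineq4[of "\<gamma> s - \<gamma> t" "\<gamma> s - \<gamma> t - (s - t) *\<^sub>R v"] by simp
      then have "\<bar>s - t\<bar> \<le> norm (\<gamma> s - \<gamma> t) + (1 - c) * \<bar>s - t\<bar>"
        using d(2)[OF s(1)] s(2) n v(2) by simp
      then show ?thesis by (simp add: algebra_simps)
    qed
    then have "t \<in> expanding c n" using t unfolding expanding_def by blast
    then show "t \<in> (\<Union>n. expanding c n)" by blast
  qed
qed

lemma vimage_borel: "S \<in> sets borel \<Longrightarrow> \<gamma> -` S \<in> sets borel"
  using measurable_sets[OF borel_measurable_continuous_onI[OF cont], of S] by simp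

text \<open>On pieces of length \<open>1 / N\<close> the expansion inequality holds between any two
  points, so \<open>hausdorff1_outer_expanding\<close> applies to each piece; injectivity keeps the
  images disjoint, and their measures add.\<close>

lemma hausdorff1_expanding:
  assumes S: "S \<in> sets borel" and c: "0 < c"
  shows "ennreal c * emeasure lborel (expanding c n \<inter> \<gamma> -` S) \<le> emeasure hausdorff1 (\<gamma> ` {0..1} \<inter> S)"
proof -
  define N where "N = real (Suc n)"
  have N: "N > 0" by (simp add: N_def)
  define E where "E = expanding c n"
  have cE: "closed E" unfolding E_def by (rule closed_expanding)
  have E01: "E \<subseteq> {0..1}" unfolding E_def expanding_def by blast
  define P where "P k = E \<inter> {real k / N..<(real k + 1) / N}" for k :: nat
  have bP: "P k \<in> sets borel" for k unfolding P_def using cE by auto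
  have floor: "k = nat \<lfloor>t * N\<rfloor>" if "t \<in> P k" for k t
  proof -
    have "real k \<le> t * N" "t * N < real k + 1" using that N by (auto simp: P_def field_simps)
    then have "\<lfloor>t * N\<rfloor> = int k" by (intro floor_unique) auto
    then show ?thesis by simp
  qed
  then have disjP: "disjoint_family P" unfolding disjoint_family_on_def by blast
  have "E \<subseteq> (\<Union>k. P k)"
  proof
    fix t assume t: "t \<in> E"
    then have t0: "0 \<le> t * N" using E01 N by auto
    define k where "k = nat \<lfloor>t * N\<rfloor>"
    have "real k \<le> t * N" "t * N < real k + 1" using t0 unfolding k_def by linarith+
    then have "t \<in> P k" using t N by (simp add: P_def pos_divide_le_eq pos_less_divide_eq)
    then show "t \<in> (\<Union>k. P k)" by blast
  qed
  then have EP: "E \<inter> \<gamma> -` S = (\<Union>k. P k \<inter> \<gamma> -` S)" unfolding P_def by blast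
  \<comment> \<open>A half-open piece is a countable union of compact sets, whose images are
    compact; thus no theorem on images of general Borel sets is involved.\<close>
  have imP: "\<gamma> ` P k \<in> sets borel" for k
  proof -
    have "P k = (\<Union>j. E \<inter> {real k / N..(real k + 1) / N - 1 / real (Suc j)})"
    proof (intro equalityI subsetI)
      fix t assume t: "t \<in> P k"
      then have "(real k + 1) / N - t > 0" by (simp add: P_def)
      then obtain j :: nat where "1 / real (Suc j) < (real k + 1) / N - t" using nat_approx_posE by blast
      then have "t \<in> E \<inter> {real k / N..(real k + 1) / N - 1 / real (Suc j)}" using t by (simp add: P_def)
      then show "t \<in> (\<Union>j. E \<inter> {real k / N..(real k + 1) / N - 1 / real (Suc j)})" by blast
    next
      fix t assume "t \<in> (\<Union>j. E \<inter> {real k / N..(real k + 1) / N - 1 / real (Suc j)})"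
      then obtain j where j: "t \<in> E" "real k / N \<le> t" "t \<le> (real k + 1) / N - 1 / real (Suc j)" by auto
      have "0 < 1 / real (Suc j)" by simp
      then have "t < (real k + 1) / N" using j(3) by linarith
      then show "t \<in> P k" using j by (simp add: P_def)
    qed
    moreover have "compact (\<gamma> ` (E \<inter> {real k / N..(real k + 1) / N - 1 / real (Suc j)}))" for j
      using cE by (intro compact_continuous_image continuous_on_subset[OF cont] closed_Int_compact compact_Icc) auto
    then have "\<gamma> ` (E \<inter> {real k / N..(real k + 1) / N - 1 / real (Suc j)}) \<in> sets borel" for j
      by (intro borel_closed compact_imp_closed)
    then have "(\<Union>j. \<gamma> ` (E \<inter> {real k / N..(real k + 1) / N - 1 / real (Suc j)})) \<in> sets borel"
      by (intro sets.countable_UN) auto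
    ultimately show ?thesis by (simp only: image_UN)
  qed
  have ex: "c * \<bar>s - t\<bar> \<le> dist (\<gamma> s) (\<gamma> t)" if "s \<in> P k" "t \<in> P k" for s t k
  proof -
    have "\<bar>s - t\<bar> < 1 / N" using that by (auto simp: P_def add_divide_distrib)
    moreover have "t \<in> expanding c n" "s \<in> {0..1}" using that E01 by (auto simp: P_def E_def)
    ultimately show ?thesis unfolding expanding_def N_def by (auto simp: dist_norm)
  qed
  have imPS: "\<gamma> ` (P k \<inter> \<gamma> -` S) = \<gamma> ` P k \<inter> S" for k by blast
  have disj: "disjoint_family (\<lambda>k. \<gamma> ` P k \<inter> S)"
    unfolding disjoint_family_on_def
  proof (intro ballI impI)
    fix k l :: nat assume kl: "k \<noteq> l"
    have "P k \<inter> P l = {}" using disjP kl by (auto simp: disjoint_family_on_def)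
    moreover have "P k \<subseteq> {0..1}" "P l \<subseteq> {0..1}" using E01 by (auto simp: P_def)
    ultimately have "\<gamma> ` P k \<inter> \<gamma> ` P l = {}" using inj_on_image_Int[OF inj, of "P k" "P l"] by simp
    then show "(\<gamma> ` P k \<inter> S) \<inter> (\<gamma> ` P l \<inter> S) = {}" by blast
  qed
  have bS: "P k \<inter> \<gamma> -` S \<in> sets borel" for k using bP vimage_borel[OF S] by auto
  have "ennreal c * emeasure lborel (E \<inter> \<gamma> -` S) = ennreal c * (\<Sum>k. emeasure lborel (P k \<inter> \<gamma> -` S))"
    unfolding EP using bS disjP
    by (subst suminf_emeasure) (auto simp: disjoint_family_on_def)
  also have "\<dots> = (\<Sum>k. ennreal c * emeasure lborel (P k \<inter> \<gamma> -` S))" by simp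
  also have "\<dots> \<le> (\<Sum>k. hausdorff1_outer (\<gamma> ` (P k \<inter> \<gamma> -` S)))"
    using bS c ex by (intro suminf_le allI hausdorff1_outer_expanding) auto
  also have "\<dots> = (\<Sum>k. emeasure hausdorff1 (\<gamma> ` P k \<inter> S))"
    using imP S by (simp add: imPS emeasure_hausdorff1)
  also have "\<dots> = emeasure hausdorff1 (\<Union>k. \<gamma> ` P k \<inter> S)"
    using imP S disj by (intro suminf_emeasure) auto
  also have "\<dots> \<le> emeasure hausdorff1 (\<gamma> ` {0..1} \<inter> S)"
  proof (rule emeasure_mono)
    show "(\<Union>k. \<gamma> ` P k \<inter> S) \<subseteq> \<gamma> ` {0..1} \<inter> S" using E01 by (auto simp: P_def)
    have "compact (\<gamma> ` {0..1})" by (intro compact_continuous_image continuous_on_subset[OF cont] compact_Icc) auto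
    then show "\<gamma> ` {0..1} \<inter> S \<in> sets hausdorff1" using S by (auto intro: borel_closed compact_imp_closed)
  qed
  finally show ?thesis by (simp add: E_def)
qed

lemma image_borel: "\<gamma> ` {0..1} \<in> sets borel"
proof -
  have "compact (\<gamma> ` {0..1})" by (intro compact_continuous_image continuous_on_subset[OF cont] compact_Icc) auto
  then show ?thesis by (intro borel_closed compact_imp_closed)
qed

text \<open>For every \<open>z < 1\<close> the sets \<open>expanding z n\<close> increase to almost
  all of the interval, which gives the inequality with the factor \<open>z\<close>; then
  \<open>z\<close> tends to 1.\<close>

lemma lborel_le_hausdorff1:
  assumes S: "S \<in> sets borel"
  shows "emeasure lborel ({0..1} \<inter> \<gamma> -` S) \<le> emeasure hausdorff1 (\<gamma> ` {0..1} \<inter> S)"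
proof (cases "emeasure hausdorff1 (\<gamma> ` {0..1} \<inter> S) = \<infinity>")
  case False
  define h where "h = enn2real (emeasure hausdorff1 (\<gamma> ` {0..1} \<inter> S))"
  have h: "emeasure hausdorff1 (\<gamma> ` {0..1} \<inter> S) = ennreal h" using False by (simp add: h_def less_top)
  have h0: "h \<ge> 0" by (simp add: h_def)
  define X where "X = {0..1} \<inter> \<gamma> -` S"
  have X: "X \<in> sets borel" unfolding X_def using vimage_borel[OF S] by auto
  have "emeasure lborel X \<le> emeasure lborel {0..1::real}" unfolding X_def by (intro emeasure_mono) auto
  then have "emeasure lborel X < \<infinity>" by (simp add: le_less_trans)
  then have x: "emeasure lborel X = ennreal (measure lborel X)" by (simp add: emeasure_eq_ennreal_measure less_top)
  have "z * measure lborel X \<le> h" if z: "0 < z" "z < 1" for z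
  proof -
    have mE: "expanding z n \<inter> \<gamma> -` S \<in> sets lborel" for n
      using closed_expanding vimage_borel[OF S] by auto
    have mU: "(\<Union>n. expanding z n \<inter> \<gamma> -` S) \<in> sets lborel" using mE by (intro sets.countable_UN) auto
    have "emeasure lborel X = emeasure lborel (\<Union>n. expanding z n \<inter> \<gamma> -` S)"
    proof (rule emeasure_eq_AE)
      show "AE t in lborel. t \<in> X \<longleftrightarrow> t \<in> (\<Union>n. expanding z n \<inter> \<gamma> -` S)"
        using AE_expanding[OF z(2)] by eventually_elim (auto simp: X_def expanding_def)
      show "X \<in> sets lborel" using X by simp
      show "(\<Union>n. expanding z n \<inter> \<gamma> -` S) \<in> sets lborel" by (rule mU)
    qed
    also have "\<dots> = (SUP n. emeasure lborel (expanding z n \<inter> \<gamma> -` S))"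
      using mE expanding_mono by (intro SUP_emeasure_incseq[symmetric]) (auto simp: incseq_def, blast)
    finally have "ennreal z * emeasure lborel X = (SUP n. ennreal z * emeasure lborel (expanding z n \<inter> \<gamma> -` S))"
      by (simp add: SUP_mult_left_ennreal)
    also have "\<dots> \<le> ennreal h" using hausdorff1_expanding[OF S z(1)] h by (intro SUP_least) simp
    finally show ?thesis unfolding x using z h0 by (simp flip: ennreal_mult)
  qed
  then have "measure lborel X \<le> h" by (rule field_le_mult_one_interval)
  then show ?thesis unfolding h X_def[symmetric] x by (rule ennreal_leI)
qed simp

text \<open>The push-forward of Lebesgue measure is dominated, set by set, by Hausdorff measure on
  the image, and domination passes to integrals.\<close>

lemma curve_integral_le:
  fixes g :: "'x \<Rightarrow> ennreal"
  assumes g: "g \<in> borel_measurable borel"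
  shows "(\<integral>\<^sup>+t\<in>{0..1}. g (\<gamma> t) \<partial>lborel) \<le> (\<integral>\<^sup>+x\<in>\<gamma> ` {0..1}. g x \<partial>hausdorff1)"
proof -
  let ?D = "density lborel (indicator {0..1})"
  let ?M = "distr ?D borel \<gamma>" and ?N = "density hausdorff1 (indicator (\<gamma> ` {0..1}))"
  have m: "\<gamma> \<in> ?D \<rightarrow>\<^sub>M borel"
    using borel_measurable_continuous_onI[OF cont] by simp
  have gh: "g \<in> borel_measurable hausdorff1" using g by (simp add: measurable_cong_sets[OF sets_hausdorff1 refl])
  have ih: "indicator (\<gamma> ` {0..1}) \<in> borel_measurable hausdorff1" using image_borel by simp
  have "emeasure ?M S \<le> emeasure ?N S" for S
  proof (cases "S \<in> sets borel")
    case True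
    have "emeasure ?M S = emeasure ?D (\<gamma> -` S)" using True by (subst emeasure_distr[OF m]) auto
    also have "\<dots> = emeasure lborel ({0..1} \<inter> \<gamma> -` S)"
      using vimage_borel[OF True]
      by (subst emeasure_density) (auto simp flip: nn_integral_indicator simp: indicator_inter_arith)
    also have "\<dots> \<le> emeasure hausdorff1 (\<gamma> ` {0..1} \<inter> S)" by (rule lborel_le_hausdorff1[OF True])
    also have "\<dots> = emeasure ?N S"
      using True image_borel ih
      by (subst emeasure_density) (auto simp flip: nn_integral_indicator simp: indicator_inter_arith)
    finally show ?thesis .
  qed (simp add: emeasure_notin_sets)
  then have "?M \<le> ?N" by (simp add: le_measure_iff le_fun_def sets_eq_imp_space_eq[OF sets_hausdorff1])
  then have "nn_integral ?M g \<le> nn_integral ?N g" by (intro nn_integral_mono_measure) auto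
  moreover have "nn_integral ?M g = (\<integral>\<^sup>+t\<in>{0..1}. g (\<gamma> t) \<partial>lborel)"
  proof -
    have gg: "(\<lambda>t. g (\<gamma> t)) \<in> borel_measurable lborel"
      using measurable_compose[OF borel_measurable_continuous_onI[OF cont] g] by simp
    have "nn_integral ?M g = (\<integral>\<^sup>+t. g (\<gamma> t) \<partial>?D)" by (rule nn_integral_distr[OF m]) (use g in simp)
    also have "\<dots> = (\<integral>\<^sup>+t. indicator {0..1} t * g (\<gamma> t) \<partial>lborel)"
      by (rule nn_integral_density[OF _ gg]) simp
    finally show ?thesis by (simp add: mult.commute)
  qed
  moreover have "nn_integral ?N g = (\<integral>\<^sup>+x\<in>\<gamma> ` {0..1}. g x \<partial>hausdorff1)"
    using nn_integral_density[OF ih gh] by (simp add: mult.commute)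
  ultimately show ?thesis by simp
qed

end

section \<open>The derivative along a curve\<close>

context lipschitz_Q_banach
begin

lemma approx_deriv_norm_tup:
  assumes "approx_deriv Q \<mu> f x = tup Q Ls"
  shows "approx_deriv_norm \<nu> Q \<mu> f x = L2_set (\<lambda>i. \<nu> (Ls i)) {..<Q}"
  unfolding approx_deriv_norm_def assms sum_mset_tup L2_set_def ..

text \<open>The size of the derivative is its distance to the zero tuple, which links it to the
  metric behind \<open>qborel\<close>.\<close>

lemma qdist_zero_tup:
  fixes Ls :: "nat \<Rightarrow> 'x \<Rightarrow>\<^sub>L 'y"
  shows "qdist (\<lambda>L L'. \<nu> (L - L')) (tup Q Ls) (tup Q (\<lambda>_. 0)) = L2_set (\<lambda>i. \<nu> (Ls i)) {..<Q}"
proof -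
  obtain \<sigma> where "qdist (\<lambda>L L'. \<nu> (L - L')) (tup Q Ls) (tup Q (\<lambda>_. 0)) = L2_set (\<lambda>i. \<nu> (Ls i - 0)) {..<Q}"
    by (rule qdist_tup_perm[of Q "\<lambda>L L'. \<nu> (L - L')" Ls "\<lambda>_. 0"])
  then show ?thesis by simp
qed

lemma approx_deriv_in_qtuples:
  assumes "approx_differentiable Q \<mu> f x"
  obtains Ls where "approx_deriv Q \<mu> f x = tup Q Ls"
proof -
  obtain As where As: "qdiff Q f x As" using assms unfolding approx_differentiable_iff by blast
  obtain ys Ls where "As = tup Q (\<lambda>i. aff x (ys i) (Ls i))" using As by (rule qdiff_aff_tup)
  then show thesis using that As approx_deriv_eq by blast
qed

text \<open>Superlevel sets are preimages of the open sets of tuples at distance greater than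
  \<open>a\<close> from the zero tuple; the value 0 off the domain makes the function total.\<close>

lemma borel_measurable_approx_deriv_norm:
  assumes \<nu>: "is_norm \<nu>" "continuous_on UNIV \<nu>"
  shows "(\<lambda>x. if approx_differentiable Q \<mu> f x then approx_deriv_norm \<nu> Q \<mu> f x else 0) \<in> borel_measurable borel"
proof -
  let ?D = "{x. approx_differentiable Q \<mu> f x}"
  let ?d = "\<lambda>L L' :: 'x \<Rightarrow>\<^sub>L 'y. \<nu> (L - L')"
  let ?Z = "tup Q (\<lambda>_. 0 :: 'x \<Rightarrow>\<^sub>L 'y)"
  let ?u = "\<lambda>x. if approx_differentiable Q \<mu> f x then approx_deriv_norm \<nu> Q \<mu> f x else 0"
  interpret V: Metric_space "qtuples Q" "qdist ?d"
    by (intro Metric_space_qdist Metric_space_is_norm \<nu>)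
  have "{x. a < ?u x} \<in> sets borel" for a
  proof -
    let ?U = "{M \<in> qtuples Q. a < qdist ?d M ?Z}"
    have "openin V.mtopology ?U"
      unfolding V.openin_mtopology
    proof (intro conjI allI impI)
      fix M assume M: "M \<in> ?U"
      have "V.mball M (qdist ?d M ?Z - a) \<subseteq> ?U"
      proof
        fix N assume "N \<in> V.mball M (qdist ?d M ?Z - a)"
        then have N: "N \<in> qtuples Q" "qdist ?d M N < qdist ?d M ?Z - a" by (auto simp: V.in_mball)
        have "qdist ?d M ?Z \<le> qdist ?d M N + qdist ?d N ?Z" using M N by (intro V.triangle) auto
        then show "N \<in> ?U" using N by simp
      qed
      then show "\<exists>r>0. V.mball M r \<subseteq> ?U" using M by (intro exI[of _ "qdist ?d M ?Z - a"]) simp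
    qed blast
    then have "?U \<in> sets (qborel Q ?d)" unfolding qborel_def
      using V.openin_mtopology by (subst sets_measure_of) auto
    then have "approx_deriv Q \<mu> f -` ?U \<inter> space (restrict_space borel ?D) \<in> sets (restrict_space borel ?D)"
      by (rule measurable_sets[OF measurable_approx_deriv[OF \<nu>]])
    then have b: "approx_deriv Q \<mu> f -` ?U \<inter> ?D \<in> sets borel"
      using borel_approx_differentiable by (simp add: space_restrict_space sets_restrict_space_iff)
    have "{x. a < ?u x} = (approx_deriv Q \<mu> f -` ?U \<inter> ?D) \<union> (if a < 0 then - ?D else {})"
    proof (intro set_eqI)
      fix x
      show "x \<in> {x. a < ?u x} \<longleftrightarrow> x \<in> (approx_deriv Q \<mu> f -` ?U \<inter> ?D) \<union> (if a < 0 then - ?D else {})"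
      proof (cases "approx_differentiable Q \<mu> f x")
        case True
        then obtain Ls where "approx_deriv Q \<mu> f x = tup Q Ls" by (rule approx_deriv_in_qtuples)
        then show ?thesis using True by (simp add: approx_deriv_norm_tup qdist_zero_tup)
      qed simp
    qed
    then show ?thesis using b borel_approx_differentiable by (auto intro: borel_comp)
  qed
  then show ?thesis by (intro borel_measurable_iff_greater[THEN iffD2]) auto
qed

text \<open>Each affine branch at \<open>\<gamma> s\<close> is paired with its own value at
  \<open>\<gamma> t\<close>; an upper bound does not require an optimal matching.\<close>

lemma qdist_difference_quotient:
  assumes v: "(\<gamma> has_vector_derivative v) (at t within {0..1})"
    and A: "qdiff Q f (\<gamma> t) (tup Q (\<lambda>i. aff (\<gamma> t) (ys i) (Ls i)))"
    and C: "C-lipschitz_on {0..1} \<gamma>" and t: "t \<in> {0..1}" and e: "e > 0"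
  shows "\<exists>d>0. \<forall>s\<in>{0..1}. \<bar>s - t\<bar> < d \<longrightarrow>
    qdist dist (f (\<gamma> s)) (f (\<gamma> t)) \<le> (L2_set (\<lambda>i. norm (blinfun_apply (Ls i) v)) {..<Q} + e) * \<bar>s - t\<bar>"
proof -
  let ?As = "tup Q (\<lambda>i. aff (\<gamma> t) (ys i) (Ls i))"
  define A0 where "A0 = L2_set (\<lambda>i. norm (blinfun_apply (Ls i) v)) {..<Q}"
  define S where "S = (\<Sum>i<Q. norm (Ls i))"
  have S: "S \<ge> 0" by (simp add: S_def sum_nonneg)
  have C0': "C \<ge> 0" using C by (rule lipschitz_on_nonneg)
  \<comment> \<open>\<open>C\<close> multiplies the error of the affine approximation along the
    curve, \<open>S\<close> the error \<open>\<rho>\<close> of the curve against its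
    tangent.\<close>
  define \<epsilon> where "\<epsilon> = e / (C + S + 1)"
  have \<epsilon>: "\<epsilon> > 0" using e C0' S by (simp add: \<epsilon>_def)
  have \<epsilon>e: "(C + S) * \<epsilon> \<le> e"
  proof -
    have "(C + S) * \<epsilon> \<le> (C + S + 1) * \<epsilon>" using \<epsilon> by (intro mult_right_mono) auto
    also have "\<dots> = e" using C0' S by (simp add: \<epsilon>_def)
    finally show ?thesis .
  qed
  from A[unfolded qdiff_def, THEN conjunct2, THEN conjunct2, THEN spec, THEN mp, OF \<epsilon>]
  obtain d1 where d1: "d1 > 0" "\<And>x. norm (x - \<gamma> t) < d1 \<Longrightarrow> qdist dist (f x) (qeval ?As x) \<le> \<epsilon> * norm (x - \<gamma> t)"
    by blast
  obtain d2 where d2: "d2 > 0" "\<And>s. s \<in> {0..1} \<Longrightarrow> norm (s - t) < d2 \<Longrightarrow>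
      norm (\<gamma> s - \<gamma> t - (s - t) *\<^sub>R v) \<le> \<epsilon> * norm (s - t)"
    using v[unfolded has_vector_derivative_def has_derivative_within_alt, THEN conjunct2, THEN spec, THEN mp, OF \<epsilon>]
    by blast
  define d where "d = min d2 (d1 / (C + 1))"
  have d: "d > 0" using d1 d2 C0' by (simp add: d_def)
  have "qdist dist (f (\<gamma> s)) (f (\<gamma> t)) \<le> (A0 + e) * \<bar>s - t\<bar>" if s: "s \<in> {0..1}" "\<bar>s - t\<bar> < d" for s
  proof -
    have g: "norm (\<gamma> s - \<gamma> t) \<le> C * \<bar>s - t\<bar>"
      using lipschitz_onD[OF C s(1) t] by (simp add: dist_norm)
    also have "\<dots> \<le> (C + 1) * \<bar>s - t\<bar>" by (intro mult_right_mono) auto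
    also have "\<dots> < (C + 1) * (d1 / (C + 1))" using s(2) C0' by (intro mult_strict_left_mono) (auto simp: d_def)
    also have "\<dots> = d1" using C0' by simp
    finally have g1: "norm (\<gamma> s - \<gamma> t) < d1" .
    define \<rho> where "\<rho> = \<gamma> s - \<gamma> t - (s - t) *\<^sub>R v"
    have \<rho>: "norm \<rho> \<le> \<epsilon> * \<bar>s - t\<bar>" using d2(2)[OF s(1)] s(2) by (simp add: \<rho>_def d_def)
    have fa: "f (\<gamma> t) = tup Q ys" using qdiff_value[OF A] by (simp add: qeval_tup)
    have "qdist dist (f (\<gamma> s)) (f (\<gamma> t)) \<le> qdist dist (f (\<gamma> s)) (qeval ?As (\<gamma> s)) + qdist dist (qeval ?As (\<gamma> s)) (f (\<gamma> t))"
      by (rule qdist_dist_triangle[of _ Q]) (auto simp: qeval_aff)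
    also have "qdist dist (f (\<gamma> s)) (qeval ?As (\<gamma> s)) \<le> \<epsilon> * (C * \<bar>s - t\<bar>)"
      by (rule order_trans[OF d1(2)[OF g1] mult_left_mono[OF g less_imp_le[OF \<epsilon>]]])
    also have "qdist dist (qeval ?As (\<gamma> s)) (f (\<gamma> t)) \<le> L2_set (\<lambda>i. dist (ys i + blinfun_apply (Ls i) (\<gamma> s - \<gamma> t)) (ys i)) {..<Q}"
      unfolding qeval_aff fa by (rule qdist_tup_le)
    also have "\<dots> = L2_set (\<lambda>i. norm (blinfun_apply (Ls i) (\<gamma> s - \<gamma> t))) {..<Q}"
      by (simp add: dist_norm)
    also have "\<dots> \<le> L2_set (\<lambda>i. \<bar>s - t\<bar> * norm (blinfun_apply (Ls i) v) + norm (Ls i) * norm \<rho>) {..<Q}"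
    proof (rule L2_set_mono)
      fix i
      have "blinfun_apply (Ls i) (\<gamma> s - \<gamma> t) = (s - t) *\<^sub>R blinfun_apply (Ls i) v + blinfun_apply (Ls i) \<rho>"
        by (simp add: \<rho>_def blinfun.diff_right blinfun.scaleR_right)
      then have "norm (blinfun_apply (Ls i) (\<gamma> s - \<gamma> t)) \<le> \<bar>s - t\<bar> * norm (blinfun_apply (Ls i) v) + norm (blinfun_apply (Ls i) \<rho>)"
        by (metis norm_triangle_ineq norm_scaleR)
      then show "norm (blinfun_apply (Ls i) (\<gamma> s - \<gamma> t)) \<le> \<bar>s - t\<bar> * norm (blinfun_apply (Ls i) v) + norm (Ls i) * norm \<rho>"
        using norm_blinfun[of "Ls i" \<rho>] by linarith
    qed simp
    also have "\<dots> \<le> L2_set (\<lambda>i. \<bar>s - t\<bar> * norm (blinfun_apply (Ls i) v)) {..<Q} + L2_set (\<lambda>i. norm (Ls i) * norm \<rho>) {..<Q}"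
      by (rule L2_set_triangle_ineq)
    also have "L2_set (\<lambda>i. \<bar>s - t\<bar> * norm (blinfun_apply (Ls i) v)) {..<Q} = \<bar>s - t\<bar> * A0"
      unfolding A0_def by (rule L2_set_right_distrib[symmetric]) simp
    also have "L2_set (\<lambda>i. norm (Ls i) * norm \<rho>) {..<Q} \<le> S * norm \<rho>"
      unfolding S_def sum_distrib_right by (rule L2_set_le_sum) simp
    also have "S * norm \<rho> \<le> S * (\<epsilon> * \<bar>s - t\<bar>)" using \<rho> S by (rule mult_left_mono)
    finally have "qdist dist (f (\<gamma> s)) (f (\<gamma> t)) \<le> A0 * \<bar>s - t\<bar> + ((C + S) * \<epsilon>) * \<bar>s - t\<bar>"
      by (simp add: algebra_simps)
    also have "\<dots> \<le> A0 * \<bar>s - t\<bar> + e * \<bar>s - t\<bar>" using \<epsilon>e by (intro add_left_mono mult_right_mono) auto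
    finally show ?thesis by (simp add: algebra_simps)
  qed
  then show ?thesis using d unfolding A0_def by blast
qed

end

text \<open>Only \<open>s\<close> in \<open>{0..1}\<close> are controlled, so increments to the
  right of the interior point \<open>t\<close> are used.\<close>

lemma vector_derivative_norm_le:
  fixes \<psi> :: "real \<Rightarrow> 'y::real_normed_vector"
  assumes der: "(\<psi> has_vector_derivative w) (at t)" and t: "0 < t" "t < 1"
    and le: "\<And>e. e > 0 \<Longrightarrow> \<exists>d>0. \<forall>s\<in>{0..1}. \<bar>s - t\<bar> < d \<longrightarrow> norm (\<psi> s - \<psi> t) \<le> (A + e) * \<bar>s - t\<bar>"
  shows "norm w \<le> A"
proof (rule field_le_epsilon)
  fix e :: real assume "e > 0"
  then have e: "e / 2 > 0" by simp
  obtain d1 where d1: "d1 > 0" "\<And>s. norm (s - t) < d1 \<Longrightarrow> norm (\<psi> s - \<psi> t - (s - t) *\<^sub>R w) \<le> e / 2 * norm (s - t)"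
    using der[unfolded has_vector_derivative_def has_derivative_at_alt, THEN conjunct2, THEN spec, THEN mp, OF e] by blast
  obtain d2 where d2: "d2 > 0" "\<And>s. s \<in> {0..1} \<Longrightarrow> \<bar>s - t\<bar> < d2 \<Longrightarrow> norm (\<psi> s - \<psi> t) \<le> (A + e / 2) * \<bar>s - t\<bar>"
    using le[OF e] by blast
  define r where "r = min (min d1 d2) (1 - t) / 2"
  have r: "r > 0" "r < d1" "r < d2" "t + r \<le> 1"
  proof -
    have "r \<le> (1 - t) / 2" unfolding r_def by (intro divide_right_mono) auto
    then show "t + r \<le> 1" using t by (simp add: field_simps)
  qed (use d1(1) d2(1) t in \<open>auto simp: r_def\<close>)
  have 1: "norm (\<psi> (t + r) - \<psi> t - r *\<^sub>R w) \<le> e / 2 * r" using d1(2)[of "t + r"] r by simp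
  have 2: "norm (\<psi> (t + r) - \<psi> t) \<le> (A + e / 2) * r" using d2(2)[of "t + r"] r t by simp
  have "norm (r *\<^sub>R w) \<le> norm (\<psi> (t + r) - \<psi> t) + norm (\<psi> (t + r) - \<psi> t - r *\<^sub>R w)"
    using norm_triangle_ineq4[of "\<psi> (t + r) - \<psi> t" "\<psi> (t + r) - \<psi> t - r *\<^sub>R w"] by simp
  then have "r * norm w \<le> (A + e / 2) * r + e / 2 * r" using 1 2 r by simp
  also have "\<dots> = r * (A + e)" by (simp add: algebra_simps)
  finally show "norm w \<le> A + e" using r by simp
qed

context lipschitz_Q_RNP
begin

text \<open>The distance from \<open>f (\<gamma> t)\<close> to \<open>f (\<gamma> 0)\<close>, times
  a unit vector of \<open>'y\<close>, is a Lipschitz curve in a space with the Radon-Nikodym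
  property. It is therefore the integral of its derivative, which is bounded by the size of the
  derivative of \<open>f\<close>.\<close>

theorem qdist_curve_le:
  fixes \<gamma> :: "real \<Rightarrow> 'x"
  assumes \<nu>: "is_norm \<nu>" "continuous_on UNIV \<nu>" "\<And>L. norm L \<le> \<nu> L"
    and inj: "inj_on \<gamma> {0..1}" and C: "C-lipschitz_on {0..1} \<gamma>"
    and ae: "AE t\<in>{0..1} in lborel. (\<exists>v. (\<gamma> has_vector_derivative v) (at t within {0..1}) \<and> norm v = 1)
      \<and> approx_differentiable Q \<mu> f (\<gamma> t)"
  shows "ennreal (qdist dist (f (\<gamma> 1)) (f (\<gamma> 0)))
    \<le> (\<integral>\<^sup>+x\<in>\<gamma> ` {0..1}. ennreal (approx_deriv_norm \<nu> Q \<mu> f x) \<partial>hausdorff1)"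
proof (cases "\<exists>y::'y. y \<noteq> 0")
  case False
  then have "f (\<gamma> 1) = f (\<gamma> 0)" using constant_if_trivial by blast
  then have "qdist dist (f (\<gamma> 1)) (f (\<gamma> 0)) = 0" using qdist_dist_zero_iff[of "f (\<gamma> 1)" Q "f (\<gamma> 0)"] by simp
  then show ?thesis by simp
next
  case True
  then obtain y :: 'y where "y \<noteq> 0" by blast
  define y0 where "y0 = (1 / norm y) *\<^sub>R y"
  have y0: "norm y0 = 1" using \<open>y \<noteq> 0\<close> by (simp add: y0_def)
  \<comment> \<open>Extension by constants, since the lemmas on curves ask for the whole
    line.\<close>
  define \<gamma>' where "\<gamma>' t = \<gamma> (max 0 (min 1 t))" for t
  have eq: "\<gamma>' t = \<gamma> t" if "t \<in> {0..1}" for t using that by (simp add: \<gamma>'_def)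
  have im: "\<gamma>' ` {0..1} = \<gamma> ` {0..1}" by (rule image_cong[OF refl eq])
  have C0': "C \<ge> 0" using C by (rule lipschitz_on_nonneg)
  have lip': "dist (\<gamma>' s) (\<gamma>' t) \<le> C * dist s t" for s t
  proof -
    have "dist (\<gamma>' s) (\<gamma>' t) \<le> C * dist (max 0 (min 1 s)) (max 0 (min 1 t))"
      unfolding \<gamma>'_def using C by (rule lipschitz_onD) auto
    also have "\<dots> \<le> C * dist s t"
      using clamp_lipschitz[of s t] C0' by (intro mult_left_mono) (auto simp: dist_real_def)
    finally show ?thesis .
  qed
  have C': "C-lipschitz_on {0..1} \<gamma>'" using lip' C0' by (intro lipschitz_onI) auto
  have ae': "AE t\<in>{0..1} in lborel. (\<exists>v. (\<gamma>' has_vector_derivative v) (at t within {0..1}) \<and> norm v = 1)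
      \<and> approx_differentiable Q \<mu> f (\<gamma>' t)"
    using ae
  proof eventually_elim
    case (elim t)
    show ?case
    proof
      assume t: "t \<in> {0..1}"
      have "(\<gamma>' has_vector_derivative v) (at t within {0..1})" if "(\<gamma> has_vector_derivative v) (at t within {0..1})" for v
        unfolding has_vector_derivative_def
      proof (rule has_derivative_transform[OF t])
        show "(\<gamma> has_derivative (\<lambda>r. r *\<^sub>R v)) (at t within {0..1})"
          using that by (simp add: has_vector_derivative_def)
      qed (rule eq)
      then show "(\<exists>v. (\<gamma>' has_vector_derivative v) (at t within {0..1}) \<and> norm v = 1) \<and> approx_differentiable Q \<mu> f (\<gamma>' t)"
        using elim t eq[OF t] by auto
    qed
  qed
  interpret curve: unit_speed_curve \<gamma>'
  proof
    show "continuous_on UNIV \<gamma>'" using lip' by (rule lipschitz_imp_continuous_UNIV)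
    show "inj_on \<gamma>' {0..1}" using inj eq by (auto simp: inj_on_def)
    show "AE t\<in>{0..1} in lborel. \<exists>v. (\<gamma>' has_vector_derivative v) (at t within {0..1}) \<and> norm v = 1"
      using ae' by eventually_elim blast
  qed
  define \<psi> where "\<psi> t = qdist dist (f (\<gamma>' t)) (f (\<gamma>' 0)) *\<^sub>R y0" for t
  have \<psi>_le: "norm (\<psi> s - \<psi> t) \<le> qdist dist (f (\<gamma>' s)) (f (\<gamma>' t))" for s t
  proof -
    have "qdist dist (f (\<gamma>' s)) (f (\<gamma>' 0)) \<le> qdist dist (f (\<gamma>' s)) (f (\<gamma>' t)) + qdist dist (f (\<gamma>' t)) (f (\<gamma>' 0))"
      "qdist dist (f (\<gamma>' t)) (f (\<gamma>' 0)) \<le> qdist dist (f (\<gamma>' t)) (f (\<gamma>' s)) + qdist dist (f (\<gamma>' s)) (f (\<gamma>' 0))"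
      by (rule qdist_dist_triangle[of _ Q], auto)+
    then have "\<bar>qdist dist (f (\<gamma>' s)) (f (\<gamma>' 0)) - qdist dist (f (\<gamma>' t)) (f (\<gamma>' 0))\<bar> \<le> qdist dist (f (\<gamma>' s)) (f (\<gamma>' t))"
      using qdist_dist_commute[of "f (\<gamma>' s)" "f (\<gamma>' t)"] by linarith
    then show ?thesis using y0 by (simp add: \<psi>_def flip: scaleR_left_diff_distrib)
  qed
  interpret win: lipschitz_curve_window \<psi> "C0 * C" 1
  proof
    show "0 \<le> C0 * C" using C0 C0' by simp
    show "norm (\<psi> s - \<psi> t) \<le> C0 * C * \<bar>s - t\<bar>" for s t
    proof -
      have "qdist dist (f (\<gamma>' s)) (f (\<gamma>' t)) \<le> C0 * norm (\<gamma>' s - \<gamma>' t)" by (rule lipf)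
      also have "\<dots> \<le> C0 * (C * \<bar>s - t\<bar>)" using lip'[of s t] C0 by (intro mult_left_mono) (auto simp: dist_norm)
      finally show ?thesis using \<psi>_le[of s t] by (simp add: mult.assoc)
    qed
  qed simp
  obtain h where h: "set_integrable lborel {-1<..1} h"
    "\<And>a b. - 1 \<le> a \<Longrightarrow> a \<le> b \<Longrightarrow> b \<le> 1 \<Longrightarrow> \<psi> b - \<psi> a = (LINT s:{a<..b}|lborel. h s)"
    "AE t in lborel. - 1 < t \<and> t < 1 \<longrightarrow> (\<psi> has_vector_derivative h t) (at t)"
    using win.RNP_derivative[OF rnp] by blast
  \<comment> \<open>Set to 0 off the domain of the derivative: this version is Borel and lies below
    the integrand of the claim, which is unspecified there.\<close>
  define k where "k x = ennreal (if approx_differentiable Q \<mu> f x then approx_deriv_norm \<nu> Q \<mu> f x else 0)" for x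
  have k: "k \<in> borel_measurable borel"
    unfolding k_def using borel_measurable_approx_deriv_norm[OF \<nu>(1,2)] by measurable
  \<comment> \<open>The window provides derivatives only for \<open>t < 1\<close>.\<close>
  have AE1: "AE t in lborel. t \<noteq> (1::real)" by (rule AE_lborel_singleton)
  have "AE t in lborel. ennreal (norm (indicat_real {0<..1} t *\<^sub>R h t)) \<le> k (\<gamma>' t) * indicator {0..1} t"
    using ae' h(3) AE1
  proof eventually_elim
    case (elim t)
    show ?case
    proof (cases "t \<in> {0<..1}")
      case True
      then have t: "0 < t" "t < 1" "t \<in> {0..1}" using elim(3) by auto
      obtain v where v: "(\<gamma>' has_vector_derivative v) (at t within {0..1})" "norm v = 1"
        and ad: "approx_differentiable Q \<mu> f (\<gamma>' t)" using elim(1) t(3) by blast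
      obtain As where As: "qdiff Q f (\<gamma>' t) As" using ad unfolding approx_differentiable_iff by blast
      obtain ys Ls where "As = tup Q (\<lambda>i. aff (\<gamma>' t) (ys i) (Ls i))" using As by (rule qdiff_aff_tup)
      then have q: "qdiff Q f (\<gamma>' t) (tup Q (\<lambda>i. aff (\<gamma>' t) (ys i) (Ls i)))" using As by simp
      have "norm (h t) \<le> L2_set (\<lambda>i. norm (blinfun_apply (Ls i) v)) {..<Q}"
      proof (rule vector_derivative_norm_le[OF _ t(1,2)])
        show "(\<psi> has_vector_derivative h t) (at t)" using elim(2) t by simp
        fix e :: real assume "e > 0"
        then obtain d where "d > 0" "\<And>s. s \<in> {0..1} \<Longrightarrow> \<bar>s - t\<bar> < d \<Longrightarrow>
          qdist dist (f (\<gamma>' s)) (f (\<gamma>' t)) \<le> (L2_set (\<lambda>i. norm (blinfun_apply (Ls i) v)) {..<Q} + e) * \<bar>s - t\<bar>"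
          using qdist_difference_quotient[OF v(1) q C' t(3)] by blast
        then show "\<exists>d>0. \<forall>s\<in>{0..1}. \<bar>s - t\<bar> < d \<longrightarrow> norm (\<psi> s - \<psi> t) \<le> (L2_set (\<lambda>i. norm (blinfun_apply (Ls i) v)) {..<Q} + e) * \<bar>s - t\<bar>"
          using \<psi>_le order_trans by blast
      qed
      also have "\<dots> \<le> L2_set (\<lambda>i. \<nu> (Ls i)) {..<Q}"
      proof (rule L2_set_mono)
        fix i
        have "norm (blinfun_apply (Ls i) v) \<le> norm (Ls i) * norm v" by (rule norm_blinfun)
        then show "norm (blinfun_apply (Ls i) v) \<le> \<nu> (Ls i)" using v(2) \<nu>(3)[of "Ls i"] by simp
      qed simp
      also have "\<dots> = approx_deriv_norm \<nu> Q \<mu> f (\<gamma>' t)"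
        using approx_deriv_norm_tup[OF approx_deriv_eq[OF q]] by simp
      finally have "ennreal (norm (h t)) \<le> k (\<gamma>' t)" using ad by (simp add: k_def ennreal_leI)
      then show ?thesis using True t(3) by simp
    qed simp
  qed
  then have "(\<integral>\<^sup>+t. ennreal (norm (indicat_real {0<..1} t *\<^sub>R h t)) \<partial>lborel) \<le> (\<integral>\<^sup>+t\<in>{0..1}. k (\<gamma>' t) \<partial>lborel)"
    by (rule nn_integral_mono_AE)
  also have "\<dots> \<le> (\<integral>\<^sup>+x\<in>\<gamma>' ` {0..1}. k x \<partial>hausdorff1)" by (rule curve.curve_integral_le[OF k])
  also have "\<dots> \<le> (\<integral>\<^sup>+x\<in>\<gamma> ` {0..1}. ennreal (approx_deriv_norm \<nu> Q \<mu> f x) \<partial>hausdorff1)"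
    unfolding im by (intro nn_integral_mono mult_right_mono) (auto simp: k_def)
  finally have le: "(\<integral>\<^sup>+t. ennreal (norm (indicat_real {0<..1} t *\<^sub>R h t)) \<partial>lborel)
    \<le> (\<integral>\<^sup>+x\<in>\<gamma> ` {0..1}. ennreal (approx_deriv_norm \<nu> Q \<mu> f x) \<partial>hausdorff1)" .
  have hi: "set_integrable lborel {0<..1} h" using h(1) by (rule set_integrable_subset) auto
  have "qdist dist (f (\<gamma> 1)) (f (\<gamma> 0)) = norm (\<psi> 1 - \<psi> 0)"
    using y0 eq[of 0] eq[of 1] qdist_dist_zero_iff[of "f (\<gamma> 0)" Q "f (\<gamma> 0)"] by (simp add: \<psi>_def)
  also have "\<psi> 1 - \<psi> 0 = (\<integral>t. indicat_real {0<..1} t *\<^sub>R h t \<partial>lborel)"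
    using h(2)[of 0 1] by (simp add: set_lebesgue_integral_def)
  finally have "ennreal (qdist dist (f (\<gamma> 1)) (f (\<gamma> 0))) \<le> (\<integral>\<^sup>+t. ennreal (norm (indicat_real {0<..1} t *\<^sub>R h t)) \<partial>lborel)"
    using hi unfolding set_integrable_def by (simp only:) (rule integral_norm_bound_ennreal)
  then show ?thesis using le by (rule order_trans)
qed

end

text \<open>Rescaling \<open>\<nu>\<close> rescales the size of the derivative but neither
  \<open>qLip f\<close> nor \<open>qdist dist\<close>. So the bound by the Lipschitz constant is
  stated for \<open>\<nu>\<close> below the operator norm and the curve inequality for
  \<open>\<nu>\<close> above it. For infinite-dimensional \<open>'y\<close> a norm on the operators
  can fail to be continuous, hence the continuity assumption. The domain of the derivative is
  claimed to be Borel because the derivative is a map on that domain.\<close>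

theorem theorem2p5p8:
  fixes f :: "'x::banach \<Rightarrow> 'y::{banach, second_countable_topology} multiset"
    and Q :: nat
    and \<mu> :: "'x measure"
    and \<nu> :: "('x \<Rightarrow>\<^sub>L 'y) \<Rightarrow> real"
  assumes "Q \<ge> 1"
    and "finite_dimensional TYPE('x)"
    and "haar_measure \<mu>"
    and "radon_nikodym_property TYPE('y)"
    and "\<forall>x. f x \<in> qtuples Q"
    and "qlipschitz f"
    and "is_norm \<nu>"
    and "continuous_on UNIV \<nu>"
  shows
    "(AE a in \<mu>. unambiguously_approx_differentiable Q \<mu> f a \<and> qeval (approx_affine Q \<mu> f a) a = f a)
     \<and>
     ({x. approx_differentiable Q \<mu> f x} \<in> sets borel
      \<and> approx_deriv Q \<mu> f \<in> restrict_space borel {x. approx_differentiable Q \<mu> f x}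
            \<rightarrow>\<^sub>M qborel Q (\<lambda>L L'. \<nu> (L - L')))
     \<and>
     (\<forall>a. approx_differentiable Q \<mu> f a \<longrightarrow>
        ((\<lambda>x. qdist dist (f x) (qeval (approx_affine Q \<mu> f a) x) / norm (x - a)) \<longlongrightarrow> 0) (at a)
        \<and> ((\<forall>L. \<nu> L \<le> norm L) \<longrightarrow> approx_deriv_norm \<nu> Q \<mu> f a \<le> sqrt (real Q) * qLip f))
     \<and>
     ((\<forall>L. norm L \<le> \<nu> L) \<longrightarrow>
        (\<forall>\<gamma>::real \<Rightarrow> 'x.
           inj_on \<gamma> {0..1} \<longrightarrow> (\<exists>C. C-lipschitz_on {0..1} \<gamma>) \<longrightarrow>
           (AE t\<in>{0..1} in lborel.
              (\<exists>v. (\<gamma> has_vector_derivative v) (at t within {0..1}) \<and> norm v = 1)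
              \<and> approx_differentiable Q \<mu> f (\<gamma> t)) \<longrightarrow>
           ennreal (qdist dist (f (\<gamma> 1)) (f (\<gamma> 0)))
             \<le> (\<integral>\<^sup>+x\<in>\<gamma> ` {0..1}. ennreal (approx_deriv_norm \<nu> Q \<mu> f x) \<partial>hausdorff1)))"
proof -
  obtain b :: "nat \<Rightarrow> 'x" and n K where fd: "fd_basis b n K"
    using assms(2) by (rule finite_dimensional_fd_basis)
  interpret fd_haar b n K \<mu>
    using fd assms(3) by (intro fd_haar.intro fd_haar_axioms.intro)
  \<comment> \<open>The least Lipschitz constant is used, so that the bound on the derivative comes
    out with \<open>qLip f\<close>.\<close>
  interpret lipschitz_Q_RNP b n K \<mu> f Q "qLip f"
    by unfold_locales (use assms(4,5) qLip_bound[OF assms(6)] in \<open>auto simp: dist_norm\<close>)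
  have "((\<lambda>x. qdist dist (f x) (qeval (approx_affine Q \<mu> f a) x) / norm (x - a)) \<longlongrightarrow> 0) (at a)
        \<and> ((\<forall>L. \<nu> L \<le> norm L) \<longrightarrow> approx_deriv_norm \<nu> Q \<mu> f a \<le> sqrt (real Q) * qLip f)"
    if ad: "approx_differentiable Q \<mu> f a" for a
  proof
    obtain As where As: "qdiff Q f a As" using ad unfolding approx_differentiable_iff by blast
    then show "((\<lambda>x. qdist dist (f x) (qeval (approx_affine Q \<mu> f a) x) / norm (x - a)) \<longlongrightarrow> 0) (at a)"
      using qdiff_tendsto approx_affine_eq by simp
    obtain ys Ls where "As = tup Q (\<lambda>i. aff a (ys i) (Ls i))" using As by (rule qdiff_aff_tup)
    then have q: "qdiff Q f a (tup Q (\<lambda>i. aff a (ys i) (Ls i)))" using As by simp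
    show "(\<forall>L. \<nu> L \<le> norm L) \<longrightarrow> approx_deriv_norm \<nu> Q \<mu> f a \<le> sqrt (real Q) * qLip f"
    proof
      assume le: "\<forall>L. \<nu> L \<le> norm L"
      have "L2_set (\<lambda>i. \<nu> (Ls i)) {..<Q} \<le> L2_set (\<lambda>i. qLip f) {..<Q}"
      proof (rule L2_set_mono)
        fix i assume "i \<in> {..<Q}"
        then have "norm (Ls i) \<le> qLip f" using qdiff_norm_le[OF q] by simp
        then show "\<nu> (Ls i) \<le> qLip f" using le order_trans by blast
        show "0 \<le> \<nu> (Ls i)" using assms(7) by (simp add: is_norm_def)
      qed
      also have "\<dots> = sqrt (real Q) * qLip f"
        using C0 by (simp add: L2_set_def real_sqrt_mult)
      finally show "approx_deriv_norm \<nu> Q \<mu> f a \<le> sqrt (real Q) * qLip f"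
        by (simp add: approx_deriv_norm_tup[OF approx_deriv_eq[OF q]])
    qed
  qed
  then show ?thesis
    using AE_unambiguous borel_approx_differentiable measurable_approx_deriv[OF assms(7,8)]
      qdist_curve_le[OF assms(7,8)]
    by blast
qed

end
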